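(* Let $\kappa$ be either an infinite regular cardinal or $\infty$. (a) An endofunctor of $\mathbf{Set}$ is an object of $\mathbf{San}_\kappa$ if and only if it is $\kappa$-accessible, preserves pullbacks along monomorphisms, and preserves wide pullbacks of monomorphisms. (b) An endofunctor of $\mathbf{Set}$ is an object of $\mathbf{SAN}$ if and only if it preserves pullbacks along monomorphisms and wide pullbacks of monomorphisms. (c) In each of the categories $\mathbf{San}_\kappa$ and $\mathbf{SAN}$, the morphisms between two objects are exactly the semi-cartesian natural transformations between them.
   Context: A cardinal number is the least ordinal of its cardinality. For a cardinal $\alpha$, $(\alpha]=\{1,\dots,\alpha\}$ denotes the standard set of cardinality $\alpha$, and $S_\alpha$ is the group of permutations of $(\alpha]$. For a regular cardinal $\kappa$, $\mathbb S_\kappa$ is the category whose objects are the cardinals $\alpha<\kappa$ and whose morphisms $\alpha\to\beta$ are the surjections $(\alpha]\to(\beta]$; $\mathbb S_\infty$ is defined in the same way using all cardinals. Given a functor $R:\mathbb S_\kappa\to\mathbf{Set}$ or $R:\mathbb S_\infty\to\mathbf{Set}$, write $R_\alpha=R(\alpha)$ and define an endofunctor of $\mathbf{Set}$ by $$\mathcal R(X)=\sum_{\alpha}\mathrm{Inj}((\alpha],X)\otimes_\alpha R_\alpha ,$$ where $\alpha$ ranges over the objects of the domain category, $\mathrm{Inj}((\alpha],X)$ is the set of injections $(\alpha]\to X$ (empty for $\alpha>\mathrm{card}(X)$, so the sum is a set), and $\otimes_\alpha$ denotes the quotient of the product by $\langle \vec x\circ\sigma,r\rangle\sim\langle\vec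 x,R(\sigma)(r)\rangle$ for $\sigma\in S_\alpha$. The class of $\langle\vec x,r\rangle$ is $[\vec x,r]$. For $f:X\to Y$, $\mathcal R(f)([\vec x,r])=[\vec y,R(s)(r)]$, where $f\circ\vec x=\vec y\circ s$ with $s:(\alpha]\to(\beta]$ a surjection, $\vec y:(\beta]\to Y$ an injection and $\beta$ a cardinal. A natural transformation $\sigma:R\to R'$ induces a natural transformation $\mathcal R\to\mathcal R'$, $[\vec x,r]\mapsto[\vec x,\sigma_\alpha(r)]$. For $\kappa$ a regular cardinal, $\mathbf{San}_\kappa$ is the category whose objects are the endofunctors of $\mathbf{Set}$ isomorphic to a functor $\mathcal R$ obtained in this way from some $R:\mathbb S_\kappa\to\mathbf{Set}$, and whose morphisms are the natural transformations corresponding, under these isomorphisms, to those induced by morphisms of $\mathbf{Set}^{\mathbb S_\kappa}$. $\mathbf{SAN}$ is defined in the same way using $\mathbb S_\infty$. $\mathbf{San}_\infty$ is the union ("sum") of the categories $\mathbf{San}_\kappa$ over all regular cardinals $\kappa$. $\kappa$-accessible means preserving $\kappa$-filtered colimits; $\infty$-accessible means accessible, i.e. $\kappa$-accessible for some regular cardinal $\kappa$. A pullback along a monomorphism is a pullback of a cospan in which (at least) one of the two maps is a monomorphism; a wide pullback of monos is a limit of a (set-indexed) family of monomorphisms with common codomain. A natural transformation is semi-cartesian if its naturality squares at injections are pullbacks. *)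

theory Defs
  imports Main "HOL-Library.FuncSet"
begin

unbundle cardinal_syntax

(* The category Set.

   Set is the category of small subsets of a type 'u whose cardinality is strongly inaccessible
   and uncountable: the usual Grothendieck-universe reading of ZFC set theory.  The type carries
   a well-order whose order type is the initial ordinal of its cardinality, so the elements of
   'u are the ordinals of the universe, the ordinal a being identified with the standard
   set {..<a} of the ordinals below it. *)

definition small :: "'u set \<Rightarrow> bool" where
  "small A \<longleftrightarrow> |A| <o |UNIV :: 'u set|"

definition set_universe :: "'u::wellorder itself \<Rightarrow> bool" where
  "set_universe _ \<longleftrightarrow>
     natLeq <o |UNIV :: 'u set| \<and>
     regularCard |UNIV :: 'u set| \<and>
     (\<forall>A :: 'u set. small A \<longrightarrow> |Pow A| <o |UNIV :: 'u set| ) \<and>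
     (\<forall>a :: 'u. small {..<a})"

definition is_cardinal :: "'u::wellorder \<Rightarrow> bool" where
  "is_cardinal a \<longleftrightarrow> (\<forall>b<a. \<not> |{..<b}| =o |{..<a}| )"

definition regular_cardinal :: "'u::wellorder \<Rightarrow> bool" where
  "regular_cardinal k \<longleftrightarrow> is_cardinal k \<and> infinite {..<k} \<and> regularCard |{..<k}|"


section \<open>Categories, functors and natural transformations\<close>

(* Hom-sets are indexed by source and target and need not be disjoint, so that extensional
   HOL functions can serve as arrows of Set; composition therefore takes the three objects as
   arguments, and cmp C x y z g f is the composite of f : x -> y followed by g : y -> z. *)

record ('o, 'm) cat =
  obj :: "'o set"
  hom :: "'o \<Rightarrow> 'o \<Rightarrow> 'm set"
  ident :: "'o \<Rightarrow> 'm"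
  cmp :: "'o \<Rightarrow> 'o \<Rightarrow> 'o \<Rightarrow> 'm \<Rightarrow> 'm \<Rightarrow> 'm"

definition is_category :: "('o, 'm) cat \<Rightarrow> bool" where
  "is_category C \<longleftrightarrow>
     (\<forall>x\<in>obj C. ident C x \<in> hom C x x) \<and>
     (\<forall>x\<in>obj C. \<forall>y\<in>obj C. \<forall>z\<in>obj C. \<forall>f\<in>hom C x y. \<forall>g\<in>hom C y z.
        cmp C x y z g f \<in> hom C x z) \<and>
     (\<forall>x\<in>obj C. \<forall>y\<in>obj C. \<forall>f\<in>hom C x y.
        cmp C x x y f (ident C x) = f \<and> cmp C x y y (ident C y) f = f) \<and>
     (\<forall>w\<in>obj C. \<forall>x\<in>obj C. \<forall>y\<in>obj C. \<forall>z\<in>obj C.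
        \<forall>f\<in>hom C w x. \<forall>g\<in>hom C x y. \<forall>h\<in>hom C y z.
        cmp C w x z (cmp C x y z h g) f = cmp C w y z h (cmp C w x y g f))"

record ('o, 'm, 'p, 'n) fctr =
  omap :: "'o \<Rightarrow> 'p"
  amap :: "'o \<Rightarrow> 'o \<Rightarrow> 'm \<Rightarrow> 'n"

definition is_functor ::
  "('o, 'm) cat \<Rightarrow> ('p, 'n) cat \<Rightarrow> ('o, 'm, 'p, 'n) fctr \<Rightarrow> bool" where
  "is_functor C D F \<longleftrightarrow>
     (\<forall>x\<in>obj C. omap F x \<in> obj D) \<and>
     (\<forall>x\<in>obj C. \<forall>y\<in>obj C. \<forall>f\<in>hom C x y. amap F x y f \<in> hom D (omap F x) (omap F y)) \<and>
     (\<forall>x\<in>obj C. amap F x x (ident C x) = ident D (omap F x)) \<and>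
     (\<forall>x\<in>obj C. \<forall>y\<in>obj C. \<forall>z\<in>obj C. \<forall>f\<in>hom C x y. \<forall>g\<in>hom C y z.
        amap F x z (cmp C x y z g f) =
        cmp D (omap F x) (omap F y) (omap F z) (amap F y z g) (amap F x y f))"

definition fctr_comp ::
  "('p, 'n, 'q, 'k) fctr \<Rightarrow> ('o, 'm, 'p, 'n) fctr \<Rightarrow> ('o, 'm, 'q, 'k) fctr" where
  "fctr_comp G F =
     \<lparr>omap = (\<lambda>x. omap G (omap F x)),
      amap = (\<lambda>x y f. amap G (omap F x) (omap F y) (amap F x y f))\<rparr>"

definition is_nat_trans ::
  "('o, 'm) cat \<Rightarrow> ('p, 'n) cat \<Rightarrow> ('o, 'm, 'p, 'n) fctr \<Rightarrow> ('o, 'm, 'p, 'n) fctr \<Rightarrow>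
   ('o \<Rightarrow> 'n) \<Rightarrow> bool" where
  "is_nat_trans C D F G \<eta> \<longleftrightarrow>
     \<eta> \<in> extensional (obj C) \<and>
     (\<forall>x\<in>obj C. \<eta> x \<in> hom D (omap F x) (omap G x)) \<and>
     (\<forall>x\<in>obj C. \<forall>y\<in>obj C. \<forall>f\<in>hom C x y.
        cmp D (omap F x) (omap F y) (omap G y) (\<eta> y) (amap F x y f) =
        cmp D (omap F x) (omap G x) (omap G y) (amap G x y f) (\<eta> x))"

definition fun_cat ::
  "('o, 'm) cat \<Rightarrow> ('p, 'n) cat \<Rightarrow> (('o, 'm, 'p, 'n) fctr, 'o \<Rightarrow> 'n) cat" where
  "fun_cat C D =
     \<lparr>obj = {F. is_functor C D F},
      hom = (\<lambda>F G. {\<eta>. is_nat_trans C D F G \<eta>}),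
      ident = (\<lambda>F. \<lambda>x\<in>obj C. ident D (omap F x)),
      cmp = (\<lambda>F G H \<theta> \<eta>. \<lambda>x\<in>obj C. cmp D (omap F x) (omap G x) (omap H x) (\<theta> x) (\<eta> x))\<rparr>"

definition set_cat :: "('u set, 'u \<Rightarrow> 'u) cat" where
  "set_cat =
     \<lparr>obj = {X. small X},
      hom = (\<lambda>X Y. X \<rightarrow>\<^sub>E Y),
      ident = (\<lambda>X. \<lambda>x\<in>X. x),
      cmp = (\<lambda>X Y Z g f. compose X g f)\<rparr>"

type_synonym 'u endo = "('u set, 'u \<Rightarrow> 'u, 'u set, 'u \<Rightarrow> 'u) fctr"


section \<open>Limits and colimits\<close>

definition is_mono :: "('o, 'm) cat \<Rightarrow> 'o \<Rightarrow> 'o \<Rightarrow> 'm \<Rightarrow> bool" where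
  "is_mono C x y m \<longleftrightarrow>
     x \<in> obj C \<and> y \<in> obj C \<and> m \<in> hom C x y \<and>
     (\<forall>w\<in>obj C. \<forall>f\<in>hom C w x. \<forall>g\<in>hom C w x.
        cmp C w x y m f = cmp C w x y m g \<longrightarrow> f = g)"

(* The cospan f : x -> z <- y : g, with projections p1 : p -> x and p2 : p -> y. *)
definition is_pullback ::
  "('o, 'm) cat \<Rightarrow> 'o \<Rightarrow> 'o \<Rightarrow> 'o \<Rightarrow> 'o \<Rightarrow> 'm \<Rightarrow> 'm \<Rightarrow> 'm \<Rightarrow> 'm \<Rightarrow> bool" where
  "is_pullback C p x y z p1 p2 f g \<longleftrightarrow>
     p \<in> obj C \<and> x \<in> obj C \<and> y \<in> obj C \<and> z \<in> obj C \<and>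
     p1 \<in> hom C p x \<and> p2 \<in> hom C p y \<and> f \<in> hom C x z \<and> g \<in> hom C y z \<and>
     cmp C p x z f p1 = cmp C p y z g p2 \<and>
     (\<forall>q\<in>obj C. \<forall>a\<in>hom C q x. \<forall>b\<in>hom C q y.
        cmp C q x z f a = cmp C q y z g b \<longrightarrow>
        (\<exists>!h. h \<in> hom C q p \<and> cmp C q p x p1 h = a \<and> cmp C q p y p2 h = b))"

(* The limit p of the family m i : x i -> z (i in I).  The leg q : p -> z to the common codomain
   is determined by the legs l i unless I is empty, in which case the limit is z itself. *)
definition is_wide_pullback ::
  "('o, 'm) cat \<Rightarrow> 'i set \<Rightarrow> ('i \<Rightarrow> 'o) \<Rightarrow> 'o \<Rightarrow> ('i \<Rightarrow> 'm) \<Rightarrow> 'o \<Rightarrow> ('i \<Rightarrow> 'm) \<Rightarrow> 'm \<Rightarrow> bool" where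
  "is_wide_pullback C I x z m p l q \<longleftrightarrow>
     (\<forall>i\<in>I. x i \<in> obj C) \<and> z \<in> obj C \<and> p \<in> obj C \<and>
     (\<forall>i\<in>I. m i \<in> hom C (x i) z) \<and>
     (\<forall>i\<in>I. l i \<in> hom C p (x i)) \<and> q \<in> hom C p z \<and>
     (\<forall>i\<in>I. cmp C p (x i) z (m i) (l i) = q) \<and>
     (\<forall>w\<in>obj C. \<forall>a b.
        (\<forall>i\<in>I. a i \<in> hom C w (x i)) \<and> b \<in> hom C w z \<and>
        (\<forall>i\<in>I. cmp C w (x i) z (m i) (a i) = b) \<longrightarrow>
        (\<exists>!h. h \<in> hom C w p \<and> (\<forall>i\<in>I. cmp C w p (x i) (l i) h = a i) \<and> cmp C w p z q h = b))"

definition is_cocone ::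
  "('j, 'k) cat \<Rightarrow> ('o, 'm) cat \<Rightarrow> ('j, 'k, 'o, 'm) fctr \<Rightarrow> 'o \<Rightarrow> ('j \<Rightarrow> 'm) \<Rightarrow> bool" where
  "is_cocone J C D c t \<longleftrightarrow>
     c \<in> obj C \<and>
     (\<forall>i\<in>obj J. t i \<in> hom C (omap D i) c) \<and>
     (\<forall>i\<in>obj J. \<forall>j\<in>obj J. \<forall>f\<in>hom J i j.
        cmp C (omap D i) (omap D j) c (t j) (amap D i j f) = t i)"

definition is_colimit ::
  "('j, 'k) cat \<Rightarrow> ('o, 'm) cat \<Rightarrow> ('j, 'k, 'o, 'm) fctr \<Rightarrow> 'o \<Rightarrow> ('j \<Rightarrow> 'm) \<Rightarrow> bool" where
  "is_colimit J C D c t \<longleftrightarrow>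
     is_cocone J C D c t \<and>
     (\<forall>c' t'. is_cocone J C D c' t' \<longrightarrow>
        (\<exists>!h. h \<in> hom C c c' \<and> (\<forall>i\<in>obj J. cmp C (omap D i) c c' h (t i) = t' i)))"

(* A category is k-filtered if any fewer than k objects admit arrows to a common object, and any
   fewer than k parallel arrows are coequalized by some arrow.  The empty family of objects
   makes the category nonempty. *)
definition filtered :: "'u::wellorder \<Rightarrow> ('j, 'k) cat \<Rightarrow> bool" where
  "filtered k J \<longleftrightarrow>
     (\<forall>S\<subseteq>obj J. |S| <o |{..<k}| \<longrightarrow> (\<exists>c\<in>obj J. \<forall>s\<in>S. hom J s c \<noteq> {})) \<and>
     (\<forall>i\<in>obj J. \<forall>j\<in>obj J. \<forall>S\<subseteq>hom J i j. |S| <o |{..<k}| \<longrightarrow>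
        (\<exists>l\<in>obj J. \<exists>h\<in>hom J j l. \<forall>f\<in>S. \<forall>g\<in>S. cmp J i j l h f = cmp J i j l h g))"

(* Up to isomorphism, every small category has its objects and arrows in 'u. *)
definition small_category :: "('u, 'u) cat \<Rightarrow> bool" where
  "small_category J \<longleftrightarrow>
     is_category J \<and> small (obj J) \<and> (\<forall>i\<in>obj J. \<forall>j\<in>obj J. small (hom J i j))"

definition accessible :: "'u::wellorder \<Rightarrow> 'u endo \<Rightarrow> bool" where
  "accessible k F \<longleftrightarrow>
     (\<forall>(J :: ('u, 'u) cat) D c t.
        small_category J \<and> filtered k J \<and> is_functor J set_cat D \<and> is_colimit J set_cat D c t \<longrightarrow>
        is_colimit J set_cat (fctr_comp F D) (omap F c) (\<lambda>i. amap F (omap D i) c (t i)))"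

definition accessible_inf :: "'u::wellorder endo \<Rightarrow> bool" where
  "accessible_inf F \<longleftrightarrow> (\<exists>k. regular_cardinal k \<and> accessible k F)"

definition preserves_pullbacks_along_monos :: "'u endo \<Rightarrow> bool" where
  "preserves_pullbacks_along_monos F \<longleftrightarrow>
     (\<forall>P X Y Z p1 p2 f g.
        is_pullback set_cat P X Y Z p1 p2 f g \<and>
        (is_mono set_cat X Z f \<or> is_mono set_cat Y Z g) \<longrightarrow>
        is_pullback set_cat (omap F P) (omap F X) (omap F Y) (omap F Z)
          (amap F P X p1) (amap F P Y p2) (amap F X Z f) (amap F Y Z g))"

definition preserves_wide_pullbacks_of_monos :: "'u endo \<Rightarrow> bool" where
  "preserves_wide_pullbacks_of_monos F \<longleftrightarrow>
     (\<forall>(I :: 'u set) X Z m P l q.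
        small I \<and> is_wide_pullback set_cat I X Z m P l q \<and>
        (\<forall>i\<in>I. is_mono set_cat (X i) Z (m i)) \<longrightarrow>
        is_wide_pullback set_cat I (\<lambda>i. omap F (X i)) (omap F Z) (\<lambda>i. amap F (X i) Z (m i))
          (omap F P) (\<lambda>i. amap F P (X i) (l i)) (amap F P Z q))"

definition semi_cartesian :: "'u endo \<Rightarrow> 'u endo \<Rightarrow> ('u set \<Rightarrow> 'u \<Rightarrow> 'u) \<Rightarrow> bool" where
  "semi_cartesian F G \<eta> \<longleftrightarrow>
     (\<forall>X\<in>obj set_cat. \<forall>Y\<in>obj set_cat. \<forall>f\<in>hom set_cat X Y. inj_on f X \<longrightarrow>
        is_pullback set_cat (omap F X) (omap F Y) (omap G X) (omap G Y)
          (amap F X Y f) (\<eta> X) (\<eta> Y) (amap G X Y f))"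


section \<open>Semi-analytic functors\<close>

(* Cardinals in K and surjections.  K = {..<k} gives the category S_k and K = UNIV gives
   the category S_infinity of all cardinals. *)
definition surj_cat :: "'u::wellorder set \<Rightarrow> ('u, 'u \<Rightarrow> 'u) cat" where
  "surj_cat K =
     \<lparr>obj = {a \<in> K. is_cardinal a},
      hom = (\<lambda>a b. {s \<in> {..<a} \<rightarrow>\<^sub>E {..<b}. s ` {..<a} = {..<b}}),
      ident = (\<lambda>a. \<lambda>x\<in>{..<a}. x),
      cmp = (\<lambda>a b c g f. compose {..<a} g f)\<rparr>"

type_synonym 'u coeffs = "('u, 'u \<Rightarrow> 'u, 'u set, 'u \<Rightarrow> 'u) fctr"

definition injections :: "'u::wellorder \<Rightarrow> 'u set \<Rightarrow> ('u \<Rightarrow> 'u) set" where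
  "injections a X = {x \<in> {..<a} \<rightarrow>\<^sub>E X. inj_on x {..<a}}"

definition permutations :: "'u::wellorder \<Rightarrow> ('u \<Rightarrow> 'u) set" where
  "permutations a = {s \<in> {..<a} \<rightarrow>\<^sub>E {..<a}. bij_betw s {..<a} {..<a}}"

type_synonym 'u triple = "'u \<times> ('u \<Rightarrow> 'u) \<times> 'u"

definition san_triples :: "'u::wellorder set \<Rightarrow> 'u coeffs \<Rightarrow> 'u set \<Rightarrow> 'u triple set" where
  "san_triples K R X =
     {(a, x, r) | a x r. a \<in> obj (surj_cat K) \<and> x \<in> injections a X \<and> r \<in> omap R a}"

(* When R is a functor this is already an equivalence relation on san_triples K R X, because the
   permutations of {..<a} form a group acting on R_a through R. *)
definition san_rel :: "'u::wellorder set \<Rightarrow> 'u coeffs \<Rightarrow> 'u set \<Rightarrow> ('u triple \<times> 'u triple) set" where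
  "san_rel K R X =
     {((a, compose {..<a} x s, r), (a, x, amap R a a s r)) | a x s r.
        a \<in> obj (surj_cat K) \<and> x \<in> injections a X \<and> s \<in> permutations a \<and> r \<in> omap R a}"

definition san_class ::
  "'u::wellorder set \<Rightarrow> 'u coeffs \<Rightarrow> 'u set \<Rightarrow> 'u \<Rightarrow> ('u \<Rightarrow> 'u) \<Rightarrow> 'u \<Rightarrow> 'u triple set" where
  "san_class K R X a x r = san_rel K R X `` {(a, x, r)}"

(* The functor X |-> sum over a of Inj({..<a}, X) (x)_a R_a.  Its values are sets of equivalence
   classes of triples, hence not literally subsets of 'u; san_iso below relates it to
   endofunctors of set_cat. *)
definition san_functor ::
  "'u::wellorder set \<Rightarrow> 'u coeffs \<Rightarrow>
   ('u set, 'u \<Rightarrow> 'u, 'u triple set set, 'u triple set \<Rightarrow> 'u triple set) fctr" where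
  "san_functor K R =
     \<lparr>omap = (\<lambda>X. san_triples K R X // san_rel K R X),
      amap = (\<lambda>X Y f. \<lambda>u \<in> san_triples K R X // san_rel K R X.
        THE v. \<exists>a x r b y s.
          (a, x, r) \<in> u \<and>
          b \<in> obj (surj_cat K) \<and> y \<in> injections b Y \<and> s \<in> hom (surj_cat K) a b \<and>
          compose {..<a} f x = compose {..<a} y s \<and>
          v = san_class K R Y b y (amap R a b s r))\<rparr>"

definition san_trans ::
  "'u::wellorder set \<Rightarrow> 'u coeffs \<Rightarrow> 'u coeffs \<Rightarrow> ('u \<Rightarrow> 'u \<Rightarrow> 'u) \<Rightarrow>
   'u set \<Rightarrow> 'u triple set \<Rightarrow> 'u triple set" where
  "san_trans K R R' \<tau> X =
     (\<lambda>u \<in> san_triples K R X // san_rel K R X.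
        THE v. \<exists>a x r. (a, x, r) \<in> u \<and> v = san_class K R' X a x (\<tau> a r))"

definition san_iso ::
  "'u::wellorder set \<Rightarrow> 'u endo \<Rightarrow> 'u coeffs \<Rightarrow> ('u set \<Rightarrow> 'u \<Rightarrow> 'u triple set) \<Rightarrow> bool" where
  "san_iso K F R \<phi> \<longleftrightarrow>
     (\<forall>X\<in>obj set_cat. bij_betw (\<phi> X) (omap F X) (omap (san_functor K R) X)) \<and>
     (\<forall>X\<in>obj set_cat. \<forall>Y\<in>obj set_cat. \<forall>f\<in>hom set_cat X Y. \<forall>e\<in>omap F X.
        \<phi> Y (amap F X Y f e) = amap (san_functor K R) X Y f (\<phi> X e))"

definition san_obj :: "'u::wellorder set \<Rightarrow> 'u endo set" where
  "san_obj K =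
     {F \<in> obj (fun_cat set_cat set_cat).
        \<exists>R \<phi>. R \<in> obj (fun_cat (surj_cat K) set_cat) \<and> san_iso K F R \<phi>}"

(* The transformations that correspond, under some choice of presentations of F and G, to one
   induced by a morphism of coefficient functors. *)
definition san_hom ::
  "'u::wellorder set \<Rightarrow> 'u endo \<Rightarrow> 'u endo \<Rightarrow> ('u set \<Rightarrow> 'u \<Rightarrow> 'u) set" where
  "san_hom K F G =
     {\<eta> \<in> hom (fun_cat set_cat set_cat) F G.
        \<exists>R R' \<phi> \<psi> \<tau>.
          R \<in> obj (fun_cat (surj_cat K) set_cat) \<and> san_iso K F R \<phi> \<and>
          R' \<in> obj (fun_cat (surj_cat K) set_cat) \<and> san_iso K G R' \<psi> \<and>
          \<tau> \<in> hom (fun_cat (surj_cat K) set_cat) R R' \<and>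
          (\<forall>X\<in>obj set_cat. \<forall>e\<in>omap F X. \<psi> X (\<eta> X e) = san_trans K R R' \<tau> X (\<phi> X e))}"

definition San :: "'u::wellorder \<Rightarrow> ('u endo, 'u set \<Rightarrow> 'u \<Rightarrow> 'u) cat" where
  "San k = (fun_cat set_cat set_cat) \<lparr>obj := san_obj {..<k}, hom := san_hom {..<k}\<rparr>"

definition SAN :: "('u::wellorder endo, 'u set \<Rightarrow> 'u \<Rightarrow> 'u) cat" where
  "SAN = (fun_cat set_cat set_cat) \<lparr>obj := san_obj UNIV, hom := san_hom UNIV\<rparr>"

definition San_inf :: "('u::wellorder endo, 'u set \<Rightarrow> 'u \<Rightarrow> 'u) cat" where
  "San_inf = (fun_cat set_cat set_cat)
     \<lparr>obj := (\<Union>k\<in>{k. regular_cardinal k}. obj (San k)),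
      hom := (\<lambda>F G. \<Union>k\<in>{k. regular_cardinal k}. hom (San k) F G)\<rparr>"

end

theory Submission
  imports Defs
begin

text \<open>
  The proof runs through supports. For an endofunctor \<open>F\<close> say that \<open>U \<subseteq> X\<close> carries \<open>e \<in> F X\<close> if \<open>e\<close>
  lies in the image of \<open>F U\<close>, and let the support of \<open>e\<close> be the intersection of all sets carrying it.
  Call \<open>F\<close> supported if it preserves injectivity, if the support of an element carries it, and if
  \<open>supp (F f e) = f ` supp e\<close>. Each notion in the theorem is a condition on supports.

  \<^item> \<open>F\<close> is supported iff it preserves pullbacks along monomorphisms and wide pullbacks of monomorphisms
  (\<open>supported_functor_iff_preserves\<close>). Such limits are preimages and intersections; preserving
  intersections makes the support carry, preserving preimages makes it natural. Conversely, in a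
  supported functor \<open>e\<close> comes from a subset iff its support lies in it, so preimages and intersections
  are preserved.

  \<^item> A supported \<open>F\<close> is \<open>k\<close>-accessible iff all supports have fewer than \<open>k\<close> elements
  (\<open>accessible_iff\<close>). Every set is the \<open>k\<close>-filtered union of its subsets of size below \<open>k\<close>, which gives one
  direction. For the other, a support of fewer than \<open>k\<close> elements and the fewer than \<open>k\<close>
  identifications made on it in a \<open>k\<close>-filtered colimit already occur at one stage of the diagram.

  \<^item> \<open>F\<close> is semi-analytic with coefficients indexed by the cardinals in a downward closed \<open>K\<close> iff it is supported and the
  cardinals of all supports belong to \<open>K\<close> (\<open>in_san_obj_iff\<close>). In the functor built from \<open>R\<close> the support
  of \<open>[x, r]\<close> is the set of entries of \<open>x\<close>. Conversely, take for \<open>R a\<close> the elements of \<open>F {..<a}\<close> with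
  full support. An element of \<open>F X\<close> is \<open>F x r\<close> for an enumeration \<open>x\<close> of its support and such an \<open>r\<close>, and
  two such enumerations differ by a permutation.

  \<^item> A natural transformation between supported functors is semi-cartesian iff it preserves supports
  (\<open>semi_cartesian_iff\<close>), and it comes from coefficients iff it is semi-cartesian (\<open>san_hom_iff\<close>),
  as preserving supports means that it restricts to the elements with full support.
\<close>

section \<open>Small sets and their cardinals\<close>

lemma finite_ordLess_infinite_sets: "finite A \<Longrightarrow> infinite B \<Longrightarrow> |A| <o |B|"
  by (rule finite_ordLess_infinite) (simp_all add: Field_card_of card_of_well_order_on)

lemma small_subset: "small B \<Longrightarrow> A \<subseteq> B \<Longrightarrow> small A"
  unfolding small_def by (erule ordLeq_ordLess_trans[OF card_of_mono1, rotated])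

lemma small_image: "small (A :: 'a set) \<Longrightarrow> small (f ` A :: 'a set)"
  unfolding small_def by (rule ordLeq_ordLess_trans[OF card_of_image])

locale universe =
  fixes t :: "'u::wellorder itself"
  assumes universe: "set_universe t"
begin

lemma small_lessThan: "small {..<a::'u}"
  using universe by (simp add: set_universe_def)

lemma infinite_UNIV_universe: "infinite (UNIV :: 'u set)"
proof
  assume fin: "finite (UNIV :: 'u set)"
  have "natLeq <o |UNIV :: 'u set|"
    using universe by (simp add: set_universe_def)
  then have "|UNIV :: nat set| \<le>o |UNIV :: 'u set|"
    using ordIso_ordLess_trans[OF card_of_nat] ordLess_imp_ordLeq by blast
  from card_of_ordLeq_infinite[OF this infinite_UNIV_nat] fin show False by simp
qed

lemma small_finite: "finite A \<Longrightarrow> small (A :: 'u set)"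
  unfolding small_def using infinite_UNIV_universe by (simp add: finite_ordLess_infinite_sets)

lemma two_elements: obtains p q :: 'u where "p \<noteq> q"
proof -
  have "infinite (UNIV - {undefined :: 'u})"
    using infinite_UNIV_universe by simp
  then have "UNIV - {undefined :: 'u} \<noteq> {}" by (metis finite.emptyI)
  then show ?thesis using that by blast
qed

text \<open>By inaccessibility the subsets of a small set can be named by elements of the universe, so
  that they may index a diagram.\<close>

lemma encode_subsets:
  fixes X :: "'u set"
  assumes "small X"
  obtains enc :: "'u set \<Rightarrow> 'u" where "inj_on enc (Pow X)" "\<And>\<A>. \<A> \<subseteq> Pow X \<Longrightarrow> small (enc ` \<A>)"
proof -
  have *: "|Pow X| <o |UNIV :: 'u set|"
    using universe assms by (simp add: set_universe_def)
  then obtain enc :: "'u set \<Rightarrow> 'u" where enc: "inj_on enc (Pow X)"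
    using card_of_ordLeq[of "Pow X" "UNIV :: 'u set"] ordLess_imp_ordLeq by blast
  have "small (enc ` \<A>)" if "\<A> \<subseteq> Pow X" for \<A>
    unfolding small_def
    using ordLeq_ordLess_trans[OF ordLeq_transitive[OF card_of_image card_of_mono1[OF that]] *] .
  with enc show ?thesis using that by blast
qed

end

definition cardinal_of :: "'u::wellorder set \<Rightarrow> 'u" where
  "cardinal_of A = (LEAST a. |{..<a}| =o |A| )"

text \<open>A well-order of the type of the cardinal of a small set is shorter than the well-order of the
  universe, so it is isomorphic to a proper initial segment of the latter.\<close>

lemma (in universe) ex_initial_segment:
  assumes "small (A :: 'u set)"
  shows "\<exists>a :: 'u. |{..<a}| =o |A|"
proof -
  let ?r = "{(x, y). x \<le> (y :: 'u)}"
  have Field: "Field ?r = UNIV" by (auto simp: Field_def)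
  have lin: "linear_order_on UNIV ?r"
    by (auto simp: linear_order_on_def partial_order_on_def preorder_on_def refl_on_def trans_def
        antisym_def total_on_def)
  have "?r - Id = {(x, y). x < y}" by auto
  then have wo: "well_order_on UNIV ?r"
    using lin wf by (simp add: well_order_on_def)
  have "|A| <o ?r"
    using ordLess_ordLeq_trans[OF _ card_of_least[OF wo]] assms unfolding small_def by blast
  moreover have "Well_order ?r" using wo Field by simp
  ultimately obtain a where iso: "|A| =o Restr ?r (underS ?r a)"
    using ordLess_iff_ordIso_Restr[OF _ card_of_Well_order, of ?r A] by blast
  have "underS ?r a = {..<a}" by (auto simp: underS_def)
  moreover have "Field (Restr ?r {..<a}) = {..<a}" by (auto simp: Field_def)
  ultimately have "|A| =o |{..<a}|"
    using card_of_cong[OF iso] by (simp add: Field_card_of)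
  then have "|{..<a}| =o |A|" by (rule ordIso_symmetric)
  then show ?thesis ..
qed

lemma (in universe) cardinal_of_ordIso: "small (A :: 'u set) \<Longrightarrow> |{..<cardinal_of A}| =o |A|"
  unfolding cardinal_of_def by (rule LeastI_ex[OF ex_initial_segment])

lemma (in universe) is_cardinal_cardinal_of:
  assumes "small (A :: 'u set)" shows "is_cardinal (cardinal_of A)"
  unfolding is_cardinal_def
proof (intro allI impI notI)
  fix b assume b: "b < cardinal_of A" "|{..<b}| =o |{..<cardinal_of A}|"
  then have "|{..<b}| =o |A|" using ordIso_transitive[OF _ cardinal_of_ordIso[OF assms]] by blast
  then have "cardinal_of A \<le> b" unfolding cardinal_of_def by (rule Least_le)
  with b show False by simp
qed

lemma is_cardinal_unique:
  assumes "is_cardinal a" "is_cardinal b" "|{..<a}| =o |{..<b}|"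
  shows "a = b"
  using assms(1,2) assms(3) ordIso_symmetric[OF assms(3)] unfolding is_cardinal_def
  by (meson linorder_neqE)

lemma is_cardinal_less_iff:
  assumes "is_cardinal a" "is_cardinal k"
  shows "a < k \<longleftrightarrow> |{..<a}| <o |{..<k}|"
proof
  assume "a < k"
  then have "{..<a} \<subseteq> {..<k}" by auto
  then have "|{..<a}| \<le>o |{..<k}|" by (rule card_of_mono1)
  moreover have "\<not> |{..<a}| =o |{..<k}|" using \<open>a < k\<close> assms is_cardinal_def by blast
  ultimately show "|{..<a}| <o |{..<k}|" by (simp add: ordLeq_iff_ordLess_or_ordIso)
next
  assume *: "|{..<a}| <o |{..<k}|"
  show "a < k"
  proof (rule ccontr)
    assume "\<not> a < k"
    then have "{..<k} \<subseteq> {..<a}" by auto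
    then have "|{..<k}| \<le>o |{..<a}|" by (rule card_of_mono1)
    then show False using not_ordLess_ordLeq[OF *] by blast
  qed
qed

lemma (in universe) cardinal_of_lessThan_iff:
  assumes "small (A :: 'u set)" "is_cardinal k"
  shows "cardinal_of A < k \<longleftrightarrow> |A| <o |{..<k}|"
proof -
  have "cardinal_of A < k \<longleftrightarrow> |{..<cardinal_of A}| <o |{..<k}|"
    by (rule is_cardinal_less_iff[OF is_cardinal_cardinal_of[OF assms(1)] assms(2)])
  also have "\<dots> \<longleftrightarrow> |A| <o |{..<k}|"
    using ordIso_ordLess_trans[OF cardinal_of_ordIso[OF assms(1)]]
      ordIso_ordLess_trans[OF ordIso_symmetric[OF cardinal_of_ordIso[OF assms(1)]]] by blast
  finally show ?thesis .
qed

lemma (in universe) cardinal_of_inj_image: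
  assumes "is_cardinal (a :: 'u)" "inj_on x {..<a}"
  shows "cardinal_of (x ` {..<a}) = a"
proof -
  have iso: "|{..<a}| =o |x ` {..<a}|"
    using card_of_ordIso[of "{..<a}" "x ` {..<a}"] inj_on_imp_bij_betw[OF assms(2)] by blast
  have small: "small (x ` {..<a})" by (simp add: small_image small_lessThan)
  have "|{..<cardinal_of (x ` {..<a})}| =o |{..<a}|"
    using ordIso_transitive[OF cardinal_of_ordIso[OF small] ordIso_symmetric[OF iso]] .
  then show ?thesis
    by (rule is_cardinal_unique[OF is_cardinal_cardinal_of[OF small] assms(1)])
qed

section \<open>Monomorphisms and pullbacks of sets\<close>

lemma obj_set_cat [simp]: "obj set_cat = {X. small X}"
  and hom_set_cat [simp]: "hom set_cat X Y = X \<rightarrow>\<^sub>E Y"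
  and ident_set_cat [simp]: "ident set_cat X = (\<lambda>x\<in>X. x)"
  and cmp_set_cat [simp]: "cmp set_cat X Y Z g f = compose X g f"
  by (simp_all add: set_cat_def)

lemma compose_PiE: "f \<in> X \<rightarrow>\<^sub>E Y \<Longrightarrow> g \<in> Y \<rightarrow>\<^sub>E Z \<Longrightarrow> compose X g f \<in> X \<rightarrow>\<^sub>E Z"
  by (auto simp: compose_def)

lemma compose_eq_iff: "compose X f g = compose X h k \<longleftrightarrow> (\<forall>x\<in>X. f (g x) = h (k x))"
  by (auto simp: compose_def restrict_def fun_eq_iff)

lemma compose_eq_PiE_iff:
  "k \<in> X \<rightarrow>\<^sub>E Y \<Longrightarrow> compose X f g = k \<longleftrightarrow> (\<forall>x\<in>X. f (g x) = k x)"
  unfolding compose_def by (metis PiE_restrict restrict_apply' restrict_ext)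

lemma PiE_eq_of_inj:
  assumes "f \<in> W \<rightarrow>\<^sub>E X" "g \<in> W \<rightarrow>\<^sub>E X" "inj_on m X" "\<And>w. w \<in> W \<Longrightarrow> m (f w) = m (g w)"
  shows "f = g"
  using assms by (intro PiE_ext[OF assms(1,2)]) (meson PiE_mem inj_onD)

lemma inclusion_PiE: "U \<subseteq> X \<Longrightarrow> (\<lambda>x\<in>U. x) \<in> U \<rightarrow>\<^sub>E X"
  by auto

lemma (in universe) is_mono_set_cat_iff:
  fixes X Y :: "'u set"
  shows "is_mono set_cat X Y m \<longleftrightarrow> small X \<and> small Y \<and> m \<in> X \<rightarrow>\<^sub>E Y \<and> inj_on m X" (is "?L \<longleftrightarrow> ?R")
proof
  assume L: ?L
  then have cancel: "f = g" if "small W" "f \<in> W \<rightarrow>\<^sub>E X" "g \<in> W \<rightarrow>\<^sub>E X" "compose W m f = compose W m g"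
    for W :: "'u set" and f g using that by (simp add: is_mono_def)
  have "x = y" if xy: "x \<in> X" "y \<in> X" "m x = m y" for x y
  proof -
    have "(\<lambda>w\<in>{x}. x) = (\<lambda>w\<in>{x}. y)"
      by (rule cancel[of "{x}"]) (use xy in \<open>auto simp: small_finite compose_eq_iff\<close>)
    then show ?thesis by (metis restrict_apply' singletonI)
  qed
  then show ?R using L by (auto simp: is_mono_def inj_on_def)
next
  assume R: ?R
  have "f = g" if "f \<in> W \<rightarrow>\<^sub>E X" "g \<in> W \<rightarrow>\<^sub>E X" "compose W m f = compose W m g" for W :: "'u set" and f g
    by (rule PiE_eq_of_inj[OF that(1,2), of m]) (use R that(3) in \<open>simp_all add: compose_eq_iff\<close>)
  then show ?L using R by (simp add: is_mono_def)
qed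

lemma is_pullback_commute: "is_pullback C p x y z p1 p2 f g \<longleftrightarrow> is_pullback C p y x z p2 p1 g f"
proof -
  have "is_pullback C p y x z p2 p1 g f" if "is_pullback C p x y z p1 p2 f g" for x y p1 p2 f g
    using that unfolding is_pullback_def by (metis (no_types, lifting))
  then show ?thesis by blast
qed

text \<open>Testing the universal property on one-element sets shows that a pullback along an injective
  \<open>g\<close> is a preimage of the image of \<open>g\<close>, up to bijection. The other projection is then determined.\<close>

lemma (in universe) is_pullback_along_inj_iff:
  fixes P X Y Z :: "'u set"
  assumes "small P" "small X" "small Y" "small Z"
    and p1: "p1 \<in> P \<rightarrow>\<^sub>E X" and p2: "p2 \<in> P \<rightarrow>\<^sub>E Y" and f: "f \<in> X \<rightarrow>\<^sub>E Z" and g: "g \<in> Y \<rightarrow>\<^sub>E Z"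
    and g_inj: "inj_on g Y"
  shows "is_pullback set_cat P X Y Z p1 p2 f g \<longleftrightarrow>
    (\<forall>p\<in>P. f (p1 p) = g (p2 p)) \<and> inj_on p1 P \<and> p1 ` P = {x\<in>X. f x \<in> g ` Y}" (is "?L \<longleftrightarrow> ?R")
proof
  assume L: ?L
  have comm: "f (p1 p) = g (p2 p)" if "p \<in> P" for p
    using L that by (simp add: is_pullback_def compose_eq_iff)
  have univ: "\<exists>!h. h \<in> Q \<rightarrow>\<^sub>E P \<and> compose Q p1 h = a \<and> compose Q p2 h = b"
    if "small Q" "a \<in> Q \<rightarrow>\<^sub>E X" "b \<in> Q \<rightarrow>\<^sub>E Y" "compose Q f a = compose Q g b" for Q :: "'u set" and a b
    using L that by (simp add: is_pullback_def)
  have p2_eq: "p2 p = p2 q" if "p \<in> P" "q \<in> P" "p1 p = p1 q" for p q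
    using comm that g_inj p2 by (metis PiE_mem inj_onD)
  have "p = q" if pq: "p \<in> P" "q \<in> P" "p1 p = p1 q" for p q
  proof -
    have a: "(\<lambda>w\<in>{p}. p1 p) \<in> {p} \<rightarrow>\<^sub>E X" and b: "(\<lambda>w\<in>{p}. p2 p) \<in> {p} \<rightarrow>\<^sub>E Y"
      using pq p1 p2 by auto
    have "\<exists>!h. h \<in> {p} \<rightarrow>\<^sub>E P \<and> compose {p} p1 h = (\<lambda>w\<in>{p}. p1 p) \<and> compose {p} p2 h = (\<lambda>w\<in>{p}. p2 p)"
      using a b pq(1,2) comm by (intro univ) (auto simp: small_finite compose_eq_iff)
    moreover have "(\<lambda>w\<in>{p}. p) \<in> {p} \<rightarrow>\<^sub>E P \<and> compose {p} p1 (\<lambda>w\<in>{p}. p) = (\<lambda>w\<in>{p}. p1 p)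
      \<and> compose {p} p2 (\<lambda>w\<in>{p}. p) = (\<lambda>w\<in>{p}. p2 p)"
      using pq a b by (auto simp: compose_eq_PiE_iff)
    moreover have "(\<lambda>w\<in>{p}. q) \<in> {p} \<rightarrow>\<^sub>E P \<and> compose {p} p1 (\<lambda>w\<in>{p}. q) = (\<lambda>w\<in>{p}. p1 p)
      \<and> compose {p} p2 (\<lambda>w\<in>{p}. q) = (\<lambda>w\<in>{p}. p2 p)"
      using pq a b p2_eq[OF pq] by (auto simp: compose_eq_PiE_iff)
    ultimately have "(\<lambda>w\<in>{p}. p) = (\<lambda>w\<in>{p}. q)" by blast
    then show "p = q" by (metis restrict_apply' singletonI)
  qed
  moreover have "x \<in> p1 ` P" if x: "x \<in> X" "y \<in> Y" "f x = g y" for x y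
  proof -
    have a: "(\<lambda>w\<in>{x}. x) \<in> {x} \<rightarrow>\<^sub>E X" and b: "(\<lambda>w\<in>{x}. y) \<in> {x} \<rightarrow>\<^sub>E Y" using x by auto
    have "\<exists>!h. h \<in> {x} \<rightarrow>\<^sub>E P \<and> compose {x} p1 h = (\<lambda>w\<in>{x}. x) \<and> compose {x} p2 h = (\<lambda>w\<in>{x}. y)"
      using a b x by (intro univ) (auto simp: small_finite compose_eq_iff)
    then obtain h where "h \<in> {x} \<rightarrow>\<^sub>E P" "compose {x} p1 h = (\<lambda>w\<in>{x}. x)" by blast
    then have "h x \<in> P" "p1 (h x) = x" by (auto simp: compose_eq_PiE_iff[OF a])
    then show ?thesis by (metis imageI)
  qed
  ultimately show ?R using comm p1 p2 by (auto simp: inj_on_def)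
next
  assume R: ?R
  have "\<exists>!h. h \<in> Q \<rightarrow>\<^sub>E P \<and> compose Q p1 h = a \<and> compose Q p2 h = b"
    if Q: "small Q" and a: "a \<in> Q \<rightarrow>\<^sub>E X" and b: "b \<in> Q \<rightarrow>\<^sub>E Y" and ab: "compose Q f a = compose Q g b"
    for Q :: "'u set" and a b
  proof (rule ex1I)
    let ?h = "\<lambda>w\<in>Q. inv_into P p1 (a w)"
    have fa: "f (a w) = g (b w)" if "w \<in> Q" for w using ab that by (simp add: compose_eq_iff)
    have aw: "a w \<in> p1 ` P" if "w \<in> Q" for w
      using R fa[OF that] PiE_mem[OF a that] PiE_mem[OF b that] by auto
    have h: "?h \<in> Q \<rightarrow>\<^sub>E P" using aw by (auto intro: inv_into_into)
    have p1h: "p1 (?h w) = a w" if "w \<in> Q" for w using aw[OF that] that by (simp add: f_inv_into_f)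
    have "p2 (?h w) = b w" if "w \<in> Q" for w
    proof -
      have "?h w \<in> P" using h that by (rule PiE_mem)
      then have "g (p2 (?h w)) = g (b w)" using R p1h[OF that] fa[OF that] by metis
      then show ?thesis using g_inj PiE_mem[OF p2 \<open>?h w \<in> P\<close>] PiE_mem[OF b that] by (metis inj_onD)
    qed
    then show "?h \<in> Q \<rightarrow>\<^sub>E P \<and> compose Q p1 ?h = a \<and> compose Q p2 ?h = b"
      using h p1h by (simp add: compose_eq_PiE_iff[OF a] compose_eq_PiE_iff[OF b])
    fix h assume h': "h \<in> Q \<rightarrow>\<^sub>E P \<and> compose Q p1 h = a \<and> compose Q p2 h = b"
    then have "p1 (h w) = p1 (?h w)" if "w \<in> Q" for w
      using that p1h by (simp add: compose_eq_PiE_iff[OF a])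
    with PiE_eq_of_inj[OF _ h] h' R show "h = ?h" by blast
  qed
  then show ?L using R assms by (simp add: is_pullback_def compose_eq_iff)
qed

text \<open>In the same way a wide pullback of monomorphisms is an intersection of images. For an empty
  family the intersection is all of \<open>Z\<close>.\<close>

lemma (in universe) is_wide_pullback_inj_iff:
  fixes P Z :: "'u set" and X :: "'i \<Rightarrow> 'u set"
  assumes "\<And>i. i \<in> I \<Longrightarrow> small (X i)" "small Z" "small P"
    and m: "\<And>i. i \<in> I \<Longrightarrow> m i \<in> X i \<rightarrow>\<^sub>E Z" and m_inj: "\<And>i. i \<in> I \<Longrightarrow> inj_on (m i) (X i)"
    and l: "\<And>i. i \<in> I \<Longrightarrow> l i \<in> P \<rightarrow>\<^sub>E X i" and q: "q \<in> P \<rightarrow>\<^sub>E Z"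
    and comm: "\<And>i p. i \<in> I \<Longrightarrow> p \<in> P \<Longrightarrow> m i (l i p) = q p"
  shows "is_wide_pullback set_cat I X Z m P l q \<longleftrightarrow>
    inj_on q P \<and> q ` P = {z\<in>Z. \<forall>i\<in>I. z \<in> m i ` X i}" (is "?L \<longleftrightarrow> ?R")
proof
  assume L: ?L
  then have univ: "\<exists>!h. h \<in> W \<rightarrow>\<^sub>E P \<and> (\<forall>i\<in>I. compose W (l i) h = a i) \<and> compose W q h = b"
    if "small W" "\<And>i. i \<in> I \<Longrightarrow> a i \<in> W \<rightarrow>\<^sub>E X i" "b \<in> W \<rightarrow>\<^sub>E Z"
      "\<And>i. i \<in> I \<Longrightarrow> compose W (m i) (a i) = b" for W :: "'u set" and a b
    using that unfolding is_wide_pullback_def by simp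
  have l_eq: "l i p = l i p'" if "p \<in> P" "p' \<in> P" "q p = q p'" "i \<in> I" for p p' i
    using that comm[of i] m_inj[of i] l[of i] by (metis PiE_mem inj_onD)
  have "p = p'" if pp: "p \<in> P" "p' \<in> P" "q p = q p'" for p p'
  proof -
    have a: "\<And>i. i \<in> I \<Longrightarrow> (\<lambda>w\<in>{p}. l i p) \<in> {p} \<rightarrow>\<^sub>E X i" and b: "(\<lambda>w\<in>{p}. q p) \<in> {p} \<rightarrow>\<^sub>E Z"
      using pp l q by auto
    have "\<exists>!h. h \<in> {p} \<rightarrow>\<^sub>E P \<and> (\<forall>i\<in>I. compose {p} (l i) h = (\<lambda>w\<in>{p}. l i p)) \<and>
      compose {p} q h = (\<lambda>w\<in>{p}. q p)"
      using a b pp(1,2) comm by (intro univ) (auto simp: small_finite compose_eq_PiE_iff[OF b])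
    moreover have "(\<lambda>w\<in>{p}. p) \<in> {p} \<rightarrow>\<^sub>E P \<and> (\<forall>i\<in>I. compose {p} (l i) (\<lambda>w\<in>{p}. p) = (\<lambda>w\<in>{p}. l i p)) \<and>
      compose {p} q (\<lambda>w\<in>{p}. p) = (\<lambda>w\<in>{p}. q p)"
      using pp(1,2) b by (auto simp: compose_eq_PiE_iff[OF b] compose_eq_PiE_iff[OF a])
    moreover have "(\<lambda>w\<in>{p}. p') \<in> {p} \<rightarrow>\<^sub>E P \<and> (\<forall>i\<in>I. compose {p} (l i) (\<lambda>w\<in>{p}. p') = (\<lambda>w\<in>{p}. l i p)) \<and>
      compose {p} q (\<lambda>w\<in>{p}. p') = (\<lambda>w\<in>{p}. q p)"
      using pp(1,2)
      by (auto simp: compose_eq_PiE_iff[OF b] compose_eq_PiE_iff[OF a] pp(3)[symmetric] l_eq[OF pp, symmetric])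
    ultimately have "(\<lambda>w\<in>{p}. p) = (\<lambda>w\<in>{p}. p')" by blast
    then show ?thesis by (metis restrict_apply' singletonI)
  qed
  then have "inj_on q P" by (auto simp: inj_on_def)
  moreover have "z \<in> q ` P" if z: "z \<in> Z" "\<forall>i\<in>I. z \<in> m i ` X i" for z
  proof -
    define y where "y i = inv_into (X i) (m i) z" for i
    have y: "y i \<in> X i" "m i (y i) = z" if "i \<in> I" for i
      using z(2) that by (auto simp: y_def intro: inv_into_into f_inv_into_f)
    have b: "(\<lambda>w\<in>{z}. z) \<in> {z} \<rightarrow>\<^sub>E Z" using z by auto
    have "\<exists>!h. h \<in> {z} \<rightarrow>\<^sub>E P \<and> (\<forall>i\<in>I. compose {z} (l i) h = (\<lambda>w\<in>{z}. y i)) \<and>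
      compose {z} q h = (\<lambda>w\<in>{z}. z)"
      using b y by (intro univ) (auto simp: small_finite compose_eq_PiE_iff[OF b])
    then obtain h where "h \<in> {z} \<rightarrow>\<^sub>E P" "compose {z} q h = (\<lambda>w\<in>{z}. z)" by blast
    then have "h z \<in> P" "q (h z) = z" by (auto simp: compose_eq_PiE_iff[OF b])
    then show ?thesis by (metis imageI)
  qed
  moreover have "q p \<in> m i ` X i" if "p \<in> P" "i \<in> I" for p i
    using comm[OF that(2,1)] PiE_mem[OF l[OF that(2)] that(1)] by (metis imageI)
  ultimately show ?R using PiE_mem[OF q] by blast
next
  assume R: ?R
  have "\<exists>!h. h \<in> W \<rightarrow>\<^sub>E P \<and> (\<forall>i\<in>I. compose W (l i) h = a i) \<and> compose W q h = b"
    if W: "small W" and a: "\<And>i. i \<in> I \<Longrightarrow> a i \<in> W \<rightarrow>\<^sub>E X i" and b: "b \<in> W \<rightarrow>\<^sub>E Z"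
      and ab: "\<And>i. i \<in> I \<Longrightarrow> compose W (m i) (a i) = b" for W :: "'u set" and a b
  proof (rule ex1I)
    let ?h = "\<lambda>w\<in>W. inv_into P q (b w)"
    have ma: "m i (a i w) = b w" if "i \<in> I" "w \<in> W" for i w
      using ab[OF that(1)] that(2) by (simp add: compose_eq_PiE_iff[OF b])
    have bw: "b w \<in> q ` P" if "w \<in> W" for w
    proof -
      have "b w \<in> m i ` X i" if "i \<in> I" for i
        using ma[OF that \<open>w \<in> W\<close>] PiE_mem[OF a[OF that] \<open>w \<in> W\<close>] by (metis imageI)
      then show ?thesis using R PiE_mem[OF b that] by simp
    qed
    have h: "?h \<in> W \<rightarrow>\<^sub>E P" using bw by (auto intro: inv_into_into)
    have qh: "q (?h w) = b w" if "w \<in> W" for w using bw[OF that] that by (simp add: f_inv_into_f)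
    have "l i (?h w) = a i w" if "i \<in> I" "w \<in> W" for i w
    proof -
      have "?h w \<in> P" using h that(2) by (rule PiE_mem)
      then have "m i (l i (?h w)) = m i (a i w)"
        using comm[OF that(1) \<open>?h w \<in> P\<close>] qh[OF that(2)] ma[OF that] by simp
      then show ?thesis
        by (rule inj_onD[OF m_inj[OF that(1)] _ PiE_mem[OF l[OF that(1)] \<open>?h w \<in> P\<close>]
              PiE_mem[OF a[OF that(1)] that(2)]])
    qed
    then show "?h \<in> W \<rightarrow>\<^sub>E P \<and> (\<forall>i\<in>I. compose W (l i) ?h = a i) \<and> compose W q ?h = b"
      using h qh by (simp add: compose_eq_PiE_iff[OF b] compose_eq_PiE_iff[OF a])
    fix h assume h': "h \<in> W \<rightarrow>\<^sub>E P \<and> (\<forall>i\<in>I. compose W (l i) h = a i) \<and> compose W q h = b"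
    then have "q (h w) = q (?h w)" if "w \<in> W" for w
      using that qh by (simp add: compose_eq_PiE_iff[OF b])
    with PiE_eq_of_inj[OF _ h] h' R show "h = ?h" by blast
  qed
  moreover have "\<forall>i\<in>I. compose P (m i) (l i) = q" using comm by (simp add: compose_eq_PiE_iff[OF q])
  ultimately show ?L using assms by (simp add: is_wide_pullback_def)
qed

section \<open>Supports\<close>

locale endofunctor = universe t for t :: "'u::wellorder itself" +
  fixes F :: "'u endo"
  assumes is_functor: "is_functor set_cat set_cat F"
begin

lemma small_omap: "small X \<Longrightarrow> small (omap F X)"
  using is_functor by (simp add: is_functor_def)

lemma amap_PiE: "small X \<Longrightarrow> small Y \<Longrightarrow> f \<in> X \<rightarrow>\<^sub>E Y \<Longrightarrow> amap F X Y f \<in> omap F X \<rightarrow>\<^sub>E omap F Y"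
  using is_functor by (simp add: is_functor_def)

lemma amap_in:
  "small X \<Longrightarrow> small Y \<Longrightarrow> f \<in> X \<rightarrow>\<^sub>E Y \<Longrightarrow> e \<in> omap F X \<Longrightarrow> amap F X Y f e \<in> omap F Y"
  by (rule PiE_mem[OF amap_PiE])

lemma amap_id: "small X \<Longrightarrow> e \<in> omap F X \<Longrightarrow> amap F X X (\<lambda>x\<in>X. x) e = e"
  using is_functor by (simp add: is_functor_def)

lemma amap_compose:
  assumes "small X" "small Y" "small Z" "f \<in> X \<rightarrow>\<^sub>E Y" "g \<in> Y \<rightarrow>\<^sub>E Z" "e \<in> omap F X"
  shows "amap F X Z (compose X g f) e = amap F Y Z g (amap F X Y f e)"
proof -
  have "amap F X Z (compose X g f) = compose (omap F X) (amap F Y Z g) (amap F X Y f)"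
    using is_functor assms(1-5) by (simp add: is_functor_def)
  then show ?thesis using assms(6) by (simp add: compose_eq)
qed

text \<open>The form in which functoriality is mostly used below.\<close>

lemma amap_square:
  assumes "small W" "small X" "small Y" "small Z"
    "f \<in> W \<rightarrow>\<^sub>E X" "g \<in> X \<rightarrow>\<^sub>E Z" "h \<in> W \<rightarrow>\<^sub>E Y" "k \<in> Y \<rightarrow>\<^sub>E Z"
    "\<And>w. w \<in> W \<Longrightarrow> g (f w) = k (h w)" "e \<in> omap F W"
  shows "amap F X Z g (amap F W X f e) = amap F Y Z k (amap F W Y h e)"
proof -
  have "compose W g f = compose W k h" using assms(9) by (simp add: compose_eq_iff)
  then show ?thesis using assms by (metis amap_compose)
qed

lemma amap_triangle:
  assumes "small X" "small Y" "small Z" "f \<in> X \<rightarrow>\<^sub>E Y" "g \<in> Y \<rightarrow>\<^sub>E Z" "h \<in> X \<rightarrow>\<^sub>E Z"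
    "\<And>x. x \<in> X \<Longrightarrow> g (f x) = h x" "e \<in> omap F X"
  shows "amap F Y Z g (amap F X Y f e) = amap F X Z h e"
  using amap_compose[OF assms(1-5,8)] assms(7) compose_eq_PiE_iff[OF assms(6), of g f] by simp

end

definition carries :: "'u endo \<Rightarrow> 'u set \<Rightarrow> 'u set \<Rightarrow> 'u \<Rightarrow> bool" where
  "carries F X U e \<longleftrightarrow> U \<subseteq> X \<and> e \<in> amap F U X (\<lambda>u\<in>U. u) ` omap F U"

definition supp :: "'u endo \<Rightarrow> 'u set \<Rightarrow> 'u \<Rightarrow> 'u set" where
  "supp F X e = \<Inter>{U. carries F X U e}"

context endofunctor
begin

lemma carries_self: "small X \<Longrightarrow> e \<in> omap F X \<Longrightarrow> carries F X X e"
  unfolding carries_def using amap_id[of X e] by (metis imageI subset_refl)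

lemma supp_subset: "small X \<Longrightarrow> e \<in> omap F X \<Longrightarrow> supp F X e \<subseteq> X"
  unfolding supp_def using carries_self by blast

lemma supp_least: "carries F X U e \<Longrightarrow> supp F X e \<subseteq> U"
  unfolding supp_def by blast

lemma carries_amap:
  assumes "small X" "small Y" "f \<in> X \<rightarrow>\<^sub>E Y" "carries F X U e"
  shows "carries F Y (f ` U) (amap F X Y f e)"
proof -
  obtain e' where U: "U \<subseteq> X" and e': "e' \<in> omap F U" "e = amap F U X (\<lambda>u\<in>U. u) e'"
    using assms(4) by (auto simp: carries_def)
  have small: "small U" "small (f ` U)"
    using U small_subset[OF assms(1)] small_image by blast+
  have "f ` U \<subseteq> Y" using U assms(3) by auto
  have r: "restrict f U \<in> U \<rightarrow>\<^sub>E f ` U" by auto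
  have "amap F X Y f (amap F U X (\<lambda>u\<in>U. u) e') =
      amap F (f ` U) Y (\<lambda>y\<in>f ` U. y) (amap F U (f ` U) (restrict f U) e')"
    using small assms(1-3) U e'(1) \<open>f ` U \<subseteq> Y\<close> by (intro amap_square) auto
  then show ?thesis
    using amap_in[OF small r e'(1)] e'(2) \<open>f ` U \<subseteq> Y\<close> by (auto simp: carries_def)
qed

end

text \<open>In such a functor each element has a least set carrying it, which behaves like the set of
  entries of a tuple. Semi-analyticity, preservation of limits and accessibility are each equivalent
  to a property of supports, and are compared through it.\<close>

locale supported_functor = endofunctor t F for t :: "'u::wellorder itself" and F +
  assumes amap_inj: "\<lbrakk>small X; small Y; f \<in> X \<rightarrow>\<^sub>E Y; inj_on f X\<rbrakk> \<Longrightarrow> inj_on (amap F X Y f) (omap F X)"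
    and carries_supp: "\<lbrakk>small X; e \<in> omap F X\<rbrakk> \<Longrightarrow> carries F X (supp F X e) e"
    and supp_amap: "\<lbrakk>small X; small Y; f \<in> X \<rightarrow>\<^sub>E Y; e \<in> omap F X\<rbrakk> \<Longrightarrow>
      supp F Y (amap F X Y f e) = f ` supp F X e"
begin

text \<open>This turns statements about images under \<open>F\<close> into statements about subsets, for which
  preimages and intersections are immediate.\<close>

lemma in_amap_image_iff:
  assumes "small W" "small X" "m \<in> W \<rightarrow>\<^sub>E X" "inj_on m W" "e \<in> omap F X"
  shows "e \<in> amap F W X m ` omap F W \<longleftrightarrow> supp F X e \<subseteq> m ` W"
proof
  assume "e \<in> amap F W X m ` omap F W"
  then obtain w where "w \<in> omap F W" "e = amap F W X m w" by blast
  then show "supp F X e \<subseteq> m ` W" using supp_amap[OF assms(1-3)] supp_subset[OF assms(1)] image_mono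
    by metis
next
  let ?S = "supp F X e"
  assume *: "?S \<subseteq> m ` W"
  have S: "?S \<subseteq> X" "small ?S" using supp_subset[OF assms(2,5)] small_subset[OF assms(2)] by auto
  obtain e' where e': "e' \<in> omap F ?S" "e = amap F ?S X (\<lambda>u\<in>?S. u) e'"
    using carries_supp[OF assms(2,5)] by (auto simp: carries_def)
  let ?n = "\<lambda>u\<in>?S. inv_into W m u"
  have n: "?n \<in> ?S \<rightarrow>\<^sub>E W" using * by (auto intro: inv_into_into)
  have "amap F W X m (amap F ?S W ?n e') = amap F ?S X (\<lambda>u\<in>?S. u) e'"
    using assms S * n e'(1) by (intro amap_triangle) (auto simp: f_inv_into_f subset_iff)
  then show "e \<in> amap F W X m ` omap F W"
    using amap_in[OF S(2) assms(1) n e'(1)] e'(2) by (metis imageI)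
qed

end

text \<open>Any natural choice \<open>S\<close> of carrying sets is the least one: if \<open>U\<close> carries \<open>e\<close>, then \<open>e\<close> comes
  from an element \<open>e'\<close> of \<open>F U\<close>, and by naturality \<open>S X e\<close> is the image of \<open>S U e'\<close>, hence inside \<open>U\<close>.\<close>

lemma (in endofunctor) supported_functorI:
  assumes inj: "\<And>X Y f. \<lbrakk>small X; small Y; f \<in> X \<rightarrow>\<^sub>E Y; inj_on f X\<rbrakk> \<Longrightarrow> inj_on (amap F X Y f) (omap F X)"
    and S_carries: "\<And>X e. small X \<Longrightarrow> e \<in> omap F X \<Longrightarrow> carries F X (S X e) e"
    and S_amap: "\<And>X Y f e. \<lbrakk>small X; small Y; f \<in> X \<rightarrow>\<^sub>E Y; e \<in> omap F X\<rbrakk> \<Longrightarrow>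
      S Y (amap F X Y f e) = f ` S X e"
  shows "supported_functor t F" "\<And>X e. small X \<Longrightarrow> e \<in> omap F X \<Longrightarrow> supp F X e = S X e"
proof -
  have least: "S X e \<subseteq> U" if "small X" and carr: "carries F X U e" for X U e
  proof -
    obtain e' where U: "U \<subseteq> X" and e': "e' \<in> omap F U" "e = amap F U X (\<lambda>u\<in>U. u) e'"
      using carr by (auto simp: carries_def)
    have small: "small U" using U small_subset[OF \<open>small X\<close>] by blast
    have "S X e = (\<lambda>u\<in>U. u) ` S U e'"
      using S_amap[OF small \<open>small X\<close> inclusion_PiE[OF U] e'(1)] e'(2) by simp
    also have "\<dots> \<subseteq> U" using S_carries[OF small e'(1)] by (auto simp: carries_def)
    finally show ?thesis .
  qed
  have eq: "supp F X e = S X e" if "small X" "e \<in> omap F X" for X e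
    using least[OF that(1)] S_carries[OF that] by (auto simp: supp_def)
  then show "\<And>X e. small X \<Longrightarrow> e \<in> omap F X \<Longrightarrow> supp F X e = S X e" .
  show "supported_functor t F"
    using inj S_carries S_amap eq amap_in by unfold_locales auto
qed

section \<open>Supports and the preservation of limits\<close>

text \<open>An element \<open>e\<close> of \<open>F X\<close> comes from the preimage of the image of \<open>g\<close> iff \<open>f\<close> maps the support of \<open>e\<close> into
  the image of \<open>g\<close>. This image of the support is the support of \<open>F f e\<close>, so the condition says that
  \<open>F f e\<close> lies in the image of \<open>F g\<close>.\<close>

lemma (in supported_functor) preserves_pullbacks: "preserves_pullbacks_along_monos F"
proof -
  have main: "is_pullback set_cat (omap F P) (omap F X) (omap F Y) (omap F Z)
      (amap F P X p1) (amap F P Y p2) (amap F X Z f) (amap F Y Z g)"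
    if pb: "is_pullback set_cat P X Y Z p1 p2 f g" and "is_mono set_cat Y Z g" for P X Y Z p1 p2 f g
  proof -
    have s: "small P" "small X" "small Y" "small Z"
      and p1: "p1 \<in> P \<rightarrow>\<^sub>E X" and p2: "p2 \<in> P \<rightarrow>\<^sub>E Y" and f: "f \<in> X \<rightarrow>\<^sub>E Z" and g: "g \<in> Y \<rightarrow>\<^sub>E Z"
      using pb by (simp_all add: is_pullback_def)
    have g_inj: "inj_on g Y" using \<open>is_mono set_cat Y Z g\<close> by (simp add: is_mono_set_cat_iff)
    have comm: "\<And>p. p \<in> P \<Longrightarrow> f (p1 p) = g (p2 p)" and p1_inj: "inj_on p1 P"
      and p1_im: "p1 ` P = {x\<in>X. f x \<in> g ` Y}"
      using pb by (simp_all add: is_pullback_along_inj_iff[OF s p1 p2 f g g_inj])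
    note Fp1 = amap_PiE[OF s(1,2) p1] and Fp2 = amap_PiE[OF s(1,3) p2]
      and Ff = amap_PiE[OF s(2,4) f] and Fg = amap_PiE[OF s(3,4) g]
    have "e \<in> amap F P X p1 ` omap F P \<longleftrightarrow> amap F X Z f e \<in> amap F Y Z g ` omap F Y"
      if e: "e \<in> omap F X" for e
    proof -
      have "e \<in> amap F P X p1 ` omap F P \<longleftrightarrow> supp F X e \<subseteq> p1 ` P"
        using s p1 p1_inj e by (intro in_amap_image_iff) auto
      also have "\<dots> \<longleftrightarrow> f ` supp F X e \<subseteq> g ` Y"
        unfolding p1_im using supp_subset[OF s(2) e] by blast
      also have "\<dots> \<longleftrightarrow> amap F X Z f e \<in> amap F Y Z g ` omap F Y"
        using s f g g_inj e in_amap_image_iff[OF s(3,4) g g_inj] supp_amap amap_in by simp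
      finally show ?thesis .
    qed
    then have "amap F P X p1 ` omap F P = {e\<in>omap F X. amap F X Z f e \<in> amap F Y Z g ` omap F Y}"
      using Fp1 by blast
    moreover have "\<forall>e\<in>omap F P. amap F X Z f (amap F P X p1 e) = amap F Y Z g (amap F P Y p2 e)"
      using s p1 p2 f g comm amap_square by blast
    ultimately show ?thesis
      using amap_inj[OF s(1,2) p1 p1_inj]
      by (simp add: is_pullback_along_inj_iff[OF s[THEN small_omap] Fp1 Fp2 Ff Fg
            amap_inj[OF s(3,4) g g_inj]])
  qed
  show ?thesis
    unfolding preserves_pullbacks_along_monos_def
    using main by (meson is_pullback_commute)
qed

lemma (in supported_functor) preserves_wide_pullbacks: "preserves_wide_pullbacks_of_monos F"
  unfolding preserves_wide_pullbacks_of_monos_def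
proof (intro allI impI, elim conjE)
  fix I :: "'u set" and X :: "'u \<Rightarrow> 'u set" and Z m P l q
  assume wpb: "is_wide_pullback set_cat I X Z m P l q" and mono: "\<forall>i\<in>I. is_mono set_cat (X i) Z (m i)"
  have s: "\<And>i. i \<in> I \<Longrightarrow> small (X i)" "small Z" "small P"
    and m: "\<And>i. i \<in> I \<Longrightarrow> m i \<in> X i \<rightarrow>\<^sub>E Z" and l: "\<And>i. i \<in> I \<Longrightarrow> l i \<in> P \<rightarrow>\<^sub>E X i"
    and q: "q \<in> P \<rightarrow>\<^sub>E Z" and mlq: "\<And>i. i \<in> I \<Longrightarrow> compose P (m i) (l i) = q"
    using wpb unfolding is_wide_pullback_def by simp_all
  have comm: "\<And>i p. i \<in> I \<Longrightarrow> p \<in> P \<Longrightarrow> m i (l i p) = q p"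
    using mlq compose_eq by metis
  have m_inj: "\<And>i. i \<in> I \<Longrightarrow> inj_on (m i) (X i)" using mono by (simp add: is_mono_set_cat_iff)
  have "inj_on q P \<and> q ` P = {z\<in>Z. \<forall>i\<in>I. z \<in> m i ` X i}"
    by (rule is_wide_pullback_inj_iff[THEN iffD1, OF _ _ _ _ _ _ _ _ wpb])
      (assumption | rule s m m_inj l q comm)+
  then have q_inj: "inj_on q P" and q_im: "q ` P = {z\<in>Z. \<forall>i\<in>I. z \<in> m i ` X i}" by simp_all
  note Fs = small_omap[OF s(1)] small_omap[OF s(2)] small_omap[OF s(3)]
  note Fm = amap_PiE[OF s(1,2) m] and Fl = amap_PiE[OF s(3,1) l] and Fq = amap_PiE[OF s(3,2) q]
  note Fm_inj = amap_inj[OF s(1,2) m m_inj]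
  have Fcomm: "amap F (X i) Z (m i) (amap F P (X i) (l i) e) = amap F P Z q e"
    if "i \<in> I" "e \<in> omap F P" for i e
    using that s m l q comm by (intro amap_triangle) auto
  have "e \<in> amap F P Z q ` omap F P \<longleftrightarrow> (\<forall>i\<in>I. e \<in> amap F (X i) Z (m i) ` omap F (X i))"
    if e: "e \<in> omap F Z" for e
  proof -
    have "e \<in> amap F P Z q ` omap F P \<longleftrightarrow> supp F Z e \<subseteq> q ` P"
      by (rule in_amap_image_iff[OF s(3,2) q q_inj e])
    also have "\<dots> \<longleftrightarrow> (\<forall>i\<in>I. supp F Z e \<subseteq> m i ` X i)"
      unfolding q_im using supp_subset[OF s(2) e] by blast
    also have "\<dots> \<longleftrightarrow> (\<forall>i\<in>I. e \<in> amap F (X i) Z (m i) ` omap F (X i))"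
      using in_amap_image_iff[OF s(1,2) m m_inj e] by simp
    finally show ?thesis .
  qed
  then have "amap F P Z q ` omap F P =
      {e\<in>omap F Z. \<forall>i\<in>I. e \<in> amap F (X i) Z (m i) ` omap F (X i)}"
    using Fq by blast
  then show "is_wide_pullback set_cat I (\<lambda>i. omap F (X i)) (omap F Z) (\<lambda>i. amap F (X i) Z (m i))
      (omap F P) (\<lambda>i. amap F P (X i) (l i)) (amap F P Z q)"
    by (intro is_wide_pullback_inj_iff[THEN iffD2])
      (assumption | rule Fs Fm Fm_inj Fl Fq Fcomm conjI amap_inj[OF s(3,2) q q_inj])+
qed

context endofunctor
begin

text \<open>The kernel pair of an injection is trivial and is a pullback along it, so \<open>F\<close> preserves the
  triviality of the kernel pair.\<close>

lemma inj_of_preserves_pullbacks: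
  assumes "preserves_pullbacks_along_monos F"
    and s: "small X" "small Y" and f: "f \<in> X \<rightarrow>\<^sub>E Y" and f_inj: "inj_on f X"
  shows "inj_on (amap F X Y f) (omap F X)"
proof -
  have "is_pullback set_cat X X X Y (\<lambda>x\<in>X. x) (\<lambda>x\<in>X. x) f f"
    using s f f_inj by (subst is_pullback_along_inj_iff) auto
  moreover have "is_mono set_cat X Y f" using s f f_inj by (simp add: is_mono_set_cat_iff)
  ultimately have pb: "is_pullback set_cat (omap F X) (omap F X) (omap F X) (omap F Y)
      (amap F X X (\<lambda>x\<in>X. x)) (amap F X X (\<lambda>x\<in>X. x)) (amap F X Y f) (amap F X Y f)"
    using assms(1) unfolding preserves_pullbacks_along_monos_def by blast
  have id: "amap F X X (\<lambda>x\<in>X. x) = (\<lambda>x\<in>omap F X. x)"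
    using is_functor s by (simp add: is_functor_def)
  have "g = h" if "g \<in> W \<rightarrow>\<^sub>E omap F X" "h \<in> W \<rightarrow>\<^sub>E omap F X" "small W"
    "compose W (amap F X Y f) g = compose W (amap F X Y f) h" for W :: "'u set" and g h
  proof -
    have "\<exists>k. k \<in> W \<rightarrow>\<^sub>E omap F X \<and> compose W (\<lambda>x\<in>omap F X. x) k = g \<and>
        compose W (\<lambda>x\<in>omap F X. x) k = h"
      using pb that unfolding is_pullback_def id by simp blast
    then show ?thesis by metis
  qed
  then have "is_mono set_cat (omap F X) (omap F Y) (amap F X Y f)"
    using small_omap s amap_PiE[OF s f] by (simp add: is_mono_def)
  then show ?thesis by (simp add: is_mono_set_cat_iff)
qed

text \<open>The support is the wide pullback of the inclusions of all sets carrying \<open>e\<close>, so by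
  preservation the elements of \<open>F X\<close> that it carries are those carried by each of these sets.\<close>

lemma carries_supp_of_preserves_wide_pullbacks:
  assumes "preserves_wide_pullbacks_of_monos F"
    and inj: "\<And>X Y f. \<lbrakk>small X; small Y; f \<in> X \<rightarrow>\<^sub>E Y; inj_on f X\<rbrakk> \<Longrightarrow> inj_on (amap F X Y f) (omap F X)"
    and X: "small X" and e: "e \<in> omap F X"
  shows "carries F X (supp F X e) e"
proof -
  let ?\<U> = "{U. carries F X U e}" and ?S = "supp F X e"
  have sub: "?\<U> \<subseteq> Pow X" by (auto simp: carries_def)
  obtain enc :: "'u set \<Rightarrow> 'u" where enc: "inj_on enc (Pow X)" "\<And>\<A>. \<A> \<subseteq> Pow X \<Longrightarrow> small (enc ` \<A>)"
    using encode_subsets[OF X] by blast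
  define I where "I = enc ` ?\<U>"
  define V where "V = inv_into ?\<U> enc"
  have "inj_on enc ?\<U>" using enc(1) sub by (rule inj_on_subset)
  then have V_im: "V ` I = ?\<U>" unfolding V_def I_def by (simp add: inv_into_image_cancel)
  then have V: "carries F X (V i) e" if "i \<in> I" for i using that by blast
  have VX: "V i \<subseteq> X" if "i \<in> I" for i using V[OF that] by (simp add: carries_def)
  have S: "?S \<subseteq> X" "small ?S" using supp_subset[OF X e] small_subset[OF X] by auto
  have SV: "?S \<subseteq> V i" if "i \<in> I" for i using V[OF that] by (rule supp_least)
  have I: "small I" unfolding I_def by (rule enc(2)[OF sub])
  have sV: "small (V i)" if "i \<in> I" for i using VX[OF that] X small_subset by blast
  have incl_inj: "inj_on (\<lambda>u\<in>U. u) U" for U :: "'u set" by (simp add: inj_on_def)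
  have incl_V: "(\<lambda>u\<in>V i. u) (((\<lambda>u\<in>?S. u)) p) = (\<lambda>u\<in>?S. u) p" if "i \<in> I" "p \<in> ?S" for i p
    using that SV[OF that(1)] by auto
  have "?S = X \<inter> (\<Inter>i\<in>I. V i)"
    using S(1) V_im by (simp add: supp_def Int_absorb1)
  then have "inj_on (\<lambda>u\<in>?S. u) ?S \<and> (\<lambda>u\<in>?S. u) ` ?S = {x\<in>X. \<forall>i\<in>I. x \<in> (\<lambda>u\<in>V i. u) ` V i}"
    using incl_inj by auto
  then have "is_wide_pullback set_cat I V X (\<lambda>i. \<lambda>u\<in>V i. u) ?S (\<lambda>i. \<lambda>u\<in>?S. u) (\<lambda>u\<in>?S. u)"
    by (intro is_wide_pullback_inj_iff[THEN iffD2])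
      (assumption | rule sV X S inclusion_PiE VX SV incl_inj incl_V)+
  moreover have "\<forall>i\<in>I. is_mono set_cat (V i) X (\<lambda>u\<in>V i. u)"
    using sV X inclusion_PiE[OF VX] incl_inj by (simp add: is_mono_set_cat_iff)
  ultimately have wpb: "is_wide_pullback set_cat I (\<lambda>i. omap F (V i)) (omap F X)
      (\<lambda>i. amap F (V i) X (\<lambda>u\<in>V i. u)) (omap F ?S) (\<lambda>i. amap F ?S (V i) (\<lambda>u\<in>?S. u))
      (amap F ?S X (\<lambda>u\<in>?S. u))"
    using assms(1) I unfolding preserves_wide_pullbacks_of_monos_def by blast
  have "inj_on (amap F ?S X (\<lambda>u\<in>?S. u)) (omap F ?S) \<and> amap F ?S X (\<lambda>u\<in>?S. u) ` omap F ?S =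
      {z\<in>omap F X. \<forall>i\<in>I. z \<in> amap F (V i) X (\<lambda>u\<in>V i. u) ` omap F (V i)}"
    by (rule is_wide_pullback_inj_iff[THEN iffD1, OF _ _ _ _ _ _ _ _ wpb])
      (assumption | rule small_omap amap_PiE inj amap_triangle sV X S inclusion_PiE VX SV incl_inj incl_V)+
  moreover have "\<forall>i\<in>I. e \<in> amap F (V i) X (\<lambda>u\<in>V i. u) ` omap F (V i)"
    using V by (simp add: carries_def)
  ultimately show ?thesis using e S(1) by (simp add: carries_def)
qed

text \<open>For the nontrivial inclusion, pull the support of \<open>F f e\<close> back along \<open>f\<close>: since \<open>F\<close> preserves
  this pullback, the preimage carries \<open>e\<close> and so contains its support.\<close>

lemma supp_amap_of_preserves:
  assumes pb: "preserves_pullbacks_along_monos F"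
    and carr: "\<And>X e. small X \<Longrightarrow> e \<in> omap F X \<Longrightarrow> carries F X (supp F X e) e"
    and s: "small X" "small Y" and f: "f \<in> X \<rightarrow>\<^sub>E Y" and e: "e \<in> omap F X"
  shows "supp F Y (amap F X Y f e) = f ` supp F X e"
proof
  show "supp F Y (amap F X Y f e) \<subseteq> f ` supp F X e"
    by (rule supp_least[OF carries_amap[OF s f carr[OF s(1) e]]])
  let ?e = "amap F X Y f e"
  let ?V = "supp F Y ?e"
  let ?P = "{x\<in>X. f x \<in> ?V}"
  have Fe: "?e \<in> omap F Y" using amap_in s f e by blast
  have V: "?V \<subseteq> Y" "small ?V" using supp_subset[OF s(2) Fe] small_subset[OF s(2)] by auto
  have P: "small ?P" using small_subset[OF s(1)] by simp
  let ?j = "\<lambda>v\<in>?V. v" and ?i = "\<lambda>x\<in>?P. x" and ?k = "restrict f ?P"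
  have maps: "?i \<in> ?P \<rightarrow>\<^sub>E X" "?k \<in> ?P \<rightarrow>\<^sub>E ?V" "?j \<in> ?V \<rightarrow>\<^sub>E Y" using V by auto
  have j_inj: "inj_on ?j ?V" by (simp add: inj_on_def)
  have "is_pullback set_cat ?P X ?V Y ?i ?k f ?j"
    using is_pullback_along_inj_iff[OF P s(1) V(2) s(2) maps(1,2) f maps(3) j_inj]
    by (auto simp: inj_on_def)
  moreover have "is_mono set_cat ?V Y ?j" using s V maps j_inj by (simp add: is_mono_set_cat_iff)
  ultimately have Fpb: "is_pullback set_cat (omap F ?P) (omap F X) (omap F ?V) (omap F Y)
      (amap F ?P X ?i) (amap F ?P ?V ?k) (amap F X Y f) (amap F ?V Y ?j)"
    using pb unfolding preserves_pullbacks_along_monos_def by blast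
  then have "amap F ?P X ?i ` omap F ?P = {x\<in>omap F X. amap F X Y f x \<in> amap F ?V Y ?j ` omap F ?V}"
    using is_pullback_along_inj_iff[OF small_omap[OF P] small_omap[OF s(1)] small_omap[OF V(2)]
        small_omap[OF s(2)] amap_PiE[OF P s(1) maps(1)] amap_PiE[OF P V(2) maps(2)]
        amap_PiE[OF s f] amap_PiE[OF V(2) s(2) maps(3)]
        inj_of_preserves_pullbacks[OF pb V(2) s(2) maps(3) j_inj]] by blast
  moreover have "?e \<in> amap F ?V Y ?j ` omap F ?V"
    using carr[OF s(2) Fe] by (simp add: carries_def)
  ultimately have "carries F X ?P e" using e by (auto simp: carries_def)
  then show "f ` supp F X e \<subseteq> ?V" using supp_least by blast
qed

text \<open>Pullbacks along monomorphisms make \<open>F\<close> preserve monomorphisms and preimages, wide pullbacks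
  make it preserve intersections. The intersection of all sets carrying an element therefore
  carries it, and a preimage of a carrying set is carrying.\<close>

lemma supported_functor_iff_preserves:
  "supported_functor t F \<longleftrightarrow> preserves_pullbacks_along_monos F \<and> preserves_wide_pullbacks_of_monos F"
proof
  assume "supported_functor t F"
  then interpret supported_functor t F .
  show "preserves_pullbacks_along_monos F \<and> preserves_wide_pullbacks_of_monos F"
    using preserves_pullbacks preserves_wide_pullbacks by blast
next
  assume pres: "preserves_pullbacks_along_monos F \<and> preserves_wide_pullbacks_of_monos F"
  have inj: "inj_on (amap F X Y f) (omap F X)"
    if "small X" "small Y" "f \<in> X \<rightarrow>\<^sub>E Y" "inj_on f X" for X Y f
    using inj_of_preserves_pullbacks pres that by blast
  have carr: "carries F X (supp F X e) e" if "small X" "e \<in> omap F X" for X e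
    by (rule carries_supp_of_preserves_wide_pullbacks[OF conjunct2[OF pres] inj that])
  have "supp F Y (amap F X Y f e) = f ` supp F X e"
    if "small X" "small Y" "f \<in> X \<rightarrow>\<^sub>E Y" "e \<in> omap F X" for X Y f e
    by (rule supp_amap_of_preserves[OF conjunct1[OF pres] carr that])
  with inj carr show "supported_functor t F" by unfold_locales
qed

end

section \<open>Filtered colimits of sets\<close>

locale filtered_diagram = universe t for t :: "'u::wellorder itself" +
  fixes k :: 'u and J :: "('u, 'u) cat" and D :: "('u, 'u, 'u set, 'u \<Rightarrow> 'u) fctr"
  assumes infinite_k: "infinite {..<k}"
    and category: "is_category J" and filtered: "filtered k J" and diagram: "is_functor J set_cat D"
begin

lemma small_D: "i \<in> obj J \<Longrightarrow> small (omap D i)"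
  using diagram by (simp add: is_functor_def)

lemma D_PiE: "i \<in> obj J \<Longrightarrow> j \<in> obj J \<Longrightarrow> f \<in> hom J i j \<Longrightarrow> amap D i j f \<in> omap D i \<rightarrow>\<^sub>E omap D j"
  using diagram by (simp add: is_functor_def)

lemma D_in:
  "i \<in> obj J \<Longrightarrow> j \<in> obj J \<Longrightarrow> f \<in> hom J i j \<Longrightarrow> y \<in> omap D i \<Longrightarrow> amap D i j f y \<in> omap D j"
  by (rule PiE_mem[OF D_PiE])

lemma D_compose:
  assumes "i \<in> obj J" "j \<in> obj J" "l \<in> obj J" "f \<in> hom J i j" "g \<in> hom J j l" "y \<in> omap D i"
  shows "amap D i l (cmp J i j l g f) y = amap D j l g (amap D i j f y)"
proof -
  have "amap D i l (cmp J i j l g f) = compose (omap D i) (amap D j l g) (amap D i j f)"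
    using diagram assms(1-5) by (simp add: is_functor_def)
  then show ?thesis using assms(6) by (simp add: compose_eq)
qed

lemma ident_hom: "i \<in> obj J \<Longrightarrow> ident J i \<in> hom J i i"
  using category by (simp add: is_category_def)

lemma cmp_hom:
  "\<lbrakk>i \<in> obj J; j \<in> obj J; l \<in> obj J; f \<in> hom J i j; g \<in> hom J j l\<rbrakk> \<Longrightarrow> cmp J i j l g f \<in> hom J i l"
  using category unfolding is_category_def by blast

lemma upper_bound:
  assumes "S \<subseteq> obj J" "|S| <o |{..<k}|"
  obtains l h where "l \<in> obj J" "\<And>s. s \<in> S \<Longrightarrow> h s \<in> hom J s l"
proof -
  obtain l where l: "l \<in> obj J" "\<forall>s\<in>S. hom J s l \<noteq> {}"
    using conjunct1[OF filtered[unfolded filtered_def], THEN spec, THEN mp, THEN mp, OF assms] by blast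
  show ?thesis
    by (rule that[OF l(1), of "\<lambda>s. SOME f. f \<in> hom J s l"]) (use l(2) in \<open>simp add: some_in_eq\<close>)
qed

lemma coequalize:
  assumes "i \<in> obj J" "j \<in> obj J" "S \<subseteq> hom J i j" "|S| <o |{..<k}|"
  shows "\<exists>l\<in>obj J. \<exists>h\<in>hom J j l. \<forall>f\<in>S. \<forall>g\<in>S. cmp J i j l h f = cmp J i j l h g"
  using filtered assms by (simp add: filtered_def)

lemma upper_bound2:
  assumes "i \<in> obj J" "j \<in> obj J"
  obtains l f g where "l \<in> obj J" "f \<in> hom J i l" "g \<in> hom J j l"
proof -
  have "|{i, j}| <o |{..<k}|" using infinite_k by (simp add: finite_ordLess_infinite_sets)
  moreover have "{i, j} \<subseteq> obj J" using assms by simp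
  ultimately obtain l h where "l \<in> obj J" "\<And>s. s \<in> {i, j} \<Longrightarrow> h s \<in> hom J s l"
    using upper_bound[of "{i, j}"] by blast
  then show ?thesis using that[of l "h i" "h j"] by simp
qed

lemma coequalize2:
  assumes "i \<in> obj J" "j \<in> obj J" "f \<in> hom J i j" "g \<in> hom J i j"
  obtains l h where "l \<in> obj J" "h \<in> hom J j l"
    "\<And>y. y \<in> omap D i \<Longrightarrow> amap D j l h (amap D i j f y) = amap D j l h (amap D i j g y)"
proof -
  have card: "|{f, g}| <o |{..<k}|" using infinite_k by (simp add: finite_ordLess_infinite_sets)
  have sub: "{f, g} \<subseteq> hom J i j" using assms by simp
  obtain l h where l: "l \<in> obj J" "h \<in> hom J j l" and
    fg: "\<forall>f'\<in>{f, g}. \<forall>g'\<in>{f, g}. cmp J i j l h f' = cmp J i j l h g'"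
    using coequalize[OF assms(1,2) sub card] by (elim bexE) (rule that)
  show ?thesis
  proof (rule that[OF l])
    fix y assume y: "y \<in> omap D i"
    have "cmp J i j l h f = cmp J i j l h g" using fg by blast
    then show "amap D j l h (amap D i j f y) = amap D j l h (amap D i j g y)"
      using D_compose[OF assms(1,2) l(1) assms(3) l(2) y] D_compose[OF assms(1,2) l(1) assms(4) l(2) y]
      by metis
  qed
qed

text \<open>Fewer than \<open>k\<close> pairs of elements that become equal further along the diagram do so along a
  single arrow: bring the arrows that identify the pairs to a common target and coequalize them.\<close>

lemma identify_simultaneously:
  assumes i: "i \<in> obj J" and C: "C \<subseteq> omap D i \<times> omap D i" "|C| <o |{..<k}|"
    and ident: "\<And>x y. (x, y) \<in> C \<Longrightarrow> \<exists>l\<in>obj J. \<exists>g\<in>hom J i l. amap D i l g x = amap D i l g y"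
  obtains l g where "l \<in> obj J" "g \<in> hom J i l" "\<And>x y. (x, y) \<in> C \<Longrightarrow> amap D i l g x = amap D i l g y"
proof (cases "C = {}")
  case True
  then show ?thesis using that i ident_hom by blast
next
  case False
  then obtain c0 where c0: "c0 \<in> C" by blast
  have "\<forall>c\<in>C. \<exists>l g. l \<in> obj J \<and> g \<in> hom J i l \<and> amap D i l g (fst c) = amap D i l g (snd c)"
    using ident by (metis prod.collapse)
  then obtain L G where LG: "\<And>c. c \<in> C \<Longrightarrow> L c \<in> obj J" "\<And>c. c \<in> C \<Longrightarrow> G c \<in> hom J i (L c)"
    "\<And>c. c \<in> C \<Longrightarrow> amap D i (L c) (G c) (fst c) = amap D i (L c) (G c) (snd c)"
    by metis
  have "|L ` C| <o |{..<k}|" by (rule ordLeq_ordLess_trans[OF card_of_image C(2)])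
  moreover have "L ` C \<subseteq> obj J" using LG(1) by blast
  ultimately obtain m h where m: "m \<in> obj J" and h: "\<And>s. s \<in> L ` C \<Longrightarrow> h s \<in> hom J s m"
    using upper_bound[of "L ` C"] by blast
  define T where "T c = cmp J i (L c) m (h (L c)) (G c)" for c
  have T_hom: "T c \<in> hom J i m" if "c \<in> C" for c
    unfolding T_def using i m LG(1,2)[OF that] h that by (intro cmp_hom) auto
  have T_card: "|T ` C| <o |{..<k}|" by (rule ordLeq_ordLess_trans[OF card_of_image C(2)])
  have T_sub: "T ` C \<subseteq> hom J i m" using T_hom by blast
  obtain n q where n: "n \<in> obj J" "q \<in> hom J m n"
    and q: "\<forall>f\<in>T ` C. \<forall>g\<in>T ` C. cmp J i m n q f = cmp J i m n q g"
    using coequalize[OF i m T_sub T_card] by blast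
  have "amap D i n (cmp J i m n q (T c0)) x = amap D i n (cmp J i m n q (T c0)) y" if xy: "(x, y) \<in> C" for x y
  proof -
    have *: "amap D i n (cmp J i m n q (T c0)) z =
        amap D m n q (amap D (L (x, y)) m (h (L (x, y))) (amap D i (L (x, y)) (G (x, y)) z))"
      if z: "z \<in> omap D i" for z
    proof -
      have "cmp J i m n q (T c0) = cmp J i m n q (T (x, y))" using q c0 xy by blast
      also have "amap D i n \<dots> z = amap D m n q (amap D i m (T (x, y)) z)"
        by (rule D_compose[OF i m n(1) T_hom[OF xy] n(2) z])
      also have "amap D i m (T (x, y)) z = amap D (L (x, y)) m (h (L (x, y))) (amap D i (L (x, y)) (G (x, y)) z)"
        unfolding T_def using i m LG(1,2)[OF xy] h xy z by (intro D_compose) auto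
      finally show ?thesis .
    qed
    have "x \<in> omap D i" "y \<in> omap D i" using C(1) xy by auto
    then show ?thesis using * LG(3)[OF xy] by simp
  qed
  then show ?thesis using that n(1) cmp_hom[OF i m n(1) T_hom[OF c0] n(2)] by blast
qed

lemma is_cocone_iff:
  "is_cocone J set_cat D c s \<longleftrightarrow> small c \<and> (\<forall>i\<in>obj J. s i \<in> omap D i \<rightarrow>\<^sub>E c) \<and>
    (\<forall>i\<in>obj J. \<forall>j\<in>obj J. \<forall>f\<in>hom J i j. \<forall>y\<in>omap D i. s j (amap D i j f y) = s i y)"
proof -
  have "compose (omap D i) (s j) (amap D i j f) = s i \<longleftrightarrow> (\<forall>y\<in>omap D i. s j (amap D i j f y) = s i y)"
    if "\<forall>i\<in>obj J. s i \<in> omap D i \<rightarrow>\<^sub>E c" "i \<in> obj J" for i j f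
    by (rule compose_eq_PiE_iff[OF bspec[OF that]])
  then show ?thesis unfolding is_cocone_def by (simp cong: conj_cong)
qed

text \<open>If the legs of a colimit were not jointly surjective, a map to a two-element set could be
  changed off their images.\<close>

lemma colimit_jointly_surj:
  assumes "is_colimit J set_cat D c s" "x \<in> c"
  shows "\<exists>i\<in>obj J. x \<in> s i ` omap D i"
proof -
  obtain p q :: 'u where pq: "p \<noteq> q" by (rule two_elements)
  have s: "s i \<in> omap D i \<rightarrow>\<^sub>E c" if "i \<in> obj J" for i
    using assms(1) that by (simp add: is_colimit_def is_cocone_iff)
  define s' where "s' i = (\<lambda>y\<in>omap D i. p)" for i
  have coc: "is_cocone J set_cat D {p, q} s'"
    using small_finite D_in by (auto simp: is_cocone_iff s'_def)
  define h1 where "h1 = (\<lambda>x\<in>c. p)"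
  define h2 where "h2 = (\<lambda>x\<in>c. if \<exists>i\<in>obj J. x \<in> s i ` omap D i then p else q)"
  have s'_PiE: "s' i \<in> omap D i \<rightarrow>\<^sub>E {p, q}" for i by (simp add: s'_def)
  have "h \<in> c \<rightarrow>\<^sub>E {p, q} \<and> (\<forall>i\<in>obj J. compose (omap D i) h (s i) = s' i)" if "h = h1 \<or> h = h2" for h
  proof -
    have hs: "h (s i y) = p" if "i \<in> obj J" "y \<in> omap D i" for i y
    proof -
      have "(\<exists>j\<in>obj J. s i y \<in> s j ` omap D j) = True" using that by blast
      then have "h1 (s i y) = p" "h2 (s i y) = p"
        using PiE_mem[OF s[OF that(1)] that(2)] by (simp_all only: h1_def h2_def restrict_apply' if_True)
      then show ?thesis using \<open>h = h1 \<or> h = h2\<close> by blast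
    qed
    have "h1 \<in> c \<rightarrow>\<^sub>E {p, q}" "h2 \<in> c \<rightarrow>\<^sub>E {p, q}"
      by (simp_all add: h1_def h2_def Pi_def)
    then have "h \<in> c \<rightarrow>\<^sub>E {p, q}" using \<open>h = h1 \<or> h = h2\<close> by blast
    with hs show ?thesis by (simp add: compose_eq_PiE_iff[OF s'_PiE]) (simp add: s'_def)
  qed
  moreover have "\<exists>!h. h \<in> c \<rightarrow>\<^sub>E {p, q} \<and> (\<forall>i\<in>obj J. compose (omap D i) h (s i) = s' i)"
    using assms(1) coc unfolding is_colimit_def by simp
  ultimately have "h1 = h2" by blast
  then have "h1 x = h2 x" by simp
  then show ?thesis using assms(2) pq by (auto simp: h1_def h2_def split: if_splits)
qed

text \<open>The elements that become equal to a given \<open>x \<in> D i\<close> further along the diagram are those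
  sent to \<open>p\<close> by a cocone with values in \<open>{p, q}\<close>, so a colimit distinguishes \<open>x\<close> from all others.\<close>

lemma colimit_identifies:
  assumes colim: "is_colimit J set_cat D c s" and i: "i \<in> obj J"
    and x: "x \<in> omap D i" and y: "y \<in> omap D i" and eq: "s i x = s i y"
  shows "\<exists>l\<in>obj J. \<exists>g\<in>hom J i l. amap D i l g x = amap D i l g y"
proof -
  obtain p q :: 'u where pq: "p \<noteq> q" by (rule two_elements)
  define R where "R j z \<longleftrightarrow>
    (\<exists>l\<in>obj J. \<exists>f\<in>hom J i l. \<exists>g\<in>hom J j l. amap D i l f x = amap D j l g z)" for j z
  have R_step: "R j' (amap D j j' h z) \<longleftrightarrow> R j z"
    if j: "j \<in> obj J" "j' \<in> obj J" and h: "h \<in> hom J j j'" and z: "z \<in> omap D j" for j j' h z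
  proof
    assume "R j' (amap D j j' h z)"
    then obtain l f g where l: "l \<in> obj J" "f \<in> hom J i l" "g \<in> hom J j' l"
      and fg: "amap D i l f x = amap D j' l g (amap D j j' h z)"
      unfolding R_def by blast
    then have "amap D i l f x = amap D j l (cmp J j j' l g h) z"
      using D_compose[OF j l(1) h l(3) z] by simp
    then show "R j z" unfolding R_def using l cmp_hom[OF j l(1) h l(3)] by blast
  next
    assume "R j z"
    then obtain l f g where l: "l \<in> obj J" "f \<in> hom J i l" "g \<in> hom J j l"
      and fg: "amap D i l f x = amap D j l g z"
      unfolding R_def by blast
    obtain m a b where m: "m \<in> obj J" "a \<in> hom J l m" "b \<in> hom J j' m"
      using upper_bound2[OF l(1) j(2)] by blast
    have ag: "cmp J j l m a g \<in> hom J j m" and bh: "cmp J j j' m b h \<in> hom J j m"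
      using cmp_hom j l m h by blast+
    obtain n r where n: "n \<in> obj J" "r \<in> hom J m n"
      and r: "\<And>y. y \<in> omap D j \<Longrightarrow> amap D m n r (amap D j m (cmp J j l m a g) y) =
        amap D m n r (amap D j m (cmp J j j' m b h) y)"
      using coequalize2[OF j(1) m(1) ag bh] by blast
    have "amap D i n (cmp J i m n r (cmp J i l m a f)) x = amap D m n r (amap D l m a (amap D i l f x))"
      using D_compose[OF i m(1) n(1) cmp_hom[OF i l(1) m(1) l(2) m(2)] n(2) x]
        D_compose[OF i l(1) m(1) l(2) m(2) x] by simp
    also have "\<dots> = amap D m n r (amap D j m (cmp J j l m a g) z)"
      using D_compose[OF j(1) l(1) m(1) l(3) m(2) z] fg by simp
    also have "\<dots> = amap D m n r (amap D j m (cmp J j j' m b h) z)" by (rule r[OF z])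
    also have "\<dots> = amap D m n r (amap D j' m b (amap D j j' h z))"
      using D_compose[OF j m(1) h m(3) z] by simp
    also have "\<dots> = amap D j' n (cmp J j' m n r b) (amap D j j' h z)"
      using D_compose[OF j(2) m(1) n(1) m(3) n(2) D_in[OF j h z]] by simp
    finally show "R j' (amap D j j' h z)"
      unfolding R_def
      using n(1) cmp_hom[OF i m(1) n(1) cmp_hom[OF i l(1) m(1) l(2) m(2)] n(2)]
        cmp_hom[OF j(2) m(1) n(1) m(3) n(2)] by blast
  qed
  define s' where "s' j = (\<lambda>z\<in>omap D j. if R j z then p else q)" for j
  have coc: "is_cocone J set_cat D {p, q} s'"
    using small_finite D_in R_step by (auto simp: is_cocone_iff s'_def)
  then have "\<exists>!h. h \<in> c \<rightarrow>\<^sub>E {p, q} \<and> (\<forall>i\<in>obj J. compose (omap D i) h (s i) = s' i)"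
    using colim unfolding is_colimit_def by simp
  then obtain h where "compose (omap D i) h (s i) = s' i" using i by blast
  then have "h (s i x) = s' i x" "h (s i y) = s' i y" using x y by (metis compose_eq)+
  then have "s' i x = s' i y" using eq by simp
  moreover have "R i x" unfolding R_def using i ident_hom by blast
  ultimately have "R i y" using x y pq by (auto simp: s'_def split: if_splits)
  then obtain l f g where l: "l \<in> obj J" "f \<in> hom J i l" "g \<in> hom J i l"
    and fg: "amap D i l f x = amap D i l g y"
    unfolding R_def by blast
  obtain m r where m: "m \<in> obj J" "r \<in> hom J l m"
    and r: "\<And>y. y \<in> omap D i \<Longrightarrow> amap D l m r (amap D i l f y) = amap D l m r (amap D i l g y)"
    using coequalize2[OF i l] by blast
  have "amap D i m (cmp J i l m r f) x = amap D i m (cmp J i l m r f) y"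
    using D_compose[OF i l(1) m(1) l(2) m(2)] x y fg r[OF y] by simp
  then show ?thesis using m(1) cmp_hom[OF i l(1) m(1) l(2) m(2)] by blast
qed

text \<open>The mediating map is computed on an arbitrary representative: two representatives of the same
  element meet further along the diagram.\<close>

lemma colimitI:
  assumes coc: "is_cocone J set_cat D c s"
    and surj: "\<And>x. x \<in> c \<Longrightarrow> \<exists>i\<in>obj J. x \<in> s i ` omap D i"
    and ident: "\<And>i x y. \<lbrakk>i \<in> obj J; x \<in> omap D i; y \<in> omap D i; s i x = s i y\<rbrakk> \<Longrightarrow>
      \<exists>l\<in>obj J. \<exists>g\<in>hom J i l. amap D i l g x = amap D i l g y"
  shows "is_colimit J set_cat D c s"
  unfolding is_colimit_def
proof (intro conjI allI impI coc)
  fix c' s' assume coc': "is_cocone J set_cat D c' s'"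
  have s: "s i \<in> omap D i \<rightarrow>\<^sub>E c" if "i \<in> obj J" for i using coc that by (simp add: is_cocone_iff)
  have s': "s' i \<in> omap D i \<rightarrow>\<^sub>E c'" if "i \<in> obj J" for i using coc' that by (simp add: is_cocone_iff)
  have step: "s j (amap D i j f y) = s i y" "s' j (amap D i j f y) = s' i y"
    if "i \<in> obj J" "j \<in> obj J" "f \<in> hom J i j" "y \<in> omap D i" for i j f y
    using coc coc' that by (simp_all add: is_cocone_iff)
  have well_def: "s' i x = s' j y"
    if ij: "i \<in> obj J" "j \<in> obj J" and xy: "x \<in> omap D i" "y \<in> omap D j" and eq: "s i x = s j y" for i j x y
  proof -
    obtain l f g where l: "l \<in> obj J" "f \<in> hom J i l" "g \<in> hom J j l"
      using upper_bound2[OF ij] by blast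
    let ?x = "amap D i l f x" and ?y = "amap D j l g y"
    have in_l: "?x \<in> omap D l" "?y \<in> omap D l" using D_in ij l xy by blast+
    have "s l ?x = s l ?y" using step(1)[OF ij(1) l(1,2) xy(1)] step(1)[OF ij(2) l(1,3) xy(2)] eq by simp
    then obtain m h where m: "m \<in> obj J" "h \<in> hom J l m" "amap D l m h ?x = amap D l m h ?y"
      using ident[OF l(1) in_l] by blast
    then have "s' l ?x = s' l ?y" using step(2)[OF l(1) m(1,2)] in_l by metis
    then show ?thesis using step(2)[OF ij(1) l(1,2) xy(1)] step(2)[OF ij(2) l(1,3) xy(2)] by simp
  qed
  have "\<forall>x\<in>c. \<exists>i y. i \<in> obj J \<and> y \<in> omap D i \<and> s i y = x" using surj by blast
  then obtain I Y where IY: "\<And>x. x \<in> c \<Longrightarrow> I x \<in> obj J" "\<And>x. x \<in> c \<Longrightarrow> Y x \<in> omap D (I x)"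
    "\<And>x. x \<in> c \<Longrightarrow> s (I x) (Y x) = x"
    by metis
  define h where "h = (\<lambda>x\<in>c. s' (I x) (Y x))"
  have h: "h \<in> c \<rightarrow>\<^sub>E c'" unfolding h_def using PiE_mem[OF s'] IY(1,2) by auto
  have hs: "h (s i y) = s' i y" if "i \<in> obj J" "y \<in> omap D i" for i y
  proof -
    have c: "s i y \<in> c" using PiE_mem[OF s] that by blast
    show ?thesis using well_def[OF IY(1)[OF c] that(1) IY(2)[OF c] that(2) IY(3)[OF c]] c by (simp add: h_def)
  qed
  show "\<exists>!h. h \<in> hom set_cat c c' \<and>
      (\<forall>i\<in>obj J. cmp set_cat (omap D i) c c' h (s i) = s' i)"
  proof (rule ex1I)
    show "h \<in> hom set_cat c c' \<and> (\<forall>i\<in>obj J. cmp set_cat (omap D i) c c' h (s i) = s' i)"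
      using h hs by (simp add: compose_eq_PiE_iff[OF s'])
    fix g assume g: "g \<in> hom set_cat c c' \<and> (\<forall>i\<in>obj J. cmp set_cat (omap D i) c c' g (s i) = s' i)"
    then have gs: "g (s i y) = s' i y" if "i \<in> obj J" "y \<in> omap D i" for i y
      using that by (simp add: compose_eq_PiE_iff[OF s'])
    have "g \<in> c \<rightarrow>\<^sub>E c'" using g by simp
    then show "g = h"
    proof (rule PiE_ext[OF _ h])
      fix x assume "x \<in> c"
      then obtain i y where "i \<in> obj J" "y \<in> omap D i" "x = s i y" using surj by blast
      then show "g x = h x" using gs hs by simp
    qed
  qed
qed

end

section \<open>Supports and accessibility\<close>

lemma is_functor_fctr_comp:
  "is_functor C C' D \<Longrightarrow> is_functor C' C'' F \<Longrightarrow> is_functor C C'' (fctr_comp F D)"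
  unfolding is_functor_def fctr_comp_def by simp

lemma card_of_Times_less:
  assumes "infinite B" "|A| <o |B|"
  shows "|A \<times> A| <o |B|"
proof (cases "finite A")
  case True
  then show ?thesis using assms(1) by (simp add: finite_ordLess_infinite_sets)
next
  case False
  then show ?thesis using ordIso_ordLess_trans[OF card_of_Times_same_infinite assms(2)] by blast
qed

text \<open>A support has fewer than \<open>k\<close> elements, so it lifts to one stage of the diagram. Let further
  \<open>u\<close> and \<open>v\<close> over \<open>D i\<close> become equal over the colimit \<open>c\<close>. They come from the union \<open>U\<close> of their supports,
  on which the leg \<open>s i\<close> factors through its image \<open>V\<close>; as \<open>F V\<close> embeds into \<open>F c\<close>, they are equal
  over \<open>V\<close>. An arrow \<open>g\<close> to some \<open>l\<close> that identifies all pairs in \<open>U\<close> with the same image in \<open>c\<close> factors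
  on \<open>U\<close> through \<open>V\<close>, too, so \<open>u\<close> and \<open>v\<close> are equal over \<open>D l\<close>.\<close>

lemma (in supported_functor) accessible_of_small_supports:
  assumes k: "infinite {..<k :: 'u}"
    and supp: "\<And>X e. small X \<Longrightarrow> e \<in> omap F X \<Longrightarrow> |supp F X e| <o |{..<k}|"
  shows "accessible k F"
  unfolding accessible_def
proof (intro allI impI, elim conjE)
  fix J :: "('u, 'u) cat" and D :: "('u, 'u, 'u set, 'u \<Rightarrow> 'u) fctr" and c s
  assume J: "small_category J" "filtered k J" "is_functor J set_cat D" and colim: "is_colimit J set_cat D c s"
  interpret D: filtered_diagram t k J D
    using k J by unfold_locales (simp_all add: small_category_def)
  interpret FD: filtered_diagram t k J "fctr_comp F D"
    using k J is_functor_fctr_comp[OF J(3) is_functor] by unfold_locales (simp_all add: small_category_def)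
  have FD: "omap (fctr_comp F D) i = omap F (omap D i)"
    "amap (fctr_comp F D) i j f = amap F (omap D i) (omap D j) (amap D i j f)" for i j f
    by (simp_all add: fctr_comp_def)
  have c: "small c" and s: "\<And>i. i \<in> obj J \<Longrightarrow> s i \<in> omap D i \<rightarrow>\<^sub>E c"
    and step: "\<And>i j f y. \<lbrakk>i \<in> obj J; j \<in> obj J; f \<in> hom J i j; y \<in> omap D i\<rbrakk> \<Longrightarrow>
      s j (amap D i j f y) = s i y"
    using colim by (simp_all add: is_colimit_def D.is_cocone_iff)
  show "is_colimit J set_cat (fctr_comp F D) (omap F c) (\<lambda>i. amap F (omap D i) c (s i))"
  proof (rule FD.colimitI)
    show "is_cocone J set_cat (fctr_comp F D) (omap F c) (\<lambda>i. amap F (omap D i) c (s i))"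
      unfolding FD.is_cocone_iff FD
      using c small_omap amap_PiE[OF D.small_D c s]
      by (auto intro!: amap_triangle[OF D.small_D D.small_D c D.D_PiE s s] step)
  next
    fix e assume e: "e \<in> omap F c"
    let ?S = "supp F c e"
    have S: "?S \<subseteq> c" "small ?S" using supp_subset[OF c e] small_subset[OF c] by auto
    obtain e' where e': "e' \<in> omap F ?S" "e = amap F ?S c (\<lambda>u\<in>?S. u) e'"
      using carries_supp[OF c e] by (auto simp: carries_def)
    have "\<forall>x\<in>?S. \<exists>i y. i \<in> obj J \<and> y \<in> omap D i \<and> s i y = x"
      using D.colimit_jointly_surj[OF colim] S(1) by blast
    then obtain I Y where IY: "\<And>x. x \<in> ?S \<Longrightarrow> I x \<in> obj J" "\<And>x. x \<in> ?S \<Longrightarrow> Y x \<in> omap D (I x)"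
      "\<And>x. x \<in> ?S \<Longrightarrow> s (I x) (Y x) = x"
      by metis
    have "|I ` ?S| <o |{..<k}|" using ordLeq_ordLess_trans[OF card_of_image supp[OF c e]] .
    moreover have "I ` ?S \<subseteq> obj J" using IY(1) by blast
    ultimately obtain l h where l: "l \<in> obj J" and h: "\<And>i. i \<in> I ` ?S \<Longrightarrow> h i \<in> hom J i l"
      using D.upper_bound[of "I ` ?S"] by blast
    define y where "y = (\<lambda>x\<in>?S. amap D (I x) l (h (I x)) (Y x))"
    have y: "y \<in> ?S \<rightarrow>\<^sub>E omap D l" unfolding y_def using IY l h by (auto intro!: D.D_in)
    have "s l (y x) = x" if "x \<in> ?S" for x
      using step[OF IY(1)[OF that] l h IY(2)[OF that]] that IY(3)[OF that] by (simp add: y_def)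
    then have "amap F (omap D l) c (s l) (amap F ?S (omap D l) y e') = amap F ?S c (\<lambda>u\<in>?S. u) e'"
      by (intro amap_triangle[OF S(2) D.small_D[OF l] c y s[OF l] inclusion_PiE[OF S(1)] _ e'(1)]) simp
    then have "e = amap F (omap D l) c (s l) (amap F ?S (omap D l) y e')"
      by (rule trans[OF e'(2) sym])
    then show "\<exists>i\<in>obj J. e \<in> amap F (omap D i) c (s i) ` omap (fctr_comp F D) i"
      unfolding FD by (rule bexI[OF image_eqI l]) (rule amap_in[OF S(2) D.small_D[OF l] y e'(1)])
  next
    fix i u v
    assume i: "i \<in> obj J" and "u \<in> omap (fctr_comp F D) i" "v \<in> omap (fctr_comp F D) i"
      and eq: "amap F (omap D i) c (s i) u = amap F (omap D i) c (s i) v"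
    then have u: "u \<in> omap F (omap D i)" and v: "v \<in> omap F (omap D i)" by (simp_all add: FD)
    note Di = D.small_D[OF i]
    define U where "U = supp F (omap D i) u \<union> supp F (omap D i) v"
    have U: "U \<subseteq> omap D i" "small U"
      using supp_subset[OF Di] u v small_subset[OF Di] by (auto simp: U_def)
    have U_card: "|U| <o |{..<k}|"
      unfolding U_def by (rule card_of_Un_ordLess_infinite[OF k supp[OF Di u] supp[OF Di v]])
    have incl: "(\<lambda>x\<in>U. x) \<in> U \<rightarrow>\<^sub>E omap D i" "inj_on (\<lambda>x\<in>U. x) U"
      using U by (auto simp: inj_on_def)
    have "supp F (omap D i) u \<subseteq> U" "supp F (omap D i) v \<subseteq> U" by (auto simp: U_def)
    then have uU: "u \<in> amap F U (omap D i) (\<lambda>x\<in>U. x) ` omap F U"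
      and vU: "v \<in> amap F U (omap D i) (\<lambda>x\<in>U. x) ` omap F U"
      by (simp_all add: in_amap_image_iff[OF U(2) Di incl u] in_amap_image_iff[OF U(2) Di incl v])
    obtain u' where u': "u' \<in> omap F U" "u = amap F U (omap D i) (\<lambda>x\<in>U. x) u'"
      using uU by (rule imageE)
    obtain v' where v': "v' \<in> omap F U" "v = amap F U (omap D i) (\<lambda>x\<in>U. x) v'"
      using vU by (rule imageE)
    define V where "V = s i ` U"
    have V: "V \<subseteq> c" "small V" using U s[OF i] small_image by (auto simp: V_def)
    define p where "p = restrict (s i) U"
    have p: "p \<in> U \<rightarrow>\<^sub>E V" by (simp add: p_def V_def)
    have inclV: "(\<lambda>x\<in>V. x) \<in> V \<rightarrow>\<^sub>E c" "inj_on (\<lambda>x\<in>V. x) V" using V by (auto simp: inj_on_def)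
    have pV: "amap F V c (\<lambda>x\<in>V. x) (amap F U V p w) =
        amap F (omap D i) c (s i) (amap F U (omap D i) (\<lambda>x\<in>U. x) w)" if "w \<in> omap F U" for w
      by (rule amap_square[OF U(2) V(2) Di c p inclV(1) incl(1) s[OF i] _ that]) (simp add: p_def V_def)
    have "amap F V c (\<lambda>x\<in>V. x) (amap F U V p u') = amap F V c (\<lambda>x\<in>V. x) (amap F U V p v')"
      using pV u' v' eq by simp
    then have p_eq: "amap F U V p u' = amap F U V p v'"
      using inj_onD[OF amap_inj[OF V(2) c inclV]] amap_in[OF U(2) V(2) p] u'(1) v'(1) by blast
    define C where "C = {(x, y) \<in> U \<times> U. s i x = s i y}"
    have C_card: "|C| <o |{..<k}|"
      using ordLeq_ordLess_trans[OF card_of_mono1 card_of_Times_less[OF k U_card], of C]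
      by (auto simp: C_def)
    have C_sub: "C \<subseteq> omap D i \<times> omap D i" using U by (auto simp: C_def)
    have C_ident: "\<exists>l\<in>obj J. \<exists>g\<in>hom J i l. amap D i l g x = amap D i l g y" if "(x, y) \<in> C" for x y
      using D.colimit_identifies[OF colim i, of x y] that C_sub by (auto simp: C_def)
    obtain l g where l: "l \<in> obj J" "g \<in> hom J i l"
      and g: "\<And>x y. (x, y) \<in> C \<Longrightarrow> amap D i l g x = amap D i l g y"
      using D.identify_simultaneously[OF i C_sub C_card C_ident] by blast
    note Dl = D.small_D[OF l(1)] and Dg = D.D_PiE[OF i l]
    define w where "w = (\<lambda>z\<in>V. amap D i l g (inv_into U (s i) z))"
    have w: "w \<in> V \<rightarrow>\<^sub>E omap D l"
      using U by (auto simp: w_def V_def intro!: PiE_mem[OF Dg] subsetD[OF U(1)] inv_into_into)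
    have wp: "w (p x) = amap D i l g ((\<lambda>x\<in>U. x) x)" if "x \<in> U" for x
    proof -
      have "s i x \<in> s i ` U" using that by simp
      then have "(inv_into U (s i) (s i x), x) \<in> C"
        using that inv_into_into[of "s i x" "s i" U] f_inv_into_f[of "s i x" "s i" U] by (simp add: C_def)
      then show ?thesis using g that by (simp add: w_def p_def V_def)
    qed
    have "amap F (omap D i) (omap D l) (amap D i l g) (amap F U (omap D i) (\<lambda>x\<in>U. x) z) =
        amap F V (omap D l) w (amap F U V p z)" if "z \<in> omap F U" for z
      by (rule amap_square[OF U(2) V(2) Di Dl p w incl(1) Dg wp that, symmetric])
    then have "amap F (omap D i) (omap D l) (amap D i l g) u = amap F (omap D i) (omap D l) (amap D i l g) v"
      using u' v' p_eq by simp
    then show "\<exists>l\<in>obj J. \<exists>g\<in>hom J i l. amap (fctr_comp F D) i l g u = amap (fctr_comp F D) i l g v"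
      unfolding FD using l by blast
  qed
qed

text \<open>A set is the \<open>k\<close>-filtered union of its subsets of size less than \<open>k\<close>, by regularity of \<open>k\<close>.
  If the functor preserves this union, then one of these subsets carries a given element.\<close>

lemma (in endofunctor) small_carrier_of_accessible:
  assumes k: "regular_cardinal (k :: 'u)" and acc: "accessible k F" and X: "small X" and e: "e \<in> omap F X"
  shows "\<exists>U. carries F X U e \<and> |U| <o |{..<k}|"
proof -
  have inf: "infinite {..<k}" and reg: "regularCard |{..<k}|" using k by (auto simp: regular_cardinal_def)
  define \<A> where "\<A> = {U. U \<subseteq> X \<and> |U| <o |{..<k}|}"
  have sub: "\<A> \<subseteq> Pow X" by (auto simp: \<A>_def)
  obtain enc :: "'u set \<Rightarrow> 'u" where enc: "inj_on enc (Pow X)" "\<And>\<A>. \<A> \<subseteq> Pow X \<Longrightarrow> small (enc ` \<A>)"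
    using encode_subsets[OF X] by blast
  define V where "V = inv_into \<A> enc"
  have "inj_on enc \<A>" using enc(1) sub by (rule inj_on_subset)
  then have V_enc: "V (enc U) = U" if "U \<in> \<A>" for U using that by (simp add: V_def)
  \<comment> \<open>The poset of these subsets as a category: the only arrow from \<open>i\<close> to \<open>j\<close> is \<open>i\<close> itself.\<close>
  define J where "J = \<lparr>obj = enc ` \<A>, hom = (\<lambda>i j. if V i \<subseteq> V j then {i} else {}),
    ident = (\<lambda>i. i), cmp = (\<lambda>i j l g f. i)\<rparr>"
  define D :: "('u, 'u, 'u set, 'u \<Rightarrow> 'u) fctr" where "D = \<lparr>omap = V, amap = (\<lambda>i j f. \<lambda>u\<in>V i. u)\<rparr>"
  have V_in: "V i \<in> \<A>" if "i \<in> obj J" for i using that V_enc by (auto simp: J_def)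
  then have VX: "V i \<subseteq> X" if "i \<in> obj J" for i using that by (auto simp: \<A>_def)
  then have V_small: "small (V i)" if "i \<in> obj J" for i using small_subset[OF X] that by blast
  have cat: "is_category J"
    unfolding is_category_def by (auto simp: J_def split: if_splits)
  have "small_category J"
    unfolding small_category_def using cat enc(2)[OF sub] small_finite by (simp add: J_def)
  moreover have filt: "filtered k J"
    unfolding filtered_def
  proof (intro conjI allI impI ballI)
    fix S assume S: "S \<subseteq> obj J" "|S| <o |{..<k}|"
    have "|\<Union>i\<in>S. V i| <o |{..<k}|"
      using inf V_in S(1) by (intro regularCard_UNION_bound[OF _ reg S(2)])
        (auto simp: cinfinite_def Field_card_of card_of_card_order_on \<A>_def)
    moreover have "(\<Union>i\<in>S. V i) \<subseteq> X" using VX S(1) by blast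
    ultimately have "(\<Union>i\<in>S. V i) \<in> \<A>" by (simp add: \<A>_def)
    then have "enc (\<Union>i\<in>S. V i) \<in> obj J" "\<forall>s\<in>S. hom J s (enc (\<Union>i\<in>S. V i)) \<noteq> {}"
      using V_enc by (auto simp: J_def)
    then show "\<exists>c\<in>obj J. \<forall>s\<in>S. hom J s c \<noteq> {}" by blast
  next
    fix i j S assume "i \<in> obj J" "j \<in> obj J" "S \<subseteq> hom J i j"
    then show "\<exists>l\<in>obj J. \<exists>h\<in>hom J j l. \<forall>f\<in>S. \<forall>g\<in>S. cmp J i j l h f = cmp J i j l h g"
      by (intro bexI[of _ j] bexI[of _ "ident J j"]) (auto simp: J_def)
  qed
  moreover have funD: "is_functor J set_cat D"
    unfolding is_functor_def using V_small
    by (auto simp: D_def J_def compose_def restrict_def fun_eq_iff subset_iff split: if_splits)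
  moreover have colim: "is_colimit J set_cat D X (\<lambda>i. \<lambda>u\<in>V i. u)"
  proof -
    interpret D: filtered_diagram t k J D using inf cat filt funD by unfold_locales
    show ?thesis
    proof (rule D.colimitI)
      show "is_cocone J set_cat D X (\<lambda>i. \<lambda>u\<in>V i. u)"
        unfolding D.is_cocone_iff using X VX
        by (auto simp: D_def J_def subset_iff split: if_splits)
    next
      fix x assume x: "x \<in> X"
      have "|{x}| <o |{..<k}|" using inf by (simp add: finite_ordLess_infinite_sets)
      then have "{x} \<in> \<A>" using x by (simp add: \<A>_def)
      then have "enc {x} \<in> obj J" "x \<in> V (enc {x})" using V_enc by (auto simp: J_def)
      then show "\<exists>i\<in>obj J. x \<in> (\<lambda>u\<in>V i. u) ` omap D i" by (auto simp: D_def)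
    next
      fix i x y assume "i \<in> obj J" "x \<in> omap D i" "y \<in> omap D i" "(\<lambda>u\<in>V i. u) x = (\<lambda>u\<in>V i. u) y"
      then show "\<exists>l\<in>obj J. \<exists>g\<in>hom J i l. amap D i l g x = amap D i l g y"
        using D.ident_hom by (auto simp: D_def)
    qed
  qed
  ultimately have F_colim: "is_colimit J set_cat (fctr_comp F D) (omap F X)
      (\<lambda>i. amap F (omap D i) X (\<lambda>u\<in>V i. u))"
    using acc unfolding accessible_def by blast
  interpret FD: filtered_diagram t k J "fctr_comp F D"
    using inf cat filt is_functor_fctr_comp[OF funD is_functor] by unfold_locales
  obtain i where "i \<in> obj J" "e \<in> amap F (V i) X (\<lambda>u\<in>V i. u) ` omap F (V i)"
    using FD.colimit_jointly_surj[OF F_colim e] by (auto simp: D_def fctr_comp_def)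
  then have "carries F X (V i) e \<and> |V i| <o |{..<k}|"
    using VX V_in by (auto simp: carries_def \<A>_def)
  then show ?thesis by blast
qed

lemma (in supported_functor) accessible_iff:
  assumes k: "regular_cardinal (k :: 'u)"
  shows "accessible k F \<longleftrightarrow> (\<forall>X. small X \<longrightarrow> (\<forall>e\<in>omap F X. |supp F X e| <o |{..<k}| ))"
proof
  assume acc: "accessible k F"
  show "\<forall>X. small X \<longrightarrow> (\<forall>e\<in>omap F X. |supp F X e| <o |{..<k}| )"
  proof (intro allI impI ballI)
    fix X e assume "small X" "e \<in> omap F X"
    then obtain U where U: "carries F X U e" "|U| <o |{..<k}|"
      using small_carrier_of_accessible[OF k acc] by blast
    show "|supp F X e| <o |{..<k}|"
      by (rule ordLeq_ordLess_trans[OF card_of_mono1[OF supp_least[OF U(1)]] U(2)])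
  qed
next
  assume "\<forall>X. small X \<longrightarrow> (\<forall>e\<in>omap F X. |supp F X e| <o |{..<k}| )"
  then show "accessible k F"
    using accessible_of_small_supports k by (simp add: regular_cardinal_def)
qed

section \<open>Injections from cardinals\<close>

lemma injections_iff: "x \<in> injections a X \<longleftrightarrow> x \<in> {..<a} \<rightarrow>\<^sub>E X \<and> inj_on x {..<a}"
  by (simp add: injections_def)

lemma permutations_iff: "s \<in> permutations a \<longleftrightarrow> s \<in> {..<a} \<rightarrow>\<^sub>E {..<a} \<and> bij_betw s {..<a} {..<a}"
  by (simp add: permutations_def)

lemma identity_permutation: "(\<lambda>i\<in>{..<a}. i) \<in> permutations a"
  by (simp add: permutations_iff bij_betw_def inj_on_def)

lemma permutation_inverse:
  assumes "s \<in> permutations a"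
  obtains s' where "s' \<in> permutations a" "compose {..<a} s s' = (\<lambda>i\<in>{..<a}. i)"
    "compose {..<a} s' s = (\<lambda>i\<in>{..<a}. i)"
proof -
  let ?s' = "\<lambda>i\<in>{..<a}. inv_into {..<a} s i"
  have bij: "bij_betw s {..<a} {..<a}" using assms by (simp add: permutations_iff)
  have "bij_betw ?s' {..<a} {..<a} \<longleftrightarrow> bij_betw (inv_into {..<a} s) {..<a} {..<a}"
    by (rule bij_betw_cong) simp
  then have "bij_betw ?s' {..<a} {..<a}" using bij_betw_inv_into[OF bij] by blast
  then have "?s' \<in> permutations a" by (simp add: permutations_iff bij_betw_imp_funcset)
  then show ?thesis
    using that compose_id_inv_into[of s "{..<a}" "{..<a}"] compose_inv_into_id[OF bij] bij
    by (simp add: bij_betw_def)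
qed

lemma (in universe) ex_enumeration:
  assumes "small U" "U \<subseteq> (X :: 'u set)"
  shows "\<exists>x\<in>injections (cardinal_of U) X. x ` {..<cardinal_of U} = U"
proof -
  let ?a = "cardinal_of U"
  obtain h where h: "bij_betw h {..<?a} U"
    using cardinal_of_ordIso[OF assms(1)] card_of_ordIso by blast
  then have "restrict h {..<?a} \<in> injections ?a X" "restrict h {..<?a} ` {..<?a} = U"
    using assms(2) by (auto simp: injections_iff bij_betw_def)
  then show ?thesis by blast
qed

lemma (in universe) injections_same_image:
  fixes x y :: "'u \<Rightarrow> 'u"
  assumes a: "is_cardinal a" and b: "is_cardinal b" and x: "x \<in> injections a X" and y: "y \<in> injections b X"
    and eq: "x ` {..<a} = y ` {..<b}"
  shows "a = b" "\<exists>s\<in>permutations a. x = compose {..<a} y s"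
proof -
  have inj: "inj_on x {..<a}" "inj_on y {..<b}" using x y by (simp_all add: injections_iff)
  then show ab: "a = b"
    using cardinal_of_inj_image[OF a inj(1)] cardinal_of_inj_image[OF b inj(2)] eq by simp
  define s where "s = (\<lambda>i\<in>{..<a}. inv_into {..<a} y (x i))"
  have "bij_betw x {..<a} (y ` {..<a})" using inj eq ab by (simp add: bij_betw_def)
  moreover have "bij_betw (inv_into {..<a} y) (y ` {..<a}) {..<a}"
    using inj(2) ab by (simp add: bij_betw_inv_into inj_on_imp_bij_betw)
  ultimately have "bij_betw (inv_into {..<a} y \<circ> x) {..<a} {..<a}" by (rule bij_betw_trans)
  moreover have "bij_betw s {..<a} {..<a} \<longleftrightarrow> bij_betw (inv_into {..<a} y \<circ> x) {..<a} {..<a}"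
    by (rule bij_betw_cong) (simp add: s_def)
  ultimately have "s \<in> permutations a"
    by (simp add: permutations_iff bij_betw_imp_funcset s_def)
  moreover have "y (s i) = x i" if "i < a" for i
  proof -
    have "x i \<in> y ` {..<a}" using that eq ab by blast
    then show ?thesis using that by (simp add: s_def f_inv_into_f)
  qed
  then have "compose {..<a} y s = x"
    using x compose_eq_PiE_iff[of x "{..<a}" X y s] by (simp add: injections_iff)
  ultimately show "\<exists>s\<in>permutations a. x = compose {..<a} y s" by blast
qed

lemma obj_surj_cat [simp]: "obj (surj_cat K) = {a \<in> K. is_cardinal a}"
  and hom_surj_cat [simp]: "hom (surj_cat K) a b = {s \<in> {..<a} \<rightarrow>\<^sub>E {..<b}. s ` {..<a} = {..<b}}"
  and ident_surj_cat [simp]: "ident (surj_cat K) a = (\<lambda>x\<in>{..<a}. x)"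
  and cmp_surj_cat [simp]: "cmp (surj_cat K) a b c g f = compose {..<a} g f"
  by (simp_all add: surj_cat_def)

lemma permutations_hom: "s \<in> permutations a \<Longrightarrow> s \<in> hom (surj_cat K) a a"
  by (simp add: permutations_iff bij_betw_def)

text \<open>Enumerate the image of the map by its cardinal.\<close>

lemma (in universe) ex_surj_inj_factorization:
  fixes f :: "'u \<Rightarrow> 'u"
  assumes a: "is_cardinal a" and f: "f \<in> {..<a} \<rightarrow>\<^sub>E Y"
  shows "\<exists>b\<le>a. is_cardinal b \<and> (\<exists>y\<in>injections b Y. \<exists>s\<in>hom (surj_cat K) a b. f = compose {..<a} y s)"
proof -
  let ?U = "f ` {..<a}" and ?b = "cardinal_of (f ` {..<a})"
  have U: "small ?U" "?U \<subseteq> Y" using small_image[OF small_lessThan] f by auto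
  have b: "is_cardinal ?b" using U(1) by (rule is_cardinal_cardinal_of)
  have "?b \<le> a"
  proof (rule ccontr)
    assume "\<not> ?b \<le> a"
    then have "|{..<a}| <o |{..<?b}|" unfolding is_cardinal_less_iff[OF a b, symmetric] by simp
    then have "|{..<a}| <o |?U|" by (rule ordLess_ordIso_trans[OF _ cardinal_of_ordIso[OF U(1)]])
    then show False using not_ordLess_ordLeq card_of_image by metis
  qed
  obtain y where y: "y \<in> injections ?b Y" and y_im: "y ` {..<?b} = ?U"
    using ex_enumeration[OF U] by blast
  define s where "s = (\<lambda>i\<in>{..<a}. inv_into {..<?b} y (f i))"
  have y_bij: "bij_betw y {..<?b} ?U" using y y_im by (simp add: injections_iff bij_betw_def)
  have "s ` {..<a} = inv_into {..<?b} y ` ?U" by (auto simp: s_def)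
  also have "\<dots> = {..<?b}" using bij_betw_inv_into[OF y_bij] by (simp add: bij_betw_def)
  finally have s_im: "s ` {..<a} = {..<?b}" .
  have "s \<in> extensional {..<a}" by (simp add: s_def)
  with s_im have s: "s \<in> hom (surj_cat K) a ?b" by (auto simp: PiE_iff)
  have "y (s i) = f i" if "i < a" for i
    using that y_im by (simp add: s_def f_inv_into_f)
  then have "compose {..<a} y s = f" by (simp add: compose_eq_PiE_iff[OF f])
  then show ?thesis using \<open>?b \<le> a\<close> b y s by blast
qed

lemma compose_injection:
  "x \<in> injections a X \<Longrightarrow> f \<in> X \<rightarrow>\<^sub>E Y \<Longrightarrow> inj_on f X \<Longrightarrow> compose {..<a} f x \<in> injections a Y"
  by (auto simp: injections_iff compose_def inj_on_def Pi_iff PiE_iff)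

lemma compose_permutation: "x \<in> injections a X \<Longrightarrow> s \<in> permutations a \<Longrightarrow> compose {..<a} x s \<in> injections a X"
  by (auto simp: injections_iff permutations_iff compose_def inj_on_def bij_betw_def Pi_iff PiE_iff)

section \<open>The functor associated with a coefficient functor\<close>

text \<open>The set \<open>K\<close> is downward closed so that it contains, along with \<open>a\<close>, the cardinals of the images of
  all maps defined on \<open>{..<a}\<close>: the action of the functor on maps passes to such images.\<close>

locale coefficients = universe t for t :: "'u::wellorder itself" +
  fixes K :: "'u set" and R :: "'u coeffs"
  assumes downward: "\<And>a b. b \<in> K \<Longrightarrow> a \<le> b \<Longrightarrow> a \<in> K"
    and coeffs: "is_functor (surj_cat K) set_cat R"
begin

lemma R_in:
  assumes "a \<in> obj (surj_cat K)" "b \<in> obj (surj_cat K)" "s \<in> hom (surj_cat K) a b" "r \<in> omap R a"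
  shows "amap R a b s r \<in> omap R b"
proof -
  have "amap R a b s \<in> hom set_cat (omap R a) (omap R b)"
    using coeffs assms(1-3) unfolding is_functor_def by blast
  then show ?thesis using assms(4) by auto
qed

lemma R_id: "a \<in> obj (surj_cat K) \<Longrightarrow> r \<in> omap R a \<Longrightarrow> amap R a a (\<lambda>x\<in>{..<a}. x) r = r"
  using coeffs by (simp add: is_functor_def)

lemma R_compose:
  assumes "a \<in> obj (surj_cat K)" "b \<in> obj (surj_cat K)" "c \<in> obj (surj_cat K)"
    "f \<in> hom (surj_cat K) a b" "g \<in> hom (surj_cat K) b c" "r \<in> omap R a"
  shows "amap R a c (compose {..<a} g f) r = amap R b c g (amap R a b f r)"
proof -
  have "amap R a c (cmp (surj_cat K) a b c g f) =
      cmp set_cat (omap R a) (omap R b) (omap R c) (amap R b c g) (amap R a b f)"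
    using coeffs assms(1-5) unfolding is_functor_def by blast
  then show ?thesis using assms(6) by (simp add: compose_eq)
qed

lemma san_triples_iff:
  "(a, x, r) \<in> san_triples K R X \<longleftrightarrow> a \<in> obj (surj_cat K) \<and> x \<in> injections a X \<and> r \<in> omap R a"
  by (simp add: san_triples_def)

lemma san_rel_iff:
  "((a, x, r), (b, y, q)) \<in> san_rel K R X \<longleftrightarrow>
    b = a \<and> a \<in> obj (surj_cat K) \<and> y \<in> injections a X \<and> r \<in> omap R a \<and>
    (\<exists>s\<in>permutations a. x = compose {..<a} y s \<and> q = amap R a a s r)"
  unfolding san_rel_def by blast

lemma equiv_san_rel: "equiv (san_triples K R X) (san_rel K R X)"
proof (rule equivI)
  show "san_rel K R X \<subseteq> san_triples K R X \<times> san_triples K R X"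
    using compose_permutation R_in[OF _ _ permutations_hom]
    by (fastforce simp: san_rel_def san_triples_iff simp del: obj_surj_cat hom_surj_cat)
  show "refl_on (san_triples K R X) (san_rel K R X)"
  proof (rule refl_onI)
    fix t assume "t \<in> san_triples K R X"
    then obtain a x r where t: "t = (a, x, r)" "a \<in> obj (surj_cat K)" "x \<in> injections a X" "r \<in> omap R a"
      by (auto simp: san_triples_def)
    have "x = compose {..<a} x (\<lambda>i\<in>{..<a}. i)"
      using t(3) compose_Id[of x "{..<a}" X] by (auto simp: injections_iff PiE_iff)
    moreover have "r = amap R a a (\<lambda>i\<in>{..<a}. i) r" using R_id[OF t(2,4)] by simp
    ultimately show "(t, t) \<in> san_rel K R X"
      unfolding t(1) san_rel_iff using t(2-4) identity_permutation by blast
  qed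
  show "sym (san_rel K R X)"
  proof (rule symI)
    fix t t' assume tt': "(t, t') \<in> san_rel K R X"
    obtain a x r where t: "t = (a, x, r)" by (cases t)
    obtain b y q where t': "t' = (b, y, q)" by (cases t')
    from tt' obtain s where a: "a \<in> obj (surj_cat K)" and y: "y \<in> injections a X" and r: "r \<in> omap R a"
      and s: "s \<in> permutations a" and eq: "b = a" "x = compose {..<a} y s" "q = amap R a a s r"
      unfolding t t' san_rel_iff by blast
    obtain s' where s': "s' \<in> permutations a" "compose {..<a} s s' = (\<lambda>i\<in>{..<a}. i)"
      "compose {..<a} s' s = (\<lambda>i\<in>{..<a}. i)"
      using permutation_inverse[OF s] by blast
    have "compose {..<a} x s' = compose {..<a} y (compose {..<a} s s')"
      using s'(1) unfolding eq(2) by (intro compose_assoc[symmetric]) (auto simp: permutations_iff)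
    also have "\<dots> = y"
      unfolding s'(2) using y by (intro compose_Id[of y "{..<a}" X]) (auto simp: injections_iff PiE_iff)
    finally have "y = compose {..<a} x s'" ..
    moreover have "r = amap R a a s' q"
      using R_compose[OF a a a permutations_hom[OF s] permutations_hom[OF s'(1)] r] R_id[OF a r] s'(3) eq(3)
      by simp
    moreover have "x \<in> injections a X" "q \<in> omap R a"
      using eq compose_permutation[OF y s] R_in[OF a a permutations_hom[OF s] r] by simp_all
    ultimately show "(t', t) \<in> san_rel K R X"
      unfolding t t' eq(1) san_rel_iff using a s'(1) by blast
  qed
  show "trans (san_rel K R X)"
  proof (rule transI)
    fix t t' t'' assume tt': "(t, t') \<in> san_rel K R X" "(t', t'') \<in> san_rel K R X"
    obtain a x r where t: "t = (a, x, r)" by (cases t)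
    obtain b y q where t': "t' = (b, y, q)" by (cases t')
    obtain c z p where t'': "t'' = (c, z, p)" by (cases t'')
    from tt'(1) obtain s where a: "a \<in> obj (surj_cat K)" and r: "r \<in> omap R a"
      and s: "s \<in> permutations a" and eq: "b = a" "x = compose {..<a} y s" "q = amap R a a s r"
      unfolding t t' san_rel_iff by blast
    from tt'(2) obtain s' where z: "z \<in> injections a X"
      and s': "s' \<in> permutations a" and eq': "c = a" "y = compose {..<a} z s'" "p = amap R a a s' q"
      unfolding t' t'' san_rel_iff eq(1) by blast
    have "compose {..<a} s' s \<in> permutations a"
      using s s' bij_betw_compose[of s "{..<a}" "{..<a}" s'] compose_PiE[of s "{..<a}" "{..<a}" s']
      by (simp add: permutations_iff)
    moreover have "x = compose {..<a} z (compose {..<a} s' s)"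
      unfolding eq(2) eq'(2) using s by (intro compose_assoc[symmetric]) (auto simp: permutations_iff)
    moreover have "p = amap R a a (compose {..<a} s' s) r"
      using R_compose[OF a a a permutations_hom[OF s] permutations_hom[OF s'] r] eq(3) eq'(3) by simp
    ultimately show "(t, t'') \<in> san_rel K R X"
      unfolding t t'' eq'(1) san_rel_iff using a z r by blast
  qed
qed

lemma san_class_eq_iff:
  assumes "(a, x, r) \<in> san_triples K R X" "(b, y, q) \<in> san_triples K R X"
  shows "san_class K R X a x r = san_class K R X b y q \<longleftrightarrow> ((a, x, r), (b, y, q)) \<in> san_rel K R X"
  unfolding san_class_def by (rule eq_equiv_class_iff[OF equiv_san_rel assms])

lemma san_class_eqI:
  "((a, x, r), (b, y, q)) \<in> san_rel K R X \<Longrightarrow> san_class K R X a x r = san_class K R X b y q"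
  unfolding san_class_def by (rule equiv_class_eq[OF equiv_san_rel])

lemma in_san_class_iff: "u \<in> san_class K R X a x r \<longleftrightarrow> ((a, x, r), u) \<in> san_rel K R X"
  by (simp add: san_class_def)

lemma san_class_self: "(a, x, r) \<in> san_triples K R X \<Longrightarrow> (a, x, r) \<in> san_class K R X a x r"
  unfolding san_class_def by (rule equiv_class_self[OF equiv_san_rel])

lemma omap_san_functor: "omap (san_functor K R) X = san_triples K R X // san_rel K R X"
  by (simp add: san_functor_def)

lemma san_class_in: "(a, x, r) \<in> san_triples K R X \<Longrightarrow> san_class K R X a x r \<in> omap (san_functor K R) X"
  unfolding omap_san_functor san_class_def by (rule quotientI)

lemma san_classE:
  assumes "u \<in> omap (san_functor K R) X"
  obtains a x r where "(a, x, r) \<in> san_triples K R X" "u = san_class K R X a x r"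
proof -
  obtain t where "t \<in> san_triples K R X" "u = san_rel K R X `` {t}"
    using assms unfolding omap_san_functor by (auto elim: quotientE)
  then show ?thesis using that by (cases t) (auto simp: san_class_def)
qed

text \<open>The value does not depend on the representative, nor on the factorization: two factorizations
  of the same map differ by a permutation, since their injective parts have the same image.\<close>

lemma amap_san_class:
  assumes t: "(a, x, r) \<in> san_triples K R X"
    and b: "b \<in> obj (surj_cat K)" and y: "y \<in> injections b Y" and s: "s \<in> hom (surj_cat K) a b"
    and fx: "compose {..<a} f x = compose {..<a} y s"
  shows "amap (san_functor K R) X Y f (san_class K R X a x r) = san_class K R Y b y (amap R a b s r)"
proof -
  have a: "a \<in> obj (surj_cat K)" and x: "x \<in> injections a X" and r: "r \<in> omap R a"
    using t by (simp_all only: san_triples_iff)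
  let ?u = "san_class K R X a x r"
  let ?P = "\<lambda>v. \<exists>a x r b y s. (a, x, r) \<in> ?u \<and> b \<in> obj (surj_cat K) \<and> y \<in> injections b Y \<and>
      s \<in> hom (surj_cat K) a b \<and> compose {..<a} f x = compose {..<a} y s \<and>
      v = san_class K R Y b y (amap R a b s r)"
  have "amap (san_functor K R) X Y f ?u = (THE v. ?P v)"
    using san_class_in[OF t] unfolding san_functor_def omap_san_functor
    by (simp only: fctr.select_convs restrict_apply')
  also have "\<dots> = san_class K R Y b y (amap R a b s r)"
  proof (rule the_equality)
    show "?P (san_class K R Y b y (amap R a b s r))"
      using san_class_self[OF t] b y s fx by blast
  next
    fix v assume "?P v"
    then obtain a' x' r' b' y' s' where t': "(a', x', r') \<in> ?u" and b': "b' \<in> obj (surj_cat K)"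
      and y': "y' \<in> injections b' Y" and s': "s' \<in> hom (surj_cat K) a' b'"
      and fx': "compose {..<a'} f x' = compose {..<a'} y' s'"
      and v: "v = san_class K R Y b' y' (amap R a' b' s' r')"
      by blast
    from t' obtain p where [simp]: "a' = a" and p: "p \<in> permutations a" "x = compose {..<a} x' p" "r' = amap R a a p r"
      unfolding in_san_class_iff san_rel_iff by blast
    have p_im: "p ` {..<a} = {..<a}" using p(1) by (simp add: permutations_iff bij_betw_def)
    have s_im: "s ` {..<a} = {..<b}" "s' ` {..<a} = {..<b'}" using s s' by simp_all
    have ys: "y (s i) = y' (s' (p i))" if "i < a" for i
    proof -
      have pi: "p i < a" using p_im that by blast
      have "y (s i) = f (x i)" using fx that by (simp add: compose_eq_iff)
      also have "\<dots> = f (x' (p i))" using p(2) that by (simp add: compose_eq)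
      also have "\<dots> = y' (s' (p i))" using fx' pi by (simp add: compose_eq_iff)
      finally show ?thesis .
    qed
    have "y ` {..<b} = (\<lambda>i. y (s i)) ` {..<a}" using s_im by (metis image_image)
    also have "\<dots> = (\<lambda>i. y' (s' (p i))) ` {..<a}" using ys by (intro image_cong) auto
    also have "\<dots> = y' ` (s' ` (p ` {..<a}))" by (simp add: image_image)
    also have "\<dots> = y' ` {..<b'}" using p_im s_im by simp
    finally have im: "y ` {..<b} = y' ` {..<b'}" .
    have cards: "is_cardinal b" "is_cardinal b'" using b b' by simp_all
    have [simp]: "b' = b" using injections_same_image(1)[OF cards y y' im] by simp
    obtain q where q: "q \<in> permutations b" "y = compose {..<b} y' q"
      using injections_same_image(2)[OF cards y y' im] by blast
    have q_in: "q j < b" if "j < b" for j using q(1) that by (auto simp: permutations_iff)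
    have "q (s i) = s' (p i)" if "i < a" for i
    proof -
      have pi: "p i < a" using p_im that by blast
      have "s i < b" "s' (p i) < b" using s_im that pi by auto
      moreover from this have "y' (q (s i)) = y' (s' (p i))" using ys[OF that] q(2) by (simp add: compose_eq)
      ultimately show ?thesis using y' q_in by (auto simp: injections_iff dest: inj_onD)
    qed
    then have qs: "compose {..<a} q s = compose {..<a} s' p" by (simp add: compose_eq_iff)
    have hs': "s' \<in> hom (surj_cat K) a b" using s' by simp
    have "amap R a b s' r' = amap R a b (compose {..<a} s' p) r"
      unfolding p(3) by (rule R_compose[OF a a b permutations_hom[OF p(1)] hs' r, symmetric])
    also have "\<dots> = amap R b b q (amap R a b s r)"
      unfolding qs[symmetric] by (rule R_compose[OF a b b s permutations_hom[OF q(1)] r])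
    finally have R_eq: "amap R a b s' r' = amap R b b q (amap R a b s r)" .
    have Rs: "amap R a b s r \<in> omap R b" using R_in[OF a b s r] .
    have y'b: "y' \<in> injections b Y" using y' by simp
    have "((b, y, amap R a b s r), (b, y', amap R a b s' r')) \<in> san_rel K R Y"
      unfolding san_rel_iff using b y'b Rs q R_eq by blast
    then show "v = san_class K R Y b y (amap R a b s r)" unfolding v by (simp add: san_class_eqI)
  qed
  finally show ?thesis .
qed

text \<open>Naturality at permutations makes the value independent of the representative.\<close>

lemma san_trans_class:
  assumes t: "(a, x, r) \<in> san_triples K R X"
    and R': "coefficients t K R'" and \<tau>: "is_nat_trans (surj_cat K) set_cat R R' \<tau>"
  shows "san_trans K R R' \<tau> X (san_class K R X a x r) = san_class K R' X a x (\<tau> a r)"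
proof -
  interpret R': coefficients t K R' by (rule R')
  have a: "a \<in> obj (surj_cat K)" and x: "x \<in> injections a X" and r: "r \<in> omap R a"
    using t by (simp_all only: san_triples_iff)
  let ?u = "san_class K R X a x r"
  have \<tau>r: "\<tau> a r' \<in> omap R' a" if "r' \<in> omap R a" for r'
  proof -
    have "\<tau> a \<in> hom set_cat (omap R a) (omap R' a)" using \<tau> a unfolding is_nat_trans_def by blast
    then show ?thesis using that by auto
  qed
  have "san_trans K R R' \<tau> X ?u = (THE v. \<exists>a x r. (a, x, r) \<in> ?u \<and> v = san_class K R' X a x (\<tau> a r))"
    using san_class_in[OF t] unfolding san_trans_def omap_san_functor by (simp only: restrict_apply')
  also have "\<dots> = san_class K R' X a x (\<tau> a r)"
  proof (rule the_equality)
    show "\<exists>a' x' r'. (a', x', r') \<in> ?u \<and> san_class K R' X a x (\<tau> a r) = san_class K R' X a' x' (\<tau> a' r')"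
      using san_class_self[OF t] by blast
  next
    fix v assume "\<exists>a x r. (a, x, r) \<in> ?u \<and> v = san_class K R' X a x (\<tau> a r)"
    then obtain a' x' r' where t': "(a', x', r') \<in> ?u" and v: "v = san_class K R' X a' x' (\<tau> a' r')" by blast
    from t' obtain p where [simp]: "a' = a" and x': "x' \<in> injections a X"
      and p: "p \<in> permutations a" "x = compose {..<a} x' p" "r' = amap R a a p r"
      unfolding in_san_class_iff san_rel_iff by blast
    have "cmp set_cat (omap R a) (omap R a) (omap R' a) (\<tau> a) (amap R a a p) =
        cmp set_cat (omap R a) (omap R' a) (omap R' a) (amap R' a a p) (\<tau> a)"
      using \<tau> a permutations_hom[OF p(1)] unfolding is_nat_trans_def by blast
    then have \<tau>r': "\<tau> a r' = amap R' a a p (\<tau> a r)" using p(3) r by (simp add: compose_eq_iff)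
    have "((a, x, \<tau> a r), (a, x', \<tau> a r')) \<in> san_rel K R' X"
      unfolding R'.san_rel_iff using a x' \<tau>r[OF r] p \<tau>r' by blast
    then show "v = san_class K R' X a x (\<tau> a r)" unfolding v by (simp add: R'.san_class_eqI)
  qed
  finally show ?thesis .
qed

end

section \<open>Semi-analytic functors have supports\<close>

locale presentation = coefficients t K R + endofunctor t F
  for t :: "'u::wellorder itself" and K R and F +
  fixes \<phi> :: "'u set \<Rightarrow> 'u \<Rightarrow> 'u triple set"
  assumes san_iso: "san_iso K F R \<phi>"
begin

lemma \<phi>_bij: "small X \<Longrightarrow> bij_betw (\<phi> X) (omap F X) (omap (san_functor K R) X)"
  using san_iso by (simp add: san_iso_def)

lemma \<phi>_inj: "\<lbrakk>small X; e \<in> omap F X; e' \<in> omap F X; \<phi> X e = \<phi> X e'\<rbrakk> \<Longrightarrow> e = e'"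
  using \<phi>_bij[of X] by (simp add: bij_betw_def inj_on_def)

lemma ex_triple:
  assumes "small X" "e \<in> omap F X"
  obtains a x r where "(a, x, r) \<in> san_triples K R X" "\<phi> X e = san_class K R X a x r"
proof -
  have "\<phi> X e \<in> omap (san_functor K R) X"
    using \<phi>_bij[OF assms(1)] assms(2) bij_betwE by blast
  then show ?thesis using that by (rule san_classE)
qed

lemma ex_element:
  assumes "small X" "(a, x, r) \<in> san_triples K R X"
  obtains e where "e \<in> omap F X" "\<phi> X e = san_class K R X a x r"
proof -
  have "san_class K R X a x r \<in> \<phi> X ` omap F X"
    using san_class_in[OF assms(2)] \<phi>_bij[OF assms(1)] by (simp add: bij_betw_def)
  then show ?thesis using that by (metis imageE)
qed

lemma \<phi>_amap:
  assumes "small X" "small Y" "f \<in> X \<rightarrow>\<^sub>E Y" "e \<in> omap F X"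
    and "(a, x, r) \<in> san_triples K R X" "\<phi> X e = san_class K R X a x r"
    and "b \<in> obj (surj_cat K)" "y \<in> injections b Y" "s \<in> hom (surj_cat K) a b"
    and "compose {..<a} f x = compose {..<a} y s"
  shows "\<phi> Y (amap F X Y f e) = san_class K R Y b y (amap R a b s r)"
  using san_iso assms(1-4) amap_san_class[OF assms(5,7-10)] assms(6) by (simp add: san_iso_def)

text \<open>The representatives of a class differ by permutations and have the same set of entries, so
  the union is the set of entries of any one of them.\<close>

definition entries :: "'u set \<Rightarrow> 'u \<Rightarrow> 'u set" where
  "entries X e = (\<Union>(a, x, r)\<in>\<phi> X e. x ` {..<a})"

lemma entries_eq:
  assumes t: "(a, x, r) \<in> san_triples K R X" and e: "\<phi> X e = san_class K R X a x r"
  shows "entries X e = x ` {..<a}"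
proof -
  have "x' ` {..<a'} = x ` {..<a}" if t': "(a', x', r') \<in> \<phi> X e" for a' x' r'
  proof -
    obtain s where "a' = a" "s \<in> permutations a" "x = compose {..<a} x' s"
      using t' unfolding e in_san_class_iff san_rel_iff by blast
    then show ?thesis using surj_compose[of s "{..<a}" "{..<a}" x'] by (simp add: permutations_iff bij_betw_def)
  qed
  moreover have "(a, x, r) \<in> \<phi> X e" unfolding e by (rule san_class_self[OF t])
  ultimately show ?thesis unfolding entries_def by fast
qed

lemma compose_identity_right: "x \<in> {..<a} \<rightarrow>\<^sub>E X \<Longrightarrow> compose {..<a} x (\<lambda>i\<in>{..<a}. i) = x"
  by (rule compose_Id) (auto simp: PiE_iff)

text \<open>Along an injective map the factorization is trivial, so only the injection changes.\<close>

lemma \<phi>_amap_inj: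
  assumes "small X" "small Y" "f \<in> X \<rightarrow>\<^sub>E Y" "inj_on f X" "e \<in> omap F X"
    and t: "(a, x, r) \<in> san_triples K R X" and "\<phi> X e = san_class K R X a x r"
  shows "(a, compose {..<a} f x, r) \<in> san_triples K R Y"
    "\<phi> Y (amap F X Y f e) = san_class K R Y a (compose {..<a} f x) r"
proof -
  have a: "a \<in> obj (surj_cat K)" and x: "x \<in> injections a X" and r: "r \<in> omap R a"
    using t by (simp_all only: san_triples_iff)
  have fx: "compose {..<a} f x \<in> injections a Y" by (rule compose_injection[OF x assms(3,4)])
  show "(a, compose {..<a} f x, r) \<in> san_triples K R Y"
    unfolding san_triples_iff using a fx r by blast
  have "compose {..<a} f x = compose {..<a} (compose {..<a} f x) (\<lambda>i\<in>{..<a}. i)"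
    using fx by (intro compose_identity_right[symmetric, of _ _ Y]) (simp add: injections_iff)
  then have "\<phi> Y (amap F X Y f e) = san_class K R Y a (compose {..<a} f x) (amap R a a (\<lambda>i\<in>{..<a}. i) r)"
    using permutations_hom[OF identity_permutation] by (intro \<phi>_amap[OF assms(1-3,5-7) a fx]) auto
  then show "\<phi> Y (amap F X Y f e) = san_class K R Y a (compose {..<a} f x) r"
    using R_id[OF a r] by simp
qed

lemma amap_inj_on:
  assumes s: "small X" "small Y" and f: "f \<in> X \<rightarrow>\<^sub>E Y" "inj_on f X"
  shows "inj_on (amap F X Y f) (omap F X)"
proof (rule inj_onI)
  fix e e' assume e: "e \<in> omap F X" "e' \<in> omap F X" "amap F X Y f e = amap F X Y f e'"
  obtain a x r where t: "(a, x, r) \<in> san_triples K R X" "\<phi> X e = san_class K R X a x r"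
    using ex_triple[OF s(1) e(1)] by blast
  obtain b y q where t': "(b, y, q) \<in> san_triples K R X" "\<phi> X e' = san_class K R X b y q"
    using ex_triple[OF s(1) e(2)] by blast
  note F = \<phi>_amap_inj[OF s f e(1) t] and F' = \<phi>_amap_inj[OF s f e(2) t']
  have "((a, compose {..<a} f x, r), (b, compose {..<b} f y, q)) \<in> san_rel K R Y"
    using san_class_eq_iff[OF F(1) F'(1)] F(2) F'(2) e(3) by simp
  then obtain p where [simp]: "b = a" and p: "p \<in> permutations a" "q = amap R a a p r"
    and eq: "compose {..<a} f x = compose {..<a} (compose {..<a} f y) p"
    unfolding san_rel_iff by blast
  have a: "a \<in> obj (surj_cat K)" and x: "x \<in> injections a X" and r: "r \<in> omap R a"
    using t(1) by (simp_all only: san_triples_iff)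
  have y: "y \<in> injections a X" using t'(1) by (simp add: san_triples_iff)
  have p_in: "p i < a" if "i < a" for i using p(1) that by (auto simp: permutations_iff)
  have "f (x i) = f (y (p i))" if "i < a" for i
    using eq that p_in[OF that] by (simp add: compose_eq_iff compose_eq)
  moreover have "x i \<in> X" "y (p i) \<in> X" if "i < a" for i
    using x y p_in[OF that] that by (auto simp: injections_iff)
  ultimately have "y (p i) = x i" if "i < a" for i
    using f(2) that by (metis inj_onD)
  then have "x = compose {..<a} y p"
    using x compose_eq_PiE_iff[of x "{..<a}" X y p] by (simp add: injections_iff)
  then have "((a, x, r), (b, y, q)) \<in> san_rel K R X"
    unfolding san_rel_iff \<open>b = a\<close> using a y r p by blast
  then have "\<phi> X e = \<phi> X e'" unfolding t(2) t'(2) by (rule san_class_eqI)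
  then show "e = e'" by (rule \<phi>_inj[OF s(1) e(1,2)])
qed

lemma carries_entries:
  assumes X: "small X" and e: "e \<in> omap F X"
  shows "carries F X (entries X e) e"
proof -
  obtain a x r where t: "(a, x, r) \<in> san_triples K R X" and \<phi>e: "\<phi> X e = san_class K R X a x r"
    using ex_triple[OF X e] by blast
  have a: "a \<in> obj (surj_cat K)" and x: "x \<in> injections a X" and r: "r \<in> omap R a"
    using t by (simp_all only: san_triples_iff)
  let ?U = "x ` {..<a}"
  have U: "?U \<subseteq> X" "small ?U" using x small_image[OF small_lessThan] by (auto simp: injections_iff)
  have xU: "x \<in> injections a ?U" using x by (auto simp: injections_iff PiE_iff)
  have tU: "(a, x, r) \<in> san_triples K R ?U" unfolding san_triples_iff using a xU r by blast
  obtain e' where e': "e' \<in> omap F ?U" "\<phi> ?U e' = san_class K R ?U a x r"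
    using ex_element[OF U(2) tU] by blast
  have incl: "(\<lambda>u\<in>?U. u) \<in> ?U \<rightarrow>\<^sub>E X" "inj_on (\<lambda>u\<in>?U. u) ?U" using U by (auto simp: inj_on_def)
  have "compose {..<a} (\<lambda>u\<in>?U. u) x = x"
    using x by (subst compose_eq_PiE_iff[of x "{..<a}" X]) (simp_all add: injections_iff)
  then have "\<phi> X (amap F ?U X (\<lambda>u\<in>?U. u) e') = \<phi> X e"
    using \<phi>_amap_inj(2)[OF U(2) X incl e'(1) tU e'(2)] \<phi>e by simp
  then have "amap F ?U X (\<lambda>u\<in>?U. u) e' = e"
    by (rule \<phi>_inj[OF X amap_in[OF U(2) X incl(1) e'(1)] e])
  then show ?thesis
    unfolding carries_def entries_eq[OF t \<phi>e] using U(1) e'(1) by blast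
qed

lemma entries_amap:
  assumes s: "small X" "small Y" and f: "f \<in> X \<rightarrow>\<^sub>E Y" and e: "e \<in> omap F X"
  shows "entries Y (amap F X Y f e) = f ` entries X e"
proof -
  obtain a x r where t: "(a, x, r) \<in> san_triples K R X" and \<phi>e: "\<phi> X e = san_class K R X a x r"
    using ex_triple[OF s(1) e] by blast
  have a: "a \<in> obj (surj_cat K)" and x: "x \<in> injections a X" and r: "r \<in> omap R a"
    using t by (simp_all only: san_triples_iff)
  have "compose {..<a} f x \<in> {..<a} \<rightarrow>\<^sub>E Y"
    using x f by (intro compose_PiE[of x _ X]) (simp_all add: injections_iff)
  moreover have "is_cardinal a" using a by simp
  ultimately obtain b y p where b: "b \<le> a" "is_cardinal b" and y: "y \<in> injections b Y"
    and p: "p \<in> hom (surj_cat K) a b" and eq: "compose {..<a} f x = compose {..<a} y p"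
    using ex_surj_inj_factorization[where K = K] by meson
  have b': "b \<in> obj (surj_cat K)" using a b downward[of a b] by simp
  have "\<phi> Y (amap F X Y f e) = san_class K R Y b y (amap R a b p r)"
    by (rule \<phi>_amap[OF s f e t \<phi>e b' y p eq])
  moreover have "(b, y, amap R a b p r) \<in> san_triples K R Y"
    unfolding san_triples_iff using b' y R_in[OF a b' p r] by blast
  ultimately have "entries Y (amap F X Y f e) = y ` {..<b}" by (intro entries_eq)
  also have "\<dots> = y ` (p ` {..<a})" using p by simp
  also have "\<dots> = compose {..<a} y p ` {..<a}" by (auto simp: compose_eq image_image)
  also have "\<dots> = f ` x ` {..<a}" unfolding eq[symmetric] by (auto simp: compose_eq image_image)
  also have "x ` {..<a} = entries X e" by (rule entries_eq[OF t \<phi>e, symmetric])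
  finally show ?thesis .
qed

lemma supported: "supported_functor t F"
  by (rule supported_functorI(1)[where S = entries])
    (assumption | rule amap_inj_on carries_entries entries_amap)+

lemma supp_eq_entries: "small X \<Longrightarrow> e \<in> omap F X \<Longrightarrow> supp F X e = entries X e"
  by (rule supported_functorI(2)) (assumption | rule amap_inj_on carries_entries entries_amap)+

lemma supp_eq:
  assumes "small X" "e \<in> omap F X" "(a, x, r) \<in> san_triples K R X" "\<phi> X e = san_class K R X a x r"
  shows "supp F X e = x ` {..<a}"
  using supp_eq_entries[OF assms(1,2)] entries_eq[OF assms(3,4)] by simp

lemma cardinal_of_supp:
  assumes "small X" "e \<in> omap F X"
  shows "cardinal_of (supp F X e) \<in> K"
proof -
  obtain a x r where t: "(a, x, r) \<in> san_triples K R X" "\<phi> X e = san_class K R X a x r"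
    using ex_triple[OF assms] by blast
  then have "a \<in> K" "is_cardinal a" "inj_on x {..<a}" by (simp_all add: san_triples_iff injections_iff)
  then show ?thesis using supp_eq[OF assms t] cardinal_of_inj_image by simp
qed

end

section \<open>Functors with supports are semi-analytic\<close>

text \<open>For a supported \<open>F\<close> these are the elements of \<open>F {..<a}\<close> that come from no proper subset. They serve as coefficients because
  every element of \<open>F X\<close> is \<open>F x r\<close> for an enumeration \<open>x\<close> of its support and a generic \<open>r\<close>.\<close>

definition generic :: "'u::wellorder endo \<Rightarrow> 'u \<Rightarrow> 'u set" where
  "generic F a = {r \<in> omap F {..<a}. supp F {..<a} r = {..<a}}"

definition generic_coeffs :: "'u::wellorder endo \<Rightarrow> 'u coeffs" where
  "generic_coeffs F = \<lparr>omap = generic F, amap = (\<lambda>a b s. restrict (amap F {..<a} {..<b} s) (generic F a))\<rparr>"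

text \<open>The fibres of the evaluation \<open>(a, x, r) \<mapsto> F x r\<close> on triples with generic \<open>r\<close>. They turn out to
  be the classes that form the values of the semi-analytic functor.\<close>

definition generic_presentation :: "'u::wellorder set \<Rightarrow> 'u endo \<Rightarrow> 'u set \<Rightarrow> 'u \<Rightarrow> 'u triple set" where
  "generic_presentation K F X e =
     {(a, x, r) \<in> san_triples K (generic_coeffs F) X. amap F {..<a} X x r = e}"

locale bounded_supports = supported_functor t F for t :: "'u::wellorder itself" and F +
  fixes K :: "'u set"
  assumes K_downward: "\<And>a b. b \<in> K \<Longrightarrow> a \<le> b \<Longrightarrow> a \<in> K"
    and cardinal_supp: "\<And>X e. small X \<Longrightarrow> e \<in> omap F X \<Longrightarrow> cardinal_of (supp F X e) \<in> K"
begin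

lemma generic_amap:
  assumes "s \<in> {..<a} \<rightarrow>\<^sub>E {..<b}" "s ` {..<a} = {..<b}" "r \<in> generic F a"
  shows "amap F {..<a} {..<b} s r \<in> generic F b"
  using assms amap_in[OF small_lessThan small_lessThan assms(1)]
    supp_amap[OF small_lessThan small_lessThan assms(1)] by (simp add: generic_def)

lemma is_functor_generic_coeffs: "is_functor (surj_cat K) set_cat (generic_coeffs F)"
  unfolding is_functor_def
proof (intro conjI ballI)
  fix a assume "a \<in> obj (surj_cat K)"
  have "generic F a \<subseteq> omap F {..<a}" by (auto simp: generic_def)
  then show "omap (generic_coeffs F) a \<in> obj set_cat"
    using small_subset[OF small_omap[OF small_lessThan]] by (simp add: generic_coeffs_def)
  show "amap (generic_coeffs F) a a (ident (surj_cat K) a) = ident set_cat (omap (generic_coeffs F) a)"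
    using amap_id[OF small_lessThan] by (simp add: generic_coeffs_def generic_def restrict_def fun_eq_iff)
  fix b s assume "b \<in> obj (surj_cat K)" and s: "s \<in> hom (surj_cat K) a b"
  show "amap (generic_coeffs F) a b s \<in>
      hom set_cat (omap (generic_coeffs F) a) (omap (generic_coeffs F) b)"
    using s generic_amap by (auto simp: generic_coeffs_def)
  fix c s' assume "c \<in> obj (surj_cat K)" and s': "s' \<in> hom (surj_cat K) b c"
  show "amap (generic_coeffs F) a c (cmp (surj_cat K) a b c s' s) =
      cmp set_cat (omap (generic_coeffs F) a) (omap (generic_coeffs F) b) (omap (generic_coeffs F) c)
        (amap (generic_coeffs F) b c s') (amap (generic_coeffs F) a b s)"
  proof (rule ext)
    fix r
    show "amap (generic_coeffs F) a c (cmp (surj_cat K) a b c s' s) r =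
      cmp set_cat (omap (generic_coeffs F) a) (omap (generic_coeffs F) b) (omap (generic_coeffs F) c)
        (amap (generic_coeffs F) b c s') (amap (generic_coeffs F) a b s) r"
      using s s' generic_amap amap_compose[OF small_lessThan small_lessThan small_lessThan, of s a b s' c r]
      by (simp add: generic_coeffs_def compose_def generic_def)
  qed
qed

sublocale generic: coefficients t K "generic_coeffs F"
  by unfold_locales (use K_downward is_functor_generic_coeffs in blast)+

lemma generic_triplesD:
  assumes "(a, x, r) \<in> san_triples K (generic_coeffs F) X"
  shows "a \<in> obj (surj_cat K)" "is_cardinal a" "x \<in> {..<a} \<rightarrow>\<^sub>E X" "inj_on x {..<a}" "x \<in> injections a X"
    "r \<in> omap F {..<a}" "supp F {..<a} r = {..<a}" "r \<in> generic F a"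
  using assms by (simp_all add: san_triples_def injections_iff generic_coeffs_def generic_def)

lemma generic_triple_amap:
  assumes "small X" "(a, x, r) \<in> san_triples K (generic_coeffs F) X"
  shows "amap F {..<a} X x r \<in> omap F X" "supp F X (amap F {..<a} X x r) = x ` {..<a}"
  using generic_triplesD[OF assms(2)] amap_in[OF small_lessThan assms(1)] supp_amap[OF small_lessThan assms(1)]
  by simp_all

lemma ex_generic_triple:
  assumes X: "small X" and e: "e \<in> omap F X"
  shows "\<exists>a x r. (a, x, r) \<in> san_triples K (generic_coeffs F) X \<and> amap F {..<a} X x r = e"
proof -
  let ?S = "supp F X e"
  have S: "small ?S" "?S \<subseteq> X" using supp_subset[OF X e] small_subset[OF X] by auto
  let ?a = "cardinal_of ?S"
  obtain x where x: "x \<in> injections ?a X" "x ` {..<?a} = ?S"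
    using ex_enumeration[OF S] by blast
  then have x': "x \<in> {..<?a} \<rightarrow>\<^sub>E X" "inj_on x {..<?a}" by (simp_all add: injections_iff)
  have "e \<in> amap F {..<?a} X x ` omap F {..<?a}"
    unfolding in_amap_image_iff[OF small_lessThan X x' e] x(2) by simp
  then obtain r where r: "e = amap F {..<?a} X x r" "r \<in> omap F {..<?a}" by (rule imageE)
  have supp_r: "supp F {..<?a} r \<subseteq> {..<?a}" by (rule supp_subset[OF small_lessThan r(2)])
  have "x ` supp F {..<?a} r = supp F X (amap F {..<?a} X x r)"
    by (rule supp_amap[OF small_lessThan X x'(1) r(2), symmetric])
  also have "\<dots> = x ` {..<?a}" by (simp only: r(1)[symmetric] x(2))
  finally have "supp F {..<?a} r = {..<?a}"
    using inj_on_image_eq_iff[OF x'(2) supp_r subset_refl] by simp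
  then have t: "(?a, x, r) \<in> san_triples K (generic_coeffs F) X"
    using r(2) x(1) is_cardinal_cardinal_of[OF S(1)] cardinal_supp[OF X e]
    by (simp add: san_triples_def generic_coeffs_def generic_def)
  show ?thesis by (intro exI conjI, rule t, rule r(1)[symmetric])
qed

text \<open>Two generic presentations of an element have the same entries, namely its support, so they
  differ by a permutation.\<close>

lemma generic_san_rel_iff:
  assumes X: "small X" and t: "(a, x, r) \<in> san_triples K (generic_coeffs F) X"
    and t': "(b, y, q) \<in> san_triples K (generic_coeffs F) X"
  shows "((a, x, r), (b, y, q)) \<in> san_rel K (generic_coeffs F) X \<longleftrightarrow>
    amap F {..<a} X x r = amap F {..<b} X y q"
proof
  note x = generic_triplesD[OF t] and y = generic_triplesD[OF t']
  assume "((a, x, r), (b, y, q)) \<in> san_rel K (generic_coeffs F) X"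
  then obtain s where ba: "b = a" and s: "s \<in> permutations a" "x = compose {..<a} y s"
    and q: "q = amap (generic_coeffs F) a a s r"
    unfolding generic.san_rel_iff by blast
  have "q = amap F {..<a} {..<a} s r" using q x(8) by (simp add: generic_coeffs_def)
  moreover have "s \<in> {..<a} \<rightarrow>\<^sub>E {..<a}" using s(1) by (simp add: permutations_iff)
  ultimately show "amap F {..<a} X x r = amap F {..<b} X y q"
    using amap_compose[OF small_lessThan small_lessThan X _ _ x(6), of s a y] y(3) s(2) ba by simp
next
  note x = generic_triplesD[OF t] and y = generic_triplesD[OF t']
  assume eq: "amap F {..<a} X x r = amap F {..<b} X y q"
  have im: "x ` {..<a} = y ` {..<b}"
    using generic_triple_amap(2)[OF X t] generic_triple_amap(2)[OF X t'] eq by simp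
  have ab: "a = b" by (rule injections_same_image(1)[OF x(2) y(2) x(5) y(5) im])
  obtain s where s: "s \<in> permutations a" "x = compose {..<a} y s"
    using injections_same_image(2)[OF x(2) y(2) x(5) y(5) im] by blast
  have s': "s \<in> {..<a} \<rightarrow>\<^sub>E {..<a}" using s(1) by (simp add: permutations_iff)
  have y': "y \<in> {..<a} \<rightarrow>\<^sub>E X" "inj_on y {..<a}" "q \<in> omap F {..<a}" using y ab by simp_all
  have "amap F {..<a} X y (amap F {..<a} {..<a} s r) = amap F {..<a} X y q"
    using amap_compose[OF small_lessThan small_lessThan X s' y'(1) x(6)] s(2) eq ab by simp
  then have "amap F {..<a} {..<a} s r = q"
    using inj_onD[OF amap_inj[OF small_lessThan X y'(1,2)]] amap_in[OF small_lessThan small_lessThan s' x(6)] y'(3)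
    by blast
  then have "q = amap (generic_coeffs F) a a s r" using x(8) by (simp add: generic_coeffs_def)
  moreover have "y \<in> injections a X" "r \<in> omap (generic_coeffs F) a"
    using y(5) ab x(8) by (simp_all add: generic_coeffs_def)
  ultimately show "((a, x, r), (b, y, q)) \<in> san_rel K (generic_coeffs F) X"
    unfolding generic.san_rel_iff using ab x(1) s by blast
qed

lemma generic_presentation_class:
  assumes X: "small X" and t: "(a, x, r) \<in> san_triples K (generic_coeffs F) X"
  shows "generic_presentation K F X (amap F {..<a} X x r) = san_class K (generic_coeffs F) X a x r"
proof (rule set_eqI)
  fix w :: "'u triple"
  obtain b y q where w: "w = (b, y, q)" by (cases w)
  have "w \<in> san_class K (generic_coeffs F) X a x r \<longleftrightarrow>
      w \<in> san_triples K (generic_coeffs F) X \<and> ((a, x, r), w) \<in> san_rel K (generic_coeffs F) X"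
    unfolding generic.in_san_class_iff using equiv_type[OF generic.equiv_san_rel] by blast
  also have "\<dots> \<longleftrightarrow> w \<in> generic_presentation K F X (amap F {..<a} X x r)"
    unfolding w generic_presentation_def using generic_san_rel_iff[OF X t] by auto
  finally show "w \<in> generic_presentation K F X (amap F {..<a} X x r) \<longleftrightarrow>
      w \<in> san_class K (generic_coeffs F) X a x r" ..
qed

lemma san_iso_generic: "san_iso K F (generic_coeffs F) (generic_presentation K F)"
  unfolding san_iso_def
proof (intro conjI ballI)
  fix X :: "'u set" assume "X \<in> obj set_cat"
  then have X: "small X" by simp
  show "bij_betw (generic_presentation K F X) (omap F X) (omap (san_functor K (generic_coeffs F)) X)"
  proof (rule bij_betw_imageI)
    show "inj_on (generic_presentation K F X) (omap F X)"
    proof (rule inj_onI)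
      fix e e' assume e: "e \<in> omap F X" "e' \<in> omap F X"
        and eq: "generic_presentation K F X e = generic_presentation K F X e'"
      obtain a x r where "(a, x, r) \<in> generic_presentation K F X e"
        using ex_generic_triple[OF X e(1)] by (auto simp: generic_presentation_def)
      moreover from this have "(a, x, r) \<in> generic_presentation K F X e'" unfolding eq .
      ultimately show "e = e'" by (auto simp: generic_presentation_def)
    qed
    show "generic_presentation K F X ` omap F X = omap (san_functor K (generic_coeffs F)) X"
    proof
      show "generic_presentation K F X ` omap F X \<subseteq> omap (san_functor K (generic_coeffs F)) X"
      proof
        fix u assume "u \<in> generic_presentation K F X ` omap F X"
        then obtain e where e: "e \<in> omap F X" "u = generic_presentation K F X e" by blast
        obtain a x r where t: "(a, x, r) \<in> san_triples K (generic_coeffs F) X" "amap F {..<a} X x r = e"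
          using ex_generic_triple[OF X e(1)] by blast
        show "u \<in> omap (san_functor K (generic_coeffs F)) X"
          using generic_presentation_class[OF X t(1)] generic.san_class_in[OF t(1)] t(2) e(2) by simp
      qed
      show "omap (san_functor K (generic_coeffs F)) X \<subseteq> generic_presentation K F X ` omap F X"
      proof
        fix u assume "u \<in> omap (san_functor K (generic_coeffs F)) X"
        then obtain a x r where t: "(a, x, r) \<in> san_triples K (generic_coeffs F) X"
          "u = san_class K (generic_coeffs F) X a x r"
          by (rule generic.san_classE)
        show "u \<in> generic_presentation K F X ` omap F X"
          unfolding t(2) generic_presentation_class[OF X t(1), symmetric]
          by (rule imageI[OF generic_triple_amap(1)[OF X t(1)]])
      qed
    qed
  qed
  fix Y :: "'u set" and f e assume "Y \<in> obj set_cat" and "f \<in> hom set_cat X Y" and e: "e \<in> omap F X"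
  then have Y: "small Y" and f: "f \<in> X \<rightarrow>\<^sub>E Y" by simp_all
  obtain a x r where t: "(a, x, r) \<in> san_triples K (generic_coeffs F) X" and xr: "amap F {..<a} X x r = e"
    using ex_generic_triple[OF X e] by blast
  note x = generic_triplesD[OF t]
  have fx: "compose {..<a} f x \<in> {..<a} \<rightarrow>\<^sub>E Y" by (rule compose_PiE[OF x(3) f])
  obtain b y s where b: "b \<le> a" "is_cardinal b" and y: "y \<in> injections b Y"
    and s: "s \<in> hom (surj_cat K) a b" and eq: "compose {..<a} f x = compose {..<a} y s"
    using ex_surj_inj_factorization[OF x(2) fx, where K = K] by meson
  have b': "b \<in> obj (surj_cat K)" using x(1) b K_downward[of a b] by simp
  let ?q = "amap F {..<a} {..<b} s r"
  have q: "?q \<in> generic F b" using s x(8) by (intro generic_amap) auto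
  have q_eq: "amap (generic_coeffs F) a b s r = ?q" using x(8) by (simp add: generic_coeffs_def)
  have t': "(b, y, ?q) \<in> san_triples K (generic_coeffs F) Y"
    using b' y q by (simp add: san_triples_def generic_coeffs_def)
  have s': "s \<in> {..<a} \<rightarrow>\<^sub>E {..<b}" and y': "y \<in> {..<b} \<rightarrow>\<^sub>E Y" using s y by (simp_all add: injections_iff)
  have "amap F X Y f e = amap F {..<a} Y (compose {..<a} f x) r"
    unfolding xr[symmetric] by (rule amap_compose[OF small_lessThan X Y x(3) f x(6), symmetric])
  also have "\<dots> = amap F {..<b} Y y ?q"
    unfolding eq by (rule amap_compose[OF small_lessThan small_lessThan Y s' y' x(6)])
  finally have "generic_presentation K F Y (amap F X Y f e) = san_class K (generic_coeffs F) Y b y ?q"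
    using generic_presentation_class[OF Y t'] by simp
  also have "\<dots> = amap (san_functor K (generic_coeffs F)) X Y f (san_class K (generic_coeffs F) X a x r)"
    using generic.amap_san_class[OF t b' y s eq] q_eq by simp
  also have "san_class K (generic_coeffs F) X a x r = generic_presentation K F X e"
    using generic_presentation_class[OF X t] xr by simp
  finally show "generic_presentation K F Y (amap F X Y f e) =
      amap (san_functor K (generic_coeffs F)) X Y f (generic_presentation K F X e)" .
qed

end

section \<open>Characterization of the objects\<close>

text \<open>The cases \<open>{..<k}\<close> and \<open>UNIV\<close> of \<open>K\<close> give the characterizations of the objects.\<close>

lemma (in endofunctor) in_san_obj_iff:
  assumes K: "\<And>a b :: 'u. b \<in> K \<Longrightarrow> a \<le> b \<Longrightarrow> a \<in> K"
  shows "F \<in> san_obj K \<longleftrightarrow> supported_functor t F \<and>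
    (\<forall>X. small X \<longrightarrow> (\<forall>e\<in>omap F X. cardinal_of (supp F X e) \<in> K))"
proof
  assume "F \<in> san_obj K"
  then obtain R \<phi> where "is_functor (surj_cat K) set_cat R" "san_iso K F R \<phi>"
    by (auto simp: san_obj_def fun_cat_def)
  then interpret presentation t K R F \<phi>
    using K by unfold_locales
  show "supported_functor t F \<and> (\<forall>X. small X \<longrightarrow> (\<forall>e\<in>omap F X. cardinal_of (supp F X e) \<in> K))"
    using supported cardinal_of_supp by blast
next
  assume R: "supported_functor t F \<and> (\<forall>X. small X \<longrightarrow> (\<forall>e\<in>omap F X. cardinal_of (supp F X e) \<in> K))"
  then interpret supported_functor t F by blast
  interpret bounded_supports t F K using R K by unfold_locales blast+
  show "F \<in> san_obj K"
    using is_functor is_functor_generic_coeffs san_iso_generic by (auto simp: san_obj_def fun_cat_def)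
qed

lemma lessThan_downward: "b \<in> {..<k} \<Longrightarrow> a \<le> b \<Longrightarrow> a \<in> {..<k :: 'u::wellorder}"
  by simp

lemma (in endofunctor) in_San_iff_supp:
  "F \<in> obj (San (k :: 'u)) \<longleftrightarrow> supported_functor t F \<and>
    (\<forall>X. small X \<longrightarrow> (\<forall>e\<in>omap F X. cardinal_of (supp F X e) < k))"
proof -
  have "F \<in> san_obj {..<k} \<longleftrightarrow> supported_functor t F \<and>
      (\<forall>X. small X \<longrightarrow> (\<forall>e\<in>omap F X. cardinal_of (supp F X e) \<in> {..<k}))"
    by (rule in_san_obj_iff) (rule lessThan_downward)
  then show ?thesis by (simp add: San_def)
qed

lemma (in endofunctor) in_San_iff:
  assumes k: "regular_cardinal (k :: 'u)"
  shows "F \<in> obj (San k) \<longleftrightarrow> accessible k F \<and> preserves_pullbacks_along_monos F \<and>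
    preserves_wide_pullbacks_of_monos F"
proof -
  have "F \<in> obj (San k) \<longleftrightarrow> supported_functor t F \<and>
      (\<forall>X. small X \<longrightarrow> (\<forall>e\<in>omap F X. cardinal_of (supp F X e) < k))"
    by (rule in_San_iff_supp)
  also have "\<dots> \<longleftrightarrow> supported_functor t F \<and> accessible k F"
  proof (rule conj_cong[OF refl])
    assume "supported_functor t F"
    then interpret supported_functor t F .
    have "cardinal_of (supp F X e) < k \<longleftrightarrow> |supp F X e| <o |{..<k}|" if "small X" "e \<in> omap F X" for X e
      using cardinal_of_lessThan_iff[OF small_subset[OF that(1) supp_subset[OF that]]] k
      by (simp add: regular_cardinal_def)
    then show "(\<forall>X. small X \<longrightarrow> (\<forall>e\<in>omap F X. cardinal_of (supp F X e) < k)) \<longleftrightarrow> accessible k F"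
      unfolding accessible_iff[OF k] by simp
  qed
  finally show ?thesis unfolding supported_functor_iff_preserves by blast
qed

lemma (in endofunctor) in_SAN_iff:
  "F \<in> obj SAN \<longleftrightarrow> preserves_pullbacks_along_monos F \<and> preserves_wide_pullbacks_of_monos F"
  using in_san_obj_iff[of UNIV] supported_functor_iff_preserves by (simp add: SAN_def)

section \<open>Characterization of the morphisms\<close>

lemma nat_trans_set_catD:
  assumes "is_nat_trans set_cat set_cat F G \<eta>"
  shows "small X \<Longrightarrow> \<eta> X \<in> omap F X \<rightarrow>\<^sub>E omap G X"
    and "\<lbrakk>small X; small Y; f \<in> X \<rightarrow>\<^sub>E Y; e \<in> omap F X\<rbrakk> \<Longrightarrow> \<eta> Y (amap F X Y f e) = amap G X Y f (\<eta> X e)"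
  using assms by (simp_all add: is_nat_trans_def compose_eq_iff)

text \<open>The square at an injection \<open>f\<close> is a pullback iff an element \<open>e\<close> comes from \<open>X\<close> exactly when its
  image under \<open>\<eta>\<close> does, that is, iff the image of \<open>f\<close> contains both supports or neither. Applied to the
  inclusions of the two supports this gives their equality.\<close>

lemma semi_cartesian_iff:
  assumes F: "supported_functor t F" and G: "supported_functor (t :: 'u::wellorder itself) G"
    and \<eta>: "is_nat_trans set_cat set_cat F G \<eta>"
  shows "semi_cartesian F G \<eta> \<longleftrightarrow> (\<forall>X. small X \<longrightarrow> (\<forall>e\<in>omap F X. supp G X (\<eta> X e) = supp F X e))"
proof -
  interpret F: supported_functor t F by (rule F)
  interpret G: supported_functor t G by (rule G)
  note \<eta>_PiE = nat_trans_set_catD(1)[OF \<eta>] and natural = nat_trans_set_catD(2)[OF \<eta>]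
  have \<eta>_in: "\<eta> X e \<in> omap G X" if "small X" "e \<in> omap F X" for X e
    using PiE_mem[OF \<eta>_PiE] that by blast
  have square: "is_pullback set_cat (omap F X) (omap F Y) (omap G X) (omap G Y)
        (amap F X Y f) (\<eta> X) (\<eta> Y) (amap G X Y f) \<longleftrightarrow>
      (\<forall>e\<in>omap F Y. supp F Y e \<subseteq> f ` X \<longleftrightarrow> supp G Y (\<eta> Y e) \<subseteq> f ` X)"
    if s: "small X" "small Y" and f: "f \<in> X \<rightarrow>\<^sub>E Y" and f_inj: "inj_on f X" for X Y f
  proof -
    have "is_pullback set_cat (omap F X) (omap F Y) (omap G X) (omap G Y)
        (amap F X Y f) (\<eta> X) (\<eta> Y) (amap G X Y f) \<longleftrightarrow>
      amap F X Y f ` omap F X = {e\<in>omap F Y. \<eta> Y e \<in> amap G X Y f ` omap G X}"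
      using natural[OF s f] F.amap_inj[OF s f f_inj]
      by (subst F.is_pullback_along_inj_iff[OF F.small_omap[OF s(1)] F.small_omap[OF s(2)]
          G.small_omap[OF s(1)] G.small_omap[OF s(2)] F.amap_PiE[OF s f] \<eta>_PiE[OF s(1)]
          \<eta>_PiE[OF s(2)] G.amap_PiE[OF s f] G.amap_inj[OF s f f_inj]]) blast
    also have "\<dots> \<longleftrightarrow> (\<forall>e\<in>omap F Y. e \<in> amap F X Y f ` omap F X \<longleftrightarrow> \<eta> Y e \<in> amap G X Y f ` omap G X)"
      using F.amap_in[OF s f] by blast
    also have "\<dots> \<longleftrightarrow> (\<forall>e\<in>omap F Y. supp F Y e \<subseteq> f ` X \<longleftrightarrow> supp G Y (\<eta> Y e) \<subseteq> f ` X)"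
      using F.in_amap_image_iff[OF s f f_inj] G.in_amap_image_iff[OF s f f_inj \<eta>_in[OF s(2)]]
      by simp
    finally show ?thesis .
  qed
  show ?thesis
  proof
    assume sc: "semi_cartesian F G \<eta>"
    show "\<forall>X. small X \<longrightarrow> (\<forall>e\<in>omap F X. supp G X (\<eta> X e) = supp F X e)"
    proof (intro allI impI ballI)
      fix X e assume X: "small X" and e: "e \<in> omap F X"
      have subset_iff: "supp F X e \<subseteq> U \<longleftrightarrow> supp G X (\<eta> X e) \<subseteq> U" if U: "U \<subseteq> X" for U
      proof -
        have "is_pullback set_cat (omap F U) (omap F X) (omap G U) (omap G X)
            (amap F U X (\<lambda>u\<in>U. u)) (\<eta> U) (\<eta> X) (amap G U X (\<lambda>u\<in>U. u))"
          using sc X small_subset[OF X U] inclusion_PiE[OF U] by (simp add: semi_cartesian_def inj_on_def)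
        then show ?thesis
          using square[OF small_subset[OF X U] X inclusion_PiE[OF U]] e by (simp add: inj_on_def)
      qed
      show "supp G X (\<eta> X e) = supp F X e"
        using subset_iff[OF F.supp_subset[OF X e]] subset_iff[OF G.supp_subset[OF X \<eta>_in[OF X e]]] by blast
    qed
  next
    assume "\<forall>X. small X \<longrightarrow> (\<forall>e\<in>omap F X. supp G X (\<eta> X e) = supp F X e)"
    then show "semi_cartesian F G \<eta>" unfolding semi_cartesian_def using square by simp
  qed
qed

text \<open>A transformation induced by coefficients keeps the injection of a representative, hence the
  support. Conversely, a transformation that preserves supports maps generic elements to generic
  elements, and its restriction to these induces it.\<close>

lemma san_hom_iff:
  assumes K: "\<And>a b :: 'u::wellorder. b \<in> K \<Longrightarrow> a \<le> b \<Longrightarrow> a \<in> K"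
    and univ: "universe (t :: 'u itself)" and F: "F \<in> san_obj K" and G: "G \<in> san_obj K"
  shows "\<eta> \<in> san_hom K F G \<longleftrightarrow> is_nat_trans set_cat set_cat F G \<eta> \<and> semi_cartesian F G \<eta>"
proof -
  interpret universe t by (rule univ)
  have "endofunctor t F" "endofunctor t G"
    using F G univ by (simp_all add: san_obj_def fun_cat_def endofunctor_def endofunctor_axioms_def)
  then have "bounded_supports t F K" "bounded_supports t G K"
    using endofunctor.in_san_obj_iff[OF _ K, of t] F G K
    by (simp_all add: bounded_supports_def bounded_supports_axioms_def)
  then interpret F: bounded_supports t F K + G: bounded_supports t G K .
  show ?thesis
  proof
    assume "\<eta> \<in> san_hom K F G"
    then obtain R R' \<phi> \<psi> \<tau> where \<eta>: "is_nat_trans set_cat set_cat F G \<eta>"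
      and R: "is_functor (surj_cat K) set_cat R" "san_iso K F R \<phi>"
      and R': "is_functor (surj_cat K) set_cat R'" "san_iso K G R' \<psi>"
      and \<tau>: "is_nat_trans (surj_cat K) set_cat R R' \<tau>"
      and eq: "\<forall>X\<in>obj set_cat. \<forall>e\<in>omap F X. \<psi> X (\<eta> X e) = san_trans K R R' \<tau> X (\<phi> X e)"
      unfolding san_hom_def by (auto simp: fun_cat_def)
    interpret PF: presentation t K R F \<phi> using K R by unfold_locales
    interpret PG: presentation t K R' G \<psi> using K R' by unfold_locales
    have "supp G X (\<eta> X e) = supp F X e" if X: "small X" and e: "e \<in> omap F X" for X e
    proof -
      obtain a x r where t: "(a, x, r) \<in> san_triples K R X" "\<phi> X e = san_class K R X a x r"
        using PF.ex_triple[OF X e] by blast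
      have a: "a \<in> obj (surj_cat K)" and x: "x \<in> injections a X" and r: "r \<in> omap R a"
        using t(1) by (simp_all only: PF.san_triples_iff)
      have "\<tau> a \<in> hom set_cat (omap R a) (omap R' a)" using \<tau> a unfolding is_nat_trans_def by blast
      then have "(a, x, \<tau> a r) \<in> san_triples K R' X"
        unfolding PG.san_triples_iff using a x r by auto
      moreover have "\<psi> X (\<eta> X e) = san_class K R' X a x (\<tau> a r)"
        using eq X e t(2) PF.san_trans_class[OF t(1) PG.coefficients_axioms \<tau>] by simp
      moreover have "\<eta> X e \<in> omap G X" using PiE_mem[OF nat_trans_set_catD(1)[OF \<eta> X] e] .
      ultimately have "supp G X (\<eta> X e) = x ` {..<a}" using PG.supp_eq[OF X] by blast
      also have "\<dots> = supp F X e" using PF.supp_eq[OF X e t] by simp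
      finally show ?thesis .
    qed
    then show "is_nat_trans set_cat set_cat F G \<eta> \<and> semi_cartesian F G \<eta>"
      using \<eta> semi_cartesian_iff[OF F.supported_functor_axioms G.supported_functor_axioms \<eta>] by blast
  next
    assume "is_nat_trans set_cat set_cat F G \<eta> \<and> semi_cartesian F G \<eta>"
    then have \<eta>: "is_nat_trans set_cat set_cat F G \<eta>"
      and supp: "\<And>X e. small X \<Longrightarrow> e \<in> omap F X \<Longrightarrow> supp G X (\<eta> X e) = supp F X e"
      using semi_cartesian_iff[OF F.supported_functor_axioms G.supported_functor_axioms] by blast+
    note natural = nat_trans_set_catD(2)[OF \<eta>]
    have \<eta>_in: "\<eta> X e \<in> omap G X" if "small X" "e \<in> omap F X" for X e
      using PiE_mem[OF nat_trans_set_catD(1)[OF \<eta>]] that by blast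
    have \<eta>_generic: "\<eta> {..<a} r \<in> generic G a" if "r \<in> generic F a" for a r
      using that \<eta>_in[OF small_lessThan] supp[OF small_lessThan] by (simp add: generic_def)
    define \<tau> where "\<tau> = (\<lambda>a\<in>obj (surj_cat K). restrict (\<eta> {..<a}) (generic F a))"
    have \<tau>: "is_nat_trans (surj_cat K) set_cat (generic_coeffs F) (generic_coeffs G) \<tau>"
      unfolding is_nat_trans_def
    proof (intro conjI ballI)
      show "\<tau> \<in> extensional (obj (surj_cat K))" by (simp add: \<tau>_def)
    next
      fix a assume "a \<in> obj (surj_cat K)"
      then show "\<tau> a \<in> hom set_cat (omap (generic_coeffs F) a) (omap (generic_coeffs G) a)"
        using \<eta>_generic by (auto simp: \<tau>_def generic_coeffs_def)
    next
      fix a b s assume ab: "a \<in> obj (surj_cat K)" "b \<in> obj (surj_cat K)" and s: "s \<in> hom (surj_cat K) a b"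
      have s': "s \<in> {..<a} \<rightarrow>\<^sub>E {..<b}" "s ` {..<a} = {..<b}" using s by simp_all
      have "\<tau> b (amap (generic_coeffs F) a b s r) = amap (generic_coeffs G) a b s (\<tau> a r)"
        if r: "r \<in> generic F a" for r
        using ab r natural[OF small_lessThan small_lessThan s'(1)] \<eta>_generic F.generic_amap[OF s' r]
        by (simp add: \<tau>_def generic_coeffs_def generic_def)
      then show "cmp set_cat (omap (generic_coeffs F) a) (omap (generic_coeffs F) b) (omap (generic_coeffs G) b)
            (\<tau> b) (amap (generic_coeffs F) a b s) =
          cmp set_cat (omap (generic_coeffs F) a) (omap (generic_coeffs G) a) (omap (generic_coeffs G) b)
            (amap (generic_coeffs G) a b s) (\<tau> a)"
        by (simp add: compose_eq_iff) (simp add: generic_coeffs_def)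
    qed
    have "generic_presentation K G X (\<eta> X e) =
        san_trans K (generic_coeffs F) (generic_coeffs G) \<tau> X (generic_presentation K F X e)"
      if X: "small X" and e: "e \<in> omap F X" for X e
    proof -
      obtain a x r where t: "(a, x, r) \<in> san_triples K (generic_coeffs F) X" and xr: "amap F {..<a} X x r = e"
        using F.ex_generic_triple[OF X e] by blast
      note x = F.generic_triplesD[OF t]
      have \<tau>r: "\<tau> a r = \<eta> {..<a} r" using x(1,8) by (simp add: \<tau>_def)
      have t': "(a, x, \<tau> a r) \<in> san_triples K (generic_coeffs G) X"
        unfolding \<tau>r using x(1,5) \<eta>_generic[OF x(8)] by (simp add: san_triples_def generic_coeffs_def)
      have "\<eta> X e = amap G {..<a} X x (\<tau> a r)"
        unfolding xr[symmetric] \<tau>r by (rule natural[OF small_lessThan X x(3,6)])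
      then have "generic_presentation K G X (\<eta> X e) = san_class K (generic_coeffs G) X a x (\<tau> a r)"
        using G.generic_presentation_class[OF X t'] by simp
      also have "\<dots> = san_trans K (generic_coeffs F) (generic_coeffs G) \<tau> X
          (san_class K (generic_coeffs F) X a x r)"
        by (rule F.generic.san_trans_class[OF t G.generic.coefficients_axioms \<tau>, symmetric])
      also have "san_class K (generic_coeffs F) X a x r = generic_presentation K F X e"
        using F.generic_presentation_class[OF X t] xr by simp
      finally show ?thesis .
    qed
    then have "\<forall>X\<in>obj set_cat. \<forall>e\<in>omap F X. generic_presentation K G X (\<eta> X e) =
        san_trans K (generic_coeffs F) (generic_coeffs G) \<tau> X (generic_presentation K F X e)"
      by simp
    then show "\<eta> \<in> san_hom K F G"
      unfolding san_hom_def
      using \<eta> \<tau> F.san_iso_generic G.san_iso_generic F.is_functor_generic_coeffs G.is_functor_generic_coeffs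
      by (simp add: fun_cat_def) blast
  qed
qed

lemma San_mono: "k \<le> l \<Longrightarrow> universe (t :: 'u::wellorder itself) \<Longrightarrow> F \<in> obj (San (k :: 'u)) \<Longrightarrow> F \<in> obj (San l)"
proof -
  assume kl: "k \<le> l" and univ: "universe t" and F: "F \<in> obj (San k)"
  interpret endofunctor t F
    using F univ by (simp add: San_def san_obj_def fun_cat_def endofunctor_def endofunctor_axioms_def)
  show "F \<in> obj (San l)"
    using F less_le_trans[OF _ kl] unfolding in_San_iff_supp by blast
qed

lemma hom_fun_cat: "hom (fun_cat C D) F G = {\<eta>. is_nat_trans C D F G \<eta>}"
  by (simp add: fun_cat_def)

theorem theorem2p1:
  assumes "set_universe TYPE('u::wellorder)"
  shows
    "(\<forall>\<kappa>::'u. regular_cardinal \<kappa> \<longrightarrow>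
        (\<forall>F \<in> obj (fun_cat set_cat set_cat). F \<in> obj (San \<kappa>) \<longleftrightarrow>
           accessible \<kappa> F \<and> preserves_pullbacks_along_monos F \<and>
           preserves_wide_pullbacks_of_monos F)) \<and>
     (\<forall>F :: 'u endo \<in> obj (fun_cat set_cat set_cat). F \<in> obj San_inf \<longleftrightarrow>
        accessible_inf F \<and> preserves_pullbacks_along_monos F \<and>
        preserves_wide_pullbacks_of_monos F) \<and>
     (\<forall>F :: 'u endo \<in> obj (fun_cat set_cat set_cat). F \<in> obj SAN \<longleftrightarrow>
        preserves_pullbacks_along_monos F \<and> preserves_wide_pullbacks_of_monos F) \<and>
     (\<forall>\<kappa>::'u. regular_cardinal \<kappa> \<longrightarrow>
        (\<forall>F \<in> obj (San \<kappa>). \<forall>G \<in> obj (San \<kappa>). hom (San \<kappa>) F G =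
           {\<eta> \<in> hom (fun_cat set_cat set_cat) F G. semi_cartesian F G \<eta>})) \<and>
     (\<forall>F :: 'u endo \<in> obj San_inf. \<forall>G \<in> obj San_inf. hom San_inf F G =
        {\<eta> \<in> hom (fun_cat set_cat set_cat) F G. semi_cartesian F G \<eta>}) \<and>
     (\<forall>F :: 'u endo \<in> obj SAN. \<forall>G \<in> obj SAN. hom SAN F G =
        {\<eta> \<in> hom (fun_cat set_cat set_cat) F G. semi_cartesian F G \<eta>})"
proof -
  have univ: "universe TYPE('u)" using assms by (simp add: universe_def)
  have endo: "endofunctor TYPE('u) F" if "F \<in> obj (fun_cat set_cat set_cat)" for F :: "'u endo"
    using that univ by (simp add: fun_cat_def endofunctor_def endofunctor_axioms_def)
  have objects: "F \<in> obj (San k) \<longleftrightarrow> accessible k F \<and> preserves_pullbacks_along_monos F \<and>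
      preserves_wide_pullbacks_of_monos F"
    if "regular_cardinal k" "F \<in> obj (fun_cat set_cat set_cat)" for k :: 'u and F
    by (rule endofunctor.in_San_iff[OF endo[OF that(2)] that(1)])
  have objects_inf: "F \<in> obj San_inf \<longleftrightarrow> accessible_inf F \<and> preserves_pullbacks_along_monos F \<and>
      preserves_wide_pullbacks_of_monos F"
    if "F \<in> obj (fun_cat set_cat set_cat)" for F :: "'u endo"
    using objects[OF _ that] by (auto simp: San_inf_def accessible_inf_def)
  have objects_all: "F \<in> obj SAN \<longleftrightarrow> preserves_pullbacks_along_monos F \<and> preserves_wide_pullbacks_of_monos F"
    if "F \<in> obj (fun_cat set_cat set_cat)" for F :: "'u endo"
    by (rule endofunctor.in_SAN_iff[OF endo[OF that]])
  have hom_San: "hom (San k) F G = {\<eta> \<in> hom (fun_cat set_cat set_cat) F G. semi_cartesian F G \<eta>}"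
    if "F \<in> obj (San k)" "G \<in> obj (San k)" for k :: 'u and F G
    using san_hom_iff[where K = "{..<k}" and F = F and G = G, OF lessThan_downward univ] that
    by (auto simp: San_def hom_fun_cat)
  have hom_inf: "hom San_inf F G = {\<eta> \<in> hom (fun_cat set_cat set_cat) F G. semi_cartesian F G \<eta>}"
    if F: "F \<in> obj San_inf" and G: "G \<in> obj San_inf" for F G :: "'u endo"
  proof -
    obtain k l :: 'u where k: "regular_cardinal k" "F \<in> obj (San k)" and l: "regular_cardinal l" "G \<in> obj (San l)"
      using F G by (auto simp: San_inf_def)
    have m: "regular_cardinal (max k l)" using k(1) l(1) by (simp add: max_def)
    have m_obj: "F \<in> obj (San (max k l))" "G \<in> obj (San (max k l))"
      using San_mono[OF _ univ k(2)] San_mono[OF _ univ l(2)] by simp_all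
    \<comment> \<open>A transformation induced by coefficients below \<open>j\<close> presents its source and target by them.\<close>
    have j_obj: "F \<in> obj (San j)" "G \<in> obj (San j)" if "\<eta> \<in> hom (San j) F G" for j \<eta>
      using that k(2) l(2) by (auto simp: San_def san_obj_def san_hom_def)
    show ?thesis
    proof (rule set_eqI)
      fix \<eta>
      have "\<eta> \<in> hom San_inf F G \<longleftrightarrow> (\<exists>j. regular_cardinal j \<and> \<eta> \<in> hom (San j) F G)"
        by (auto simp: San_inf_def)
      also have "\<dots> \<longleftrightarrow> \<eta> \<in> {\<eta> \<in> hom (fun_cat set_cat set_cat) F G. semi_cartesian F G \<eta>}"
        using j_obj hom_San m hom_San[OF m_obj] by blast
      finally show "\<eta> \<in> hom San_inf F G \<longleftrightarrow>
        \<eta> \<in> {\<eta> \<in> hom (fun_cat set_cat set_cat) F G. semi_cartesian F G \<eta>}" .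
    qed
  qed
  have hom_all: "hom SAN F G = {\<eta> \<in> hom (fun_cat set_cat set_cat) F G. semi_cartesian F G \<eta>}"
    if "F \<in> obj SAN" "G \<in> obj SAN" for F G :: "'u endo"
    using san_hom_iff[where K = UNIV and F = F and G = G, OF _ univ] that by (auto simp: SAN_def hom_fun_cat)
  show ?thesis
    using objects objects_inf objects_all hom_San hom_inf hom_all by blast
qed

end
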